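(* Let $G$ be Hall's universal locally finite group and let $\mathbb{U}$ be the Urysohn universal metric space. There exists a Polish group $\mathbb{H}$ such that for comeager many $\alpha\in\mathrm{Hom}(G,\mathrm{Iso}(\mathbb{U}))$ the closure $\overline{\alpha[G]}$ of $\alpha[G]$ in $\mathrm{Iso}(\mathbb{U})$ is topologically isomorphic to $\mathbb{H}$.
   Context: Hall's universal locally finite group is the Fraïssé limit of the class of all finite groups: the unique countable locally finite group $G$ (every finitely generated subgroup is finite) such that every finite group embeds into $G$ and, for all finite groups $A\leq B$, every injective homomorphism $A\to G$ extends to an injective homomorphism $B\to G$. The Urysohn universal metric space $\mathbb{U}$ is the completion of the Fraïssé limit of the class of all finite metric spaces with rational distances. $\mathrm{Iso}(\mathbb{U})$ is the Polish group of all isometries of $\mathbb{U}$ onto itself with the topology of pointwise convergence, and $\mathrm{Hom}(G,\mathrm{Iso}(\mathbb{U}))$ is the set of all group homomorphisms $G\to\mathrm{Iso}(\mathbb{U})$, a closed subspace of the product $\mathrm{Iso}(\mathbb{U})^G$, hence a Polish space. *)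

theory Defs
  imports "HOL-Analysis.Analysis" "HOL-Algebra.Generated_Groups"
begin

text \<open>
  Every finite group and every finite metric space has a copy whose carrier is a set of natural
  numbers, so quantifying over carriers in \<^typ>\<open>nat\<close> covers all finite structures.
\<close>

definition locally_finite_group :: "('g, 'm) monoid_scheme \<Rightarrow> bool" where
  "locally_finite_group G \<longleftrightarrow>
     group G \<and> (\<forall>S. finite S \<and> S \<subseteq> carrier G \<longrightarrow> finite (generate G S))"

definition hall_universal_group :: "('g, 'm) monoid_scheme \<Rightarrow> bool" where
  "hall_universal_group G \<longleftrightarrow>
     locally_finite_group G \<and> countable (carrier G) \<and>
     (\<forall>F :: nat monoid. group F \<and> finite (carrier F) \<longrightarrow> mon F G \<noteq> {}) \<and>
     (\<forall>(B :: nat monoid) A f.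
        group B \<and> finite (carrier B) \<and> subgroup A B \<and> f \<in> mon (B\<lparr>carrier := A\<rparr>) G \<longrightarrow>
        (\<exists>h \<in> mon B G. \<forall>x\<in>A. h x = f x))"

definition isometric_on :: "'a set \<Rightarrow> ('a::metric_space \<Rightarrow> 'b::metric_space) \<Rightarrow> bool" where
  "isometric_on A f \<longleftrightarrow> (\<forall>x\<in>A. \<forall>y\<in>A. dist (f x) (f y) = dist x y)"

text \<open>
  The Fraisse limit of the finite metric spaces with rational distances: a countable
  space whose finite subspaces are, up to isometry, exactly those spaces, and which is
  ultrahomogeneous.
\<close>

definition rational_urysohn :: "'a::metric_space set \<Rightarrow> bool" where
  "rational_urysohn Q \<longleftrightarrow>
     countable Q \<and>
     (\<forall>x\<in>Q. \<forall>y\<in>Q. dist x y \<in> \<rat>) \<and>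
     (\<forall>(F :: nat set) d. finite F \<and> Metric_space F d \<and> (\<forall>x\<in>F. \<forall>y\<in>F. d x y \<in> \<rat>) \<longrightarrow>
        (\<exists>f. f ` F \<subseteq> Q \<and> (\<forall>x\<in>F. \<forall>y\<in>F. dist (f x) (f y) = d x y))) \<and>
     (\<forall>A f. finite A \<and> A \<subseteq> Q \<and> f ` A \<subseteq> Q \<and> isometric_on A f \<longrightarrow>
        (\<exists>g. bij_betw g Q Q \<and> isometric_on Q g \<and> (\<forall>x\<in>A. g x = f x)))"

text \<open>The type \<^typ>\<open>'u\<close> with its metric is the completion of a rational Urysohn space.\<close>

definition urysohn_space :: "'u::metric_space itself \<Rightarrow> bool" where
  "urysohn_space _ \<longleftrightarrow>
     complete (UNIV :: 'u set) \<and> (\<exists>Q :: 'u set. rational_urysohn Q \<and> closure Q = UNIV)"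

definition isometry_group :: "('u::metric_space \<Rightarrow> 'u) monoid" where
  "isometry_group =
     \<lparr>carrier = {f. surj f \<and> isometric_on UNIV f}, mult = (\<circ>), one = id\<rparr>"

definition isometry_topology :: "('u::metric_space \<Rightarrow> 'u) topology" where
  "isometry_topology =
     subtopology (product_topology (\<lambda>_. euclidean) UNIV) (carrier isometry_group)"

text \<open>
  The points of a product topology indexed by \<^term>\<open>carrier G\<close> are extensional, so each
  homomorphism is represented by exactly one point here.
\<close>

definition hom_topology ::
  "('g, 'm) monoid_scheme \<Rightarrow> ('g \<Rightarrow> ('u::metric_space \<Rightarrow> 'u)) topology" where
  "hom_topology G =
     subtopology (product_topology (\<lambda>_. isometry_topology) (carrier G)) (hom G isometry_group)"

definition meager_in :: "'a topology \<Rightarrow> 'a set \<Rightarrow> bool" where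
  "meager_in X A \<longleftrightarrow>
     (\<exists>\<N>. countable \<N> \<and> A = \<Union>\<N> \<and>
        (\<forall>N\<in>\<N>. N \<subseteq> topspace X \<and> X interior_of (X closure_of N) = {}))"

definition comeager_in :: "'a topology \<Rightarrow> 'a set \<Rightarrow> bool" where
  "comeager_in X A \<longleftrightarrow> A \<subseteq> topspace X \<and> meager_in X (topspace X - A)"

definition topological_group :: "('a, 'm) monoid_scheme \<Rightarrow> 'a topology \<Rightarrow> bool" where
  "topological_group H T \<longleftrightarrow>
     group H \<and> topspace T = carrier H \<and>
     continuous_map (prod_topology T T) T (\<lambda>(x, y). x \<otimes>\<^bsub>H\<^esub> y) \<and>
     continuous_map T T (\<lambda>x. inv\<^bsub>H\<^esub> x)"

definition polish_group :: "('a, 'm) monoid_scheme \<Rightarrow> 'a topology \<Rightarrow> bool" where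
  "polish_group H T \<longleftrightarrow>
     topological_group H T \<and> separable_space T \<and> completely_metrizable_space T"

definition topologically_isomorphic ::
  "('a, 'm) monoid_scheme \<Rightarrow> 'a topology \<Rightarrow> ('b, 'n) monoid_scheme \<Rightarrow> 'b topology \<Rightarrow> bool" where
  "topologically_isomorphic G S H T \<longleftrightarrow> (\<exists>\<phi> \<in> iso G H. homeomorphic_map S T \<phi>)"

definition image_closure ::
  "('g, 'm) monoid_scheme \<Rightarrow> ('g \<Rightarrow> ('u::metric_space \<Rightarrow> 'u)) \<Rightarrow> ('u \<Rightarrow> 'u) set" where
  "image_closure G \<alpha> = isometry_topology closure_of (\<alpha> ` carrier G)"

lemma isometry_group_is_group: "group (isometry_group :: ('u::metric_space \<Rightarrow> 'u) monoid)"
proof (rule groupI)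
  fix f :: "'u \<Rightarrow> 'u" assume "f \<in> carrier isometry_group"
  then have s: "surj f" and d: "\<And>x y. dist (f x) (f y) = dist x y"
    by (auto simp: isometry_group_def isometric_on_def)
  have "inj f" by (rule injI) (metis d dist_eq_0_iff)
  with s have "bij f" by (simp add: bij_def)
  then have "surj (inv_into UNIV f)" "inv_into UNIV f \<circ> f = id"
    by (auto simp: bij_is_inj bij_imp_bij_inv bij_is_surj)
  moreover have "dist (inv_into UNIV f x) (inv_into UNIV f y) = dist x y" for x y
    by (metis d s surj_f_inv_f)
  ultimately show "\<exists>g \<in> carrier isometry_group. g \<otimes>\<^bsub>isometry_group\<^esub> f = \<one>\<^bsub>isometry_group\<^esub>"
    by (auto simp: isometry_group_def isometric_on_def)
next
  fix f g :: "'u \<Rightarrow> 'u"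
  assume "f \<in> carrier isometry_group" "g \<in> carrier isometry_group"
  then show "f \<otimes>\<^bsub>isometry_group\<^esub> g \<in> carrier isometry_group"
    using comp_surj[of g f] by (simp add: isometry_group_def isometric_on_def)
qed (auto simp: isometry_group_def isometric_on_def o_assoc)

lemma topspace_isometry_topology: "topspace isometry_topology = carrier isometry_group"
  by (simp add: isometry_topology_def)

lemma topspace_hom_topology:
  "topspace (hom_topology G) = hom G isometry_group \<inter> extensional (carrier G)"
  by (auto simp: hom_topology_def topspace_isometry_topology PiE_def hom_def)

end

theory Submission
  imports Defs "HOL-Combinatorics.Permutations" "HOL-Algebra.Weak_Morphisms"
begin

text \<open>
  A homomorphism \<open>\<alpha>\<close> from \<open>G\<close> to the isometry group together with points \<open>x i\<close> is recorded, up to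
  isometry, by the numbers \<open>\<rho> i j g = dist (x i) (\<alpha> g (x j))\<close>: an orbit pseudometric. Call \<open>\<alpha>\<close>
  generic if every orbit metric on a finite overgroup of a finite group already embedded in \<open>G\<close>,
  nearly agreeing with what \<open>\<alpha>\<close> does to some given points, is nearly realised by \<open>\<alpha>\<close> after the
  embedding has been extended and the given points have been moved slightly
  (\<open>generic_extension\<close>).

  Any two generic homomorphisms \<open>\<alpha>\<close> and \<open>\<beta>\<close> are matched by a back-and-forth argument in which the
  group elements are matched exactly and the points only up to an error \<open>2\<^sup>-\<^sup>n\<close> at stage \<open>n\<close>. The
  limit is an isometry \<open>\<phi>\<close> and a map \<open>\<theta>\<close> of \<open>G\<close> onto itself with \<open>\<phi> \<circ> \<alpha> g = \<beta> (\<theta> g) \<circ> \<phi>\<close>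
  (\<open>generic_actions_conjugate\<close>). So conjugation by \<open>\<phi>\<close>, a topological automorphism of the isometry
  group, carries the image of \<open>\<alpha>\<close> onto the image of \<open>\<beta>\<close>, and one closure onto the other.

  Genericity is a comeager condition. It suffices to test countably many rational data, and for
  fixed data the homomorphisms with a realisation form an open set; the point is that this set is
  dense where it can be (\<open>realizes_extension_dense\<close>). Let \<open>\<beta>0\<close> be a homomorphism whose values on a
  finite subgroup \<open>F2\<close> and on finitely many points are to be nearly kept, and let an orbit metric
  on a finite group \<open>F1\<close> be given that nearly agrees with \<open>\<beta>0\<close> on a common subgroup. The two
  actions are amalgamated: \<open>F1\<close> and \<open>F2\<close> embed into one finite group carrying one orbit
  pseudometric that restricts to the two given ones (\<open>amalgam_exists\<close>), and universality puts this
  group inside \<open>G\<close> over \<open>F2\<close> (\<open>hall_amalgam\<close>). A rational orbit metric on a finite subgroup extends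
  to one on all of \<open>G\<close> with countably many orbits that has the one-point extension property
  (\<open>universal_orbit_metric\<close>); as a metric space it is then the rational Urysohn space
  (\<open>isometric_back_and_forth\<close>), and left translation is the required action of \<open>G\<close>.

  Finite groups with orbit metrics can be amalgamated because of the following construction. In
  the free amalgamated product of \<open>F1\<close> and \<open>F2\<close> the two actions glue freely, along a tree of
  copies of the two spaces. A large constant \<open>D\<close> minus the distance to a base point, cut off at
  \<open>0\<close>, vanishes outside a bounded part of this tree, since every passage to a new coset costs at
  least the separation \<open>\<delta>\<close> of the metrics. So the tree may be truncated at a finite depth and closed
  up to a finite set with actions of both groups, and all given distances can be read off from
  these functions on the finite set as suprema of differences.
\<close>

section \<open>Orbit pseudometrics\<close>

text \<open>
  Read \<open>\<rho> i j g\<close> as the distance from \<open>x i\<close> to \<open>g\<close> applied to \<open>x j\<close>. The conditions say that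
  \<open>\<rho> i j (inv g \<otimes> h)\<close> is a left invariant pseudometric on pairs \<open>(g, i)\<close> and \<open>(h, j)\<close>.
\<close>

definition orbit_pseudometric ::
  "('g, 'm) monoid_scheme \<Rightarrow> 'g set \<Rightarrow> 'i set \<Rightarrow> ('i \<Rightarrow> 'i \<Rightarrow> 'g \<Rightarrow> real) \<Rightarrow> bool" where
  "orbit_pseudometric G F I \<rho> \<longleftrightarrow>
     (\<forall>i\<in>I. \<rho> i i \<one>\<^bsub>G\<^esub> = 0) \<and>
     (\<forall>i\<in>I. \<forall>j\<in>I. \<forall>g\<in>F. \<rho> i j g = \<rho> j i (inv\<^bsub>G\<^esub> g)) \<and>
     (\<forall>i\<in>I. \<forall>j\<in>I. \<forall>k\<in>I. \<forall>g\<in>F. \<forall>h\<in>F. \<rho> i k (g \<otimes>\<^bsub>G\<^esub> h) \<le> \<rho> i j g + \<rho> j k h)"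

lemma orbit_pseudometricD:
  assumes "orbit_pseudometric G F I \<rho>"
  shows "i \<in> I \<Longrightarrow> \<rho> i i \<one>\<^bsub>G\<^esub> = 0"
    and "i \<in> I \<Longrightarrow> j \<in> I \<Longrightarrow> g \<in> F \<Longrightarrow> \<rho> i j g = \<rho> j i (inv\<^bsub>G\<^esub> g)"
    and "i \<in> I \<Longrightarrow> j \<in> I \<Longrightarrow> k \<in> I \<Longrightarrow> g \<in> F \<Longrightarrow> h \<in> F \<Longrightarrow>
           \<rho> i k (g \<otimes>\<^bsub>G\<^esub> h) \<le> \<rho> i j g + \<rho> j k h"
  using assms by (auto simp: orbit_pseudometric_def)

lemma orbit_pseudometric_nonneg:
  assumes "group G" "subgroup F G" "orbit_pseudometric G F I \<rho>" "i \<in> I" "j \<in> I" "g \<in> F"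
  shows "0 \<le> \<rho> i j g"
proof -
  interpret group G by fact
  have "inv\<^bsub>G\<^esub> g \<in> F" "g \<in> carrier G"
    using assms by (auto intro: subgroup.m_inv_closed subgroup.mem_carrier)
  then have "\<rho> i i \<one>\<^bsub>G\<^esub> \<le> \<rho> i j g + \<rho> j i (inv\<^bsub>G\<^esub> g)"
    using orbit_pseudometricD(3)[OF assms(3), of i j i g "inv\<^bsub>G\<^esub> g"] assms by simp
  then show ?thesis
    using orbit_pseudometricD(1,2)[OF assms(3)] assms by simp
qed

text \<open>
  A maximum over a possibly empty finite set of values that are all at least \<open>0\<close>, or of which only
  the positive part matters.
\<close>

definition sup0 :: "'a set \<Rightarrow> ('a \<Rightarrow> real) \<Rightarrow> real" where
  "sup0 A f = Max (insert 0 (f ` A))"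

lemma sup0_le_iff: "finite A \<Longrightarrow> sup0 A f \<le> c \<longleftrightarrow> 0 \<le> c \<and> (\<forall>a\<in>A. f a \<le> c)"
  by (simp add: sup0_def)

lemma sup0_upper: "finite A \<Longrightarrow> a \<in> A \<Longrightarrow> f a \<le> sup0 A f"
  by (simp add: sup0_def)

lemma sup0_nonneg: "finite A \<Longrightarrow> 0 \<le> sup0 A f"
  by (simp add: sup0_def)

definition permutation_group :: "'a set \<Rightarrow> ('a \<Rightarrow> 'a) monoid" where
  "permutation_group S = \<lparr>carrier = {p. p permutes S}, mult = (\<circ>), one = id\<rparr>"

lemma group_permutation_group: "group (permutation_group S)"
proof (rule groupI)
  fix p assume "p \<in> carrier (permutation_group S)"
  then have "p permutes S" by (simp add: permutation_group_def)
  then show "\<exists>q\<in>carrier (permutation_group S). q \<otimes>\<^bsub>permutation_group S\<^esub> p = \<one>\<^bsub>permutation_group S\<^esub>"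
    by (intro bexI[of _ "inv_into UNIV p"])
       (auto simp: permutation_group_def permutes_inv permutes_inv_o)
qed (auto simp: permutation_group_def permutes_compose permutes_id o_assoc)

lemma inv_permutation_group: "p permutes S \<Longrightarrow> inv\<^bsub>permutation_group S\<^esub> p = inv_into UNIV p"
  by (rule group.inv_equality[OF group_permutation_group])
     (auto simp: permutation_group_def permutes_inv permutes_inv_o)

text \<open>
  Permutations of \<open>\<Omega>\<close> act on functions on \<open>\<Omega>\<close> by isometries of the supremum distance, so families
  \<open>v a k\<close> of functions give points indexed by \<open>k\<close>, each with one coordinate for every label \<open>a\<close>.
\<close>

lemma orbit_pseudometric_permutations:
  fixes v :: "'l \<Rightarrow> 'k \<Rightarrow> 'w \<Rightarrow> real"
  assumes "finite \<Lambda>" "finite \<Omega>"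
  shows "orbit_pseudometric (permutation_group \<Omega>) {p. p permutes \<Omega>} I
    (\<lambda>k l p. sup0 (\<Lambda> \<times> \<Omega>) (\<lambda>(a, \<omega>). \<bar>v a k \<omega> - v a l (inv_into UNIV p \<omega>)\<bar>))"
proof -
  define \<sigma> where "\<sigma> = (\<lambda>k l p. sup0 (\<Lambda> \<times> \<Omega>) (\<lambda>(a, \<omega>). \<bar>v a k \<omega> - v a l (inv_into UNIV p \<omega>)\<bar>))"
  have fin: "finite (\<Lambda> \<times> \<Omega>)" using assms by simp
  have up: "\<bar>v a k \<omega> - v a l (inv_into UNIV p \<omega>)\<bar> \<le> \<sigma> k l p" if "a \<in> \<Lambda>" "\<omega> \<in> \<Omega>" for a k l p \<omega>
    unfolding \<sigma>_def using sup0_upper[OF fin, of "(a, \<omega>)" "\<lambda>(a, \<omega>). \<bar>v a k \<omega> - v a l (inv_into UNIV p \<omega>)\<bar>"] that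
    by simp
  have le: "\<sigma> k l p \<le> c" if "0 \<le> c" "\<And>a \<omega>. a \<in> \<Lambda> \<Longrightarrow> \<omega> \<in> \<Omega> \<Longrightarrow> \<bar>v a k \<omega> - v a l (inv_into UNIV p \<omega>)\<bar> \<le> c" for k l p c
    unfolding \<sigma>_def using that by (subst sup0_le_iff[OF fin]) auto
  have nn: "0 \<le> \<sigma> k l p" for k l p unfolding \<sigma>_def by (rule sup0_nonneg[OF fin])
  have sym: "\<sigma> k l p \<le> \<sigma> l k (inv_into UNIV p)" if p: "p permutes \<Omega>" for k l p
  proof (rule le[OF nn])
    fix a \<omega> assume a: "a \<in> \<Lambda>" "\<omega> \<in> \<Omega>"
    have "inv_into UNIV p \<omega> \<in> \<Omega>" using a p by (simp add: permutes_in_image permutes_inv)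
    from up[OF a(1) this, of l k "inv_into UNIV p"]
    show "\<bar>v a k \<omega> - v a l (inv_into UNIV p \<omega>)\<bar> \<le> \<sigma> l k (inv_into UNIV p)"
      using p by (simp add: permutes_inv_inv permutes_inverses abs_minus_commute)
  qed
  have "orbit_pseudometric (permutation_group \<Omega>) {p. p permutes \<Omega>} I \<sigma>"
    unfolding orbit_pseudometric_def
  proof (safe)
    show "\<sigma> k k \<one>\<^bsub>permutation_group \<Omega>\<^esub> = 0" for k
      by (rule antisym[OF le nn]) (auto simp: permutation_group_def)
    show "\<sigma> k l p = \<sigma> l k (inv\<^bsub>permutation_group \<Omega>\<^esub> p)" if p: "p permutes \<Omega>" for k l p
      using sym[OF p, of k l] sym[OF permutes_inv[OF p], of l k] p
      by (simp add: inv_permutation_group permutes_inv_inv)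
    fix k l m p q assume p: "p permutes \<Omega>" and q: "q permutes \<Omega>"
    have "\<sigma> k m (p \<circ> q) \<le> \<sigma> k l p + \<sigma> l m q"
    proof (rule le)
      fix a \<omega> assume a: "a \<in> \<Lambda>" "\<omega> \<in> \<Omega>"
      have "inv_into UNIV p \<omega> \<in> \<Omega>" using a p by (simp add: permutes_in_image permutes_inv)
      from up[OF a(1) this, of l m q] up[OF a, of k l p]
      show "\<bar>v a k \<omega> - v a m (inv_into UNIV (p \<circ> q) \<omega>)\<bar> \<le> \<sigma> k l p + \<sigma> l m q"
        using p q by (simp add: o_inv_distrib permutes_bij)
    qed (simp add: nn)
    then show "\<sigma> k m (p \<otimes>\<^bsub>permutation_group \<Omega>\<^esub> q) \<le> \<sigma> k l p + \<sigma> l m q"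
      by (simp add: permutation_group_def)
  qed
  then show ?thesis by (simp add: \<sigma>_def)
qed

lemma finite_group_nat_copy:
  assumes "group A" "finite (carrier A)"
  shows "\<exists>(B :: nat monoid) h. group B \<and> finite (carrier B) \<and> h \<in> iso A B"
proof -
  obtain h :: "'a \<Rightarrow> nat" where h: "inj_on h (carrier A)"
    using finite_imp_inj_to_nat_seg[OF assms(2)] by blast
  interpret group A by fact
  have "h \<in> iso A (image_group h A)" "group (image_group h A)"
    using inj_imp_image_group_iso[OF h] inj_imp_image_group_is_group[OF h] by auto
  moreover have "finite (carrier (image_group h A))"
    using assms by (simp add: image_group_def)
  ultimately show ?thesis by blast
qed

section \<open>Amalgamation of two finite groups with orbit metrics\<close>

lemma coset_representatives:
  fixes G (structure)
  assumes "group G" and P: "subgroup P G" and N: "subgroup N G" "N \<subseteq> P"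
  shows "\<exists>rep. (\<forall>x\<in>P. rep x \<in> P) \<and> (\<forall>n\<in>N. \<forall>x\<in>P. rep (n \<otimes> x) = rep x) \<and>
           (\<forall>x\<in>P. \<exists>n\<in>N. x = n \<otimes> rep x) \<and> rep \<one> = \<one>"
proof -
  interpret group G by fact
  note cl = subgroup.mem_carrier[OF P] subgroup.mem_carrier[OF N(1)] subgroup.m_closed[OF N(1)]
    subgroup.m_inv_closed[OF N(1)] subgroup.m_closed[OF P] subgroup.one_closed[OF N(1)]
  define rep where "rep x = (if x \<in> N then \<one> else SOME y. y \<in> P \<and> (\<exists>n\<in>N. x = n \<otimes> y))" for x
  have ex: "\<exists>y. y \<in> P \<and> (\<exists>n\<in>N. x = n \<otimes> y)" if "x \<in> P" for x
    using that cl by (metis l_one)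
  have some: "(SOME y. y \<in> P \<and> (\<exists>n\<in>N. x = n \<otimes> y)) \<in> P \<and>
      (\<exists>n\<in>N. x = n \<otimes> (SOME y. y \<in> P \<and> (\<exists>n\<in>N. x = n \<otimes> y)))" if "x \<in> P" for x
    using someI_ex[OF ex[OF that]] .
  have 1: "rep x \<in> P" "\<exists>n\<in>N. x = n \<otimes> rep x" if "x \<in> P" for x
    using some[OF that] that subgroup.one_closed[OF P] cl by (auto simp: rep_def)
  have 2: "rep (n \<otimes> x) = rep x" if "n \<in> N" "x \<in> P" for n x
  proof -
    have "n \<otimes> x \<in> N \<longleftrightarrow> x \<in> N"
      using that cl by (metis inv_solve_left)
    moreover have "(\<exists>m\<in>N. n \<otimes> x = m \<otimes> y) \<longleftrightarrow> (\<exists>m\<in>N. x = m \<otimes> y)" if "y \<in> P" for y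
    proof
      assume "\<exists>m\<in>N. n \<otimes> x = m \<otimes> y"
      then obtain m where "m \<in> N" "n \<otimes> x = m \<otimes> y" by auto
      then have "x = (inv n \<otimes> m) \<otimes> y"
        using \<open>n \<in> N\<close> \<open>x \<in> P\<close> that cl by (metis inv_solve_left m_assoc m_closed inv_closed)
      then show "\<exists>m\<in>N. x = m \<otimes> y" using \<open>m \<in> N\<close> \<open>n \<in> N\<close> cl by blast
    next
      assume "\<exists>m\<in>N. x = m \<otimes> y"
      then show "\<exists>m\<in>N. n \<otimes> x = m \<otimes> y"
        using \<open>n \<in> N\<close> that cl by (metis m_assoc)
    qed
    then have "(\<lambda>y. y \<in> P \<and> (\<exists>m\<in>N. n \<otimes> x = m \<otimes> y)) = (\<lambda>y. y \<in> P \<and> (\<exists>m\<in>N. x = m \<otimes> y))"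
      by (intro ext) blast
    ultimately show ?thesis by (simp add: rep_def)
  qed
  have "rep \<one> = \<one>" using cl by (simp add: rep_def)
  with 1 2 show ?thesis by blast
qed

text \<open>
  The two factors are indexed by a truth value because every step below alternates between them.
  The common subgroup \<open>P0\<close> enters both through \<open>\<theta>\<close>. The points with index in \<open>I0\<close> are shared, but
  the two metrics agree on their orbits only up to \<open>\<epsilon>\<close>; in the amalgam the two copies of such a
  point are at distance at most \<open>\<epsilon>\<close>. The lower bound \<open>\<delta>\<close> is what bounds the depth of the tree.
\<close>

locale metric_amalgam = group G for G :: "('g, 'm) monoid_scheme" (structure) +
  fixes P0 :: "'g set" and P :: "bool \<Rightarrow> 'g set" and \<theta> :: "bool \<Rightarrow> 'g \<Rightarrow> 'g"
    and I :: "bool \<Rightarrow> nat set" and I0 :: "nat set" and \<rho> :: "bool \<Rightarrow> nat \<Rightarrow> nat \<Rightarrow> 'g \<Rightarrow> real"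
    and \<epsilon> \<delta> :: real
  assumes sub0: "subgroup P0 G" and fin0: "finite P0"
    and subP: "\<And>b. subgroup (P b) G" and finP: "\<And>b. finite (P b)"
    and emb: "\<And>b. \<theta> b \<in> mon (G\<lparr>carrier := P0\<rparr>) (G\<lparr>carrier := P b\<rparr>)"
    and finI: "\<And>b. finite (I b)" and I0: "\<And>b. I0 \<subseteq> I b"
    and opm: "\<And>b. orbit_pseudometric G (P b) (I b) (\<rho> b)"
    and sep: "\<And>b i j g. i \<in> I b \<Longrightarrow> j \<in> I b \<Longrightarrow> g \<in> P b \<Longrightarrow> g \<noteq> \<one> \<Longrightarrow> \<delta> \<le> \<rho> b i j g"
    and pos: "0 < \<delta>" "0 \<le> \<epsilon>"
    and close: "\<And>i j f. i \<in> I0 \<Longrightarrow> j \<in> I0 \<Longrightarrow> f \<in> P0 \<Longrightarrow>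
                  \<bar>\<rho> True i j (\<theta> True f) - \<rho> False i j (\<theta> False f)\<bar> \<le> \<epsilon>"
begin

lemma PC: "x \<in> P b \<Longrightarrow> x \<in> carrier G" using subgroup.mem_carrier[OF subP] .
lemma P_closed [simp]: "x \<in> P b \<Longrightarrow> y \<in> P b \<Longrightarrow> x \<otimes> y \<in> P b" using subgroup.m_closed[OF subP] .
lemma P_inv [simp]: "x \<in> P b \<Longrightarrow> inv x \<in> P b" using subgroup.m_inv_closed[OF subP] .
lemma P_one [simp]: "\<one> \<in> P b" using subgroup.one_closed[OF subP] .
lemma P0C: "x \<in> P0 \<Longrightarrow> x \<in> carrier G" using subgroup.mem_carrier[OF sub0] .
lemma P0_closed [simp]: "x \<in> P0 \<Longrightarrow> y \<in> P0 \<Longrightarrow> x \<otimes> y \<in> P0" using subgroup.m_closed[OF sub0] .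
lemma P0_inv [simp]: "x \<in> P0 \<Longrightarrow> inv x \<in> P0" using subgroup.m_inv_closed[OF sub0] .
lemma P0_one [simp]: "\<one> \<in> P0" using subgroup.one_closed[OF sub0] .

lemma \<theta>P [simp]: "f \<in> P0 \<Longrightarrow> \<theta> b f \<in> P b"
  using emb[of b] by (auto simp: mon_def hom_def)
lemma \<theta>_mult: "f \<in> P0 \<Longrightarrow> h \<in> P0 \<Longrightarrow> \<theta> b (f \<otimes> h) = \<theta> b f \<otimes> \<theta> b h"
  using emb[of b] by (auto simp: mon_def hom_def)
lemma \<theta>_inj: "inj_on (\<theta> b) P0"
  using emb[of b] by (auto simp: mon_def)
lemma \<theta>_one [simp]: "\<theta> b \<one> = \<one>"
proof -
  have "\<theta> b \<one> \<otimes> \<theta> b \<one> = \<theta> b \<one>" using \<theta>_mult[of \<one> \<one> b] by simp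
  then show ?thesis using PC[OF \<theta>P[OF P0_one]] by simp
qed
lemma \<theta>_inv: "f \<in> P0 \<Longrightarrow> \<theta> b (inv f) = inv (\<theta> b f)"
proof -
  assume f: "f \<in> P0"
  then have "\<theta> b (inv f) \<otimes> \<theta> b f = \<one>"
    using \<theta>_mult[of "inv f" f b] P0C by simp
  then show ?thesis using f PC[OF \<theta>P, of _ b] by (simp add: inv_equality)
qed
lemma \<theta>_subgroup: "subgroup (\<theta> b ` P0) G"
proof (rule subgroupI)
  show "\<theta> b ` P0 \<subseteq> carrier G" "\<theta> b ` P0 \<noteq> {}" using PC[OF \<theta>P] P0_one by blast+
  show "inv a \<in> \<theta> b ` P0" if "a \<in> \<theta> b ` P0" for a
    using that by (auto simp: \<theta>_inv[symmetric])
  show "x \<otimes> y \<in> \<theta> b ` P0" if "x \<in> \<theta> b ` P0" "y \<in> \<theta> b ` P0" for x y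
    using that by (auto simp: \<theta>_mult[symmetric])
qed

lemma \<rho>_nonneg: "i \<in> I b \<Longrightarrow> j \<in> I b \<Longrightarrow> g \<in> P b \<Longrightarrow> 0 \<le> \<rho> b i j g"
  using orbit_pseudometric_nonneg[OF is_group subP opm] .

definition rep :: "bool \<Rightarrow> 'g \<Rightarrow> 'g" where
  "rep b = (SOME r. (\<forall>x\<in>P b. r x \<in> P b) \<and> (\<forall>n\<in>\<theta> b ` P0. \<forall>x\<in>P b. r (n \<otimes> x) = r x) \<and>
           (\<forall>x\<in>P b. \<exists>n\<in>\<theta> b ` P0. x = n \<otimes> r x) \<and> r \<one> = \<one>)"

lemma rep_all: "(\<forall>x\<in>P b. rep b x \<in> P b) \<and> (\<forall>n\<in>\<theta> b ` P0. \<forall>x\<in>P b. rep b (n \<otimes> x) = rep b x) \<and>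
           (\<forall>x\<in>P b. \<exists>n\<in>\<theta> b ` P0. x = n \<otimes> rep b x) \<and> rep b \<one> = \<one>"
proof -
  have "\<theta> b ` P0 \<subseteq> P b" by auto
  from someI_ex[OF coset_representatives[OF is_group subP \<theta>_subgroup this]]
  show ?thesis unfolding rep_def .
qed

lemma rep_P [simp]: "x \<in> P b \<Longrightarrow> rep b x \<in> P b"
  and rep_\<theta> [simp]: "f \<in> P0 \<Longrightarrow> x \<in> P b \<Longrightarrow> rep b (\<theta> b f \<otimes> x) = rep b x"
  and rep_one [simp]: "rep b \<one> = \<one>"
  using rep_all[of b] by auto

lemma rep_decomp: "x \<in> P b \<Longrightarrow> \<exists>f\<in>P0. x = \<theta> b f \<otimes> rep b x"
  using rep_all[of b] by auto

text \<open>
  A transversal for the right cosets of the image of \<open>P0\<close>; together with the \<open>P0\<close>-coordinate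
  \<open>par\<close> it identifies \<open>P b\<close> with \<open>P0 \<times> S b\<close>.
\<close>

definition S :: "bool \<Rightarrow> 'g set" where "S b = rep b ` P b"

definition par :: "bool \<Rightarrow> 'g \<Rightarrow> 'g" where
  "par b x = (SOME f. f \<in> P0 \<and> x = \<theta> b f \<otimes> rep b x)"

lemma S_P: "s \<in> S b \<Longrightarrow> s \<in> P b" by (auto simp: S_def)
lemma rep_S: "x \<in> P b \<Longrightarrow> rep b x \<in> S b" by (auto simp: S_def)
lemma one_S [simp]: "\<one> \<in> S b" using rep_S[of \<one> b] by simp
lemma finS: "finite (S b)" by (simp add: S_def finP)
lemma rep_idem: "s \<in> S b \<Longrightarrow> rep b s = s"
proof -
  assume "s \<in> S b"
  then obtain x where x: "x \<in> P b" "s = rep b x" by (auto simp: S_def)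
  obtain f where "f \<in> P0" "x = \<theta> b f \<otimes> rep b x" using rep_decomp x by blast
  then show ?thesis using x rep_\<theta>[of f "rep b x" b] by simp
qed
lemma par: "x \<in> P b \<Longrightarrow> par b x \<in> P0" "x \<in> P b \<Longrightarrow> \<theta> b (par b x) \<otimes> rep b x = x"
proof -
  assume x: "x \<in> P b"
  have "par b x \<in> P0 \<and> x = \<theta> b (par b x) \<otimes> rep b x"
    unfolding par_def by (rule someI_ex) (use rep_decomp[OF x] in blast)
  then show "par b x \<in> P0" "\<theta> b (par b x) \<otimes> rep b x = x" by auto
qed
lemma rep_mult: "f \<in> P0 \<Longrightarrow> s \<in> S b \<Longrightarrow> rep b (\<theta> b f \<otimes> s) = s"
  by (simp add: S_P rep_idem)
lemma par_mult: "f \<in> P0 \<Longrightarrow> s \<in> S b \<Longrightarrow> par b (\<theta> b f \<otimes> s) = f"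
proof -
  assume a: "f \<in> P0" "s \<in> S b"
  then have "\<theta> b (par b (\<theta> b f \<otimes> s)) \<otimes> s = \<theta> b f \<otimes> s"
    using par(2)[of "\<theta> b f \<otimes> s" b] by (simp add: S_P rep_idem)
  then have "\<theta> b (par b (\<theta> b f \<otimes> s)) = \<theta> b f"
    using a using right_cancel PC[OF S_P] PC[OF \<theta>P] par(1)[of "\<theta> b f \<otimes> s" b] by (simp add: S_P)
  then show ?thesis using a \<theta>_inj[of b] by (metis inj_onD S_P \<theta>P P_closed par(1))
qed
lemma rep_ne_one: "f \<in> P0 \<Longrightarrow> s \<in> S b \<Longrightarrow> s \<noteq> \<one> \<Longrightarrow> \<theta> b f \<otimes> s \<notin> \<theta> b ` P0"
proof
  assume a: "f \<in> P0" "s \<in> S b" "s \<noteq> \<one>" "\<theta> b f \<otimes> s \<in> \<theta> b ` P0"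
  then obtain h where h: "h \<in> P0" "\<theta> b f \<otimes> s = \<theta> b h \<otimes> \<one>" using PC[OF \<theta>P] by (metis imageE r_one)
  have "s = rep b (\<theta> b f \<otimes> s)" using a rep_mult by simp
  also have "\<dots> = \<one>" unfolding h(2) using h(1) by (simp only: rep_mult one_S)
  finally show False using a by simp
qed

definition starts :: "bool \<Rightarrow> (bool \<times> 'g) list \<Rightarrow> bool" where
  "starts b w \<longleftrightarrow> w \<noteq> [] \<and> fst (hd w) = b"

text \<open>
  Reduced words are the normal forms of the free amalgamated product modulo \<open>P0\<close>, that is, the
  edges of its Bass-Serre tree; the head of the list is the letter farthest from the root.
\<close>

fun reduced :: "(bool \<times> 'g) list \<Rightarrow> bool" where
  "reduced [] = True"
| "reduced ((b, s) # w) = (s \<in> S b \<and> s \<noteq> \<one> \<and> \<not> starts b w \<and> reduced w)"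

definition strip :: "bool \<Rightarrow> (bool \<times> 'g) list \<Rightarrow> (bool \<times> 'g) list" where
  "strip b w = (if starts b w then tl w else w)"

lemma starts_simps [simp]: "\<not> starts b []" "starts b ((b', s) # w) \<longleftrightarrow> b' = b"
  by (auto simp: starts_def)

lemma strip_simps [simp]: "strip b [] = []" "strip b ((b, s) # w) = w" "\<not> starts b w \<Longrightarrow> strip b w = w"
  by (auto simp: strip_def)

lemma not_starts_strip: "reduced w \<Longrightarrow> \<not> starts b (strip b w)"
  by (cases w) (auto simp: strip_def)

lemma reduced_strip: "reduced w \<Longrightarrow> reduced (strip b w)"
  by (cases w) (auto simp: strip_def)

lemma length_strip: "length (strip b w) \<le> length w"
  by (auto simp: strip_def)

lemma strip_reduced_cases:
  assumes "reduced w"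
  obtains "\<not> starts b w" | s w' where "w = (b, s) # w'" "s \<in> S b" "s \<noteq> \<one>" "\<not> starts b w'" "reduced w'"
proof (cases w)
  case Nil
  then show ?thesis using that(1) by simp
next
  case (Cons a w')
  then show ?thesis using assms that by (cases a) (cases "fst a = b"; auto)
qed

context
  fixes K :: nat assumes K: "0 < K"
begin

text \<open>
  Words of length \<open>K\<close> cannot be prolonged, so their blocks would be incomplete. This is repaired by
  taking copies of the truncated tree indexed by \<open>\<kappa>\<close>: in a block that cannot be formed by changing
  the first letter of a word, the coordinate \<open>\<kappa> b\<close> takes the place of that letter.
\<close>

definition V :: "((bool \<times> 'g) list \<times> (bool \<Rightarrow> 'g)) set" where
  "V = {(w, \<kappa>). reduced w \<and> length w \<le> K \<and> (\<forall>b. \<kappa> b \<in> S b)}"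

text \<open>
  For each \<open>b\<close> the set \<open>V\<close> is partitioned into blocks, each in bijection with \<open>S b\<close>: \<open>coord\<close> is the
  position inside the block and \<open>move\<close> changes it. By \<open>coord_move\<close>, \<open>move_move\<close> and
  \<open>move_coord\<close> a position in a block may be changed at will, and this gives the action of \<open>P b\<close>.
\<close>

definition coord :: "bool \<Rightarrow> (bool \<times> 'g) list \<times> (bool \<Rightarrow> 'g) \<Rightarrow> 'g" where
  "coord b = (\<lambda>(w, \<kappa>). if starts b w then snd (hd w) else if length w < K then \<one> else \<kappa> b)"

definition move :: "bool \<Rightarrow> (bool \<times> 'g) list \<times> (bool \<Rightarrow> 'g) \<Rightarrow> 'g \<Rightarrow> (bool \<times> 'g) list \<times> (bool \<Rightarrow> 'g)" where
  "move b = (\<lambda>(w, \<kappa>) s. if length (strip b w) < K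
      then (if s = \<one> then strip b w else (b, s) # strip b w, \<kappa>) else (strip b w, \<kappa>(b := s)))"

lemma finite_V: "finite V"
proof -
  have w: "{w. reduced w \<and> length w \<le> K} \<subseteq> {w. set w \<subseteq> Sigma UNIV S \<and> length w \<le> K}"
  proof -
    have "reduced w \<Longrightarrow> set w \<subseteq> Sigma UNIV S" for w by (induction w) auto
    then show ?thesis by auto
  qed
  have "finite (Sigma (UNIV::bool set) S)" by (simp add: finS)
  then have "finite {w. set w \<subseteq> Sigma UNIV S \<and> length w \<le> K}" by (rule finite_lists_length_le)
  then have 1: "finite {w. reduced w \<and> length w \<le> K}" using w finite_subset by blast
  have "finite (PiE (UNIV::bool set) S)" by (intro finite_PiE) (auto simp: finS)
  moreover have "PiE (UNIV::bool set) S = {\<kappa>. \<forall>b. \<kappa> b \<in> S b}" by (auto simp: PiE_def)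
  ultimately have 2: "finite {\<kappa>. \<forall>b. \<kappa> b \<in> S b}" by simp
  have "V = {w. reduced w \<and> length w \<le> K} \<times> {\<kappa>. \<forall>b. \<kappa> b \<in> S b}" by (auto simp: V_def)
  then show ?thesis using 1 2 by simp
qed

lemma coord_S: "v \<in> V \<Longrightarrow> coord b v \<in> S b"
proof -
  assume "v \<in> V"
  then obtain w \<kappa> where v: "v = (w, \<kappa>)" "reduced w" "\<forall>b. \<kappa> b \<in> S b" by (auto simp: V_def)
  show ?thesis using v(2) by (rule strip_reduced_cases[of _ b]) (use v(3) in \<open>auto simp: v coord_def\<close>)
qed

lemma move_V: "v \<in> V \<Longrightarrow> s \<in> S b \<Longrightarrow> move b v s \<in> V"
  using length_strip[of b "fst v"]
  by (auto simp: V_def move_def reduced_strip not_starts_strip split: prod.splits)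

lemma coord_move: "v \<in> V \<Longrightarrow> s \<in> S b \<Longrightarrow> coord b (move b v s) = s"
  by (auto simp: V_def move_def coord_def not_starts_strip split: prod.splits)

lemma move_move: "v \<in> V \<Longrightarrow> move b (move b v s) s' = move b v s'"
  by (auto simp: V_def move_def not_starts_strip split: prod.splits)

lemma move_coord: "v \<in> V \<Longrightarrow> move b v (coord b v) = v"
proof -
  assume "v \<in> V"
  then obtain w \<kappa> where v: "v = (w, \<kappa>)" "reduced w" "length w \<le> K" by (auto simp: V_def)
  show ?thesis using v(2) by (rule strip_reduced_cases[of _ b]) (use v(3) in \<open>auto simp: v coord_def move_def\<close>)
qed

lemma strip_move: "v \<in> V \<Longrightarrow> strip b (fst (move b v s)) = strip b (fst v)"
  by (auto simp: V_def move_def not_starts_strip split: prod.splits)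

text \<open>
  Over each block of \<open>V\<close> the set \<open>P0 \<times> V\<close> contains one copy of \<open>P0 \<times> S b\<close>, that is, of \<open>P b\<close>; \<open>loc\<close> is
  the identification, through which \<open>P b\<close> acts by left multiplication.
\<close>

definition \<Omega> :: "('g \<times> (bool \<times> 'g) list \<times> (bool \<Rightarrow> 'g)) set" where "\<Omega> = P0 \<times> V"

definition loc :: "bool \<Rightarrow> 'g \<times> (bool \<times> 'g) list \<times> (bool \<Rightarrow> 'g) \<Rightarrow> 'g" where
  "loc b = (\<lambda>(f, v). \<theta> b f \<otimes> coord b v)"

definition act :: "bool \<Rightarrow> 'g \<Rightarrow> 'g \<times> (bool \<times> 'g) list \<times> (bool \<Rightarrow> 'g) \<Rightarrow>
    'g \<times> (bool \<times> 'g) list \<times> (bool \<Rightarrow> 'g)" where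
  "act b g \<omega> = (if \<omega> \<in> \<Omega> then (par b (g \<otimes> loc b \<omega>), move b (snd \<omega>) (rep b (g \<otimes> loc b \<omega>))) else \<omega>)"

lemma finite_\<Omega>: "finite \<Omega>" by (simp add: \<Omega>_def fin0 finite_V)

lemma loc_P [simp]: "\<omega> \<in> \<Omega> \<Longrightarrow> loc b \<omega> \<in> P b"
  by (auto simp: \<Omega>_def loc_def coord_S S_P)

lemma act_\<Omega>: "\<omega> \<in> \<Omega> \<Longrightarrow> g \<in> P b \<Longrightarrow> act b g \<omega> \<in> \<Omega>"
proof -
  assume a: "\<omega> \<in> \<Omega>" "g \<in> P b"
  then have "g \<otimes> loc b \<omega> \<in> P b" by simp
  then show ?thesis using a by (auto simp: act_def \<Omega>_def par(1) move_V rep_S)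
qed

lemma loc_act: "\<omega> \<in> \<Omega> \<Longrightarrow> g \<in> P b \<Longrightarrow> loc b (act b g \<omega>) = g \<otimes> loc b \<omega>"
proof -
  assume a: "\<omega> \<in> \<Omega>" "g \<in> P b"
  then have 1: "g \<otimes> loc b \<omega> \<in> P b" by simp
  have "snd \<omega> \<in> V" using a by (auto simp: \<Omega>_def)
  then have "coord b (move b (snd \<omega>) (rep b (g \<otimes> loc b \<omega>))) = rep b (g \<otimes> loc b \<omega>)"
    by (intro coord_move rep_S 1)
  then show ?thesis using a par(2)[OF 1] by (simp add: act_def loc_def)
qed

lemma strip_act: "\<omega> \<in> \<Omega> \<Longrightarrow> strip b (fst (snd (act b g \<omega>))) = strip b (fst (snd \<omega>))"
  by (auto simp: act_def \<Omega>_def strip_move)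

lemma act_act: "\<omega> \<in> \<Omega> \<Longrightarrow> g \<in> P b \<Longrightarrow> h \<in> P b \<Longrightarrow> act b g (act b h \<omega>) = act b (g \<otimes> h) \<omega>"
proof -
  assume a: "\<omega> \<in> \<Omega>" "g \<in> P b" "h \<in> P b"
  have "g \<otimes> loc b (act b h \<omega>) = g \<otimes> h \<otimes> loc b \<omega>"
    using a loc_act[of \<omega> h b] PC[of _ b] m_assoc[of g h "loc b \<omega>"] by simp
  moreover have "snd (act b h \<omega>) = move b (snd \<omega>) (rep b (h \<otimes> loc b \<omega>))" "snd \<omega> \<in> V"
    using a by (auto simp: act_def \<Omega>_def)
  ultimately show ?thesis
    using a act_\<Omega>[of \<omega> h b] by (simp add: act_def[of b g "act b h \<omega>"] move_move) (simp add: act_def)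
qed

text \<open>
  The right-hand side does not mention \<open>b\<close>: the two actions agree on the common subgroup.
\<close>

lemma act_\<theta>: "(f, v) \<in> \<Omega> \<Longrightarrow> f0 \<in> P0 \<Longrightarrow> act b (\<theta> b f0) (f, v) = (f0 \<otimes> f, v)"
proof -
  assume a: "(f, v) \<in> \<Omega>" "f0 \<in> P0"
  then have v: "v \<in> V" "f \<in> P0" by (auto simp: \<Omega>_def)
  have c: "coord b v \<in> S b" using coord_S v by simp
  have "\<theta> b f0 \<otimes> loc b (f, v) = \<theta> b (f0 \<otimes> f) \<otimes> coord b v"
    using a v c PC[OF S_P[OF c]] PC[OF \<theta>P] by (simp add: loc_def \<theta>_mult m_assoc)
  then show ?thesis using a v c by (simp add: act_def par_mult rep_mult move_coord)
qed

lemma act_one: "\<omega> \<in> \<Omega> \<Longrightarrow> act b \<one> \<omega> = \<omega>"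
proof -
  assume a: "\<omega> \<in> \<Omega>"
  then have "fst \<omega> \<in> P0" by (auto simp: \<Omega>_def)
  then show ?thesis using act_\<theta>[of "fst \<omega>" "snd \<omega>" \<one> b] a P0C by (simp add: prod_eq_iff)
qed

lemma act_outside: "\<omega> \<notin> \<Omega> \<Longrightarrow> act b g \<omega> = \<omega>"
  by (simp add: act_def)

lemma act_comp: "g \<in> P b \<Longrightarrow> h \<in> P b \<Longrightarrow> act b g \<circ> act b h = act b (g \<otimes> h)"
  by (rule ext) (metis act_act act_outside comp_apply)

lemma act_permutes: "g \<in> P b \<Longrightarrow> act b g permutes \<Omega>"
proof -
  assume g: "g \<in> P b"
  have "act b \<one> = id" by (rule ext) (metis act_one act_outside id_apply)
  then have "act b g \<circ> act b (inv g) = id" "act b (inv g) \<circ> act b g = id"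
    using act_comp[of g b "inv g"] act_comp[of "inv g" b g] g PC[OF g] by simp_all
  then have "bij (act b g)" by (metis o_bij)
  then show ?thesis
    unfolding permutes_def using act_outside by (auto simp: bij_iff)
qed

lemma inv_act: "g \<in> P b \<Longrightarrow> inv_into UNIV (act b g) = act b (inv g)"
proof -
  assume g: "g \<in> P b"
  have "act b \<one> = id" by (rule ext) (metis act_one act_outside id_apply)
  then have "act b g \<circ> act b (inv g) = id" "act b (inv g) \<circ> act b g = id"
    using act_comp[of g b "inv g"] act_comp[of "inv g" b g] g PC[OF g] by simp_all
  then show ?thesis by (rule inv_unique_comp)
qed

definition root :: "'g \<times> (bool \<times> 'g) list \<times> (bool \<Rightarrow> 'g)" where
  "root = (\<one>, [], \<lambda>_. \<one>)"

lemma root_\<Omega>: "root \<in> \<Omega>" by (auto simp: root_def \<Omega>_def V_def)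
lemma loc_root: "loc b root = \<one>" using K by (simp add: root_def loc_def coord_def)

lemma inj_act: "inj_on (act b) (P b)"
proof (rule inj_onI)
  fix g h assume a: "g \<in> P b" "h \<in> P b" "act b g = act b h"
  then have "g \<otimes> loc b root = h \<otimes> loc b root" using loc_act[OF root_\<Omega>, of _ b] by metis
  then show "g = h" using a PC[of _ b] by (simp add: loc_root)
qed


text \<open>
  The least nonnegative 1-Lipschitz function on a block of type \<open>b\<close> that is at least \<open>u - \<epsilon>\<close> at the
  shared points over the \<open>P0\<close>-coset along which the block is attached. On a block the distance of
  \<open>(x, i)\<close> and \<open>(y, j)\<close> is \<open>\<rho> b i j (x \<otimes> inv y)\<close>.
\<close>

definition bump :: "bool \<Rightarrow> (nat \<Rightarrow> 'g \<Rightarrow> real) \<Rightarrow> 'g \<Rightarrow> nat \<Rightarrow> real" where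
  "bump b u x j = sup0 (I0 \<times> P0) (\<lambda>(i, f). u i f - \<epsilon> - \<rho> b i j (\<theta> b f \<otimes> inv x))"

lemma fin0P: "finite (I0 \<times> P0)"
  using finI I0 fin0 by (meson finite_SigmaI finite_subset)

lemma I0_I: "i \<in> I0 \<Longrightarrow> i \<in> I b" using I0 by blast

lemma \<rho>_triangle:
  "i \<in> I b \<Longrightarrow> j \<in> I b \<Longrightarrow> k \<in> I b \<Longrightarrow> x \<in> P b \<Longrightarrow> y \<in> P b \<Longrightarrow> z \<in> P b \<Longrightarrow>
     \<rho> b i k (x \<otimes> inv z) \<le> \<rho> b i j (x \<otimes> inv y) + \<rho> b j k (y \<otimes> inv z)"
proof -
  assume a: "i \<in> I b" "j \<in> I b" "k \<in> I b" "x \<in> P b" "y \<in> P b" "z \<in> P b"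
  then have "x \<otimes> inv z = (x \<otimes> inv y) \<otimes> (y \<otimes> inv z)"
    using PC[of _ b] by (simp add: m_assoc inv_solve_left)
  then show ?thesis using a orbit_pseudometricD(3)[OF opm[of b], of i j k "x \<otimes> inv y" "y \<otimes> inv z"] by simp
qed

lemma bump_nonneg: "0 \<le> bump b u x j"
  unfolding bump_def by (rule sup0_nonneg[OF fin0P])

lemma bump_lipschitz:
  assumes "x \<in> P b" "y \<in> P b" "i \<in> I b" "j \<in> I b"
  shows "bump b u x i - bump b u y j \<le> \<rho> b i j (x \<otimes> inv y)"
proof -
  have "bump b u x i \<le> bump b u y j + \<rho> b i j (x \<otimes> inv y)"
    unfolding bump_def[of b u x]
  proof (subst sup0_le_iff[OF fin0P], safe)
    show "0 \<le> bump b u y j + \<rho> b i j (x \<otimes> inv y)"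
      using bump_nonneg \<rho>_nonneg[of i b j "x \<otimes> inv y"] assms by (simp add: add_nonneg_nonneg)
  next
    fix k f assume k: "k \<in> I0" "f \<in> P0"
    have "(\<lambda>(i, f). u i f - \<epsilon> - \<rho> b i j (\<theta> b f \<otimes> inv y)) (k, f) \<le> bump b u y j"
      unfolding bump_def by (rule sup0_upper[OF fin0P]) (use k in auto)
    moreover have "\<rho> b k j (\<theta> b f \<otimes> inv y) \<le> \<rho> b k i (\<theta> b f \<otimes> inv x) + \<rho> b i j (x \<otimes> inv y)"
      using \<rho>_triangle[of k b i j "\<theta> b f" x y] assms k I0_I by simp
    ultimately show "u k f - \<epsilon> - \<rho> b k i (\<theta> b f \<otimes> inv x) \<le> bump b u y j + \<rho> b i j (x \<otimes> inv y)"
      by simp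
  qed
  then show ?thesis by simp
qed

lemma bump_le:
  assumes "\<And>i f. i \<in> I0 \<Longrightarrow> f \<in> P0 \<Longrightarrow> u i f \<le> c" "0 \<le> c" "x \<in> P b" "j \<in> I b"
  shows "bump b u x j \<le> c"
  unfolding bump_def
proof (subst sup0_le_iff[OF fin0P], safe)
  fix i f assume "i \<in> I0" "f \<in> P0"
  then show "u i f - \<epsilon> - \<rho> b i j (\<theta> b f \<otimes> inv x) \<le> c"
    using assms(1)[of i f] \<rho>_nonneg[of i b j "\<theta> b f \<otimes> inv x"] I0_I assms pos by fastforce
qed (use assms in simp)

text \<open>
  Every point off the coset of attachment is at distance at least \<open>\<delta>\<close> from it.
\<close>

lemma bump_decay:
  assumes "\<And>i f. i \<in> I0 \<Longrightarrow> f \<in> P0 \<Longrightarrow> u i f \<le> max 0 c" "x \<in> P b" "x \<notin> \<theta> b ` P0" "j \<in> I b"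
  shows "bump b u x j \<le> max 0 (c - \<delta>)"
  unfolding bump_def
proof (subst sup0_le_iff[OF fin0P], safe)
  fix i f assume a: "i \<in> I0" "f \<in> P0"
  have "\<theta> b f \<otimes> inv x \<noteq> \<one>"
  proof
    assume "\<theta> b f \<otimes> inv x = \<one>"
    then have "\<theta> b f = x" using a assms PC[of _ b] by (metis \<theta>P inv_closed inv_equality inv_inv)
    then show False using a assms(3) by blast
  qed
  then have "\<delta> \<le> \<rho> b i j (\<theta> b f \<otimes> inv x)" using sep a assms I0_I by simp
  then show "u i f - \<epsilon> - \<rho> b i j (\<theta> b f \<otimes> inv x) \<le> max 0 (c - \<delta>)"
    using assms(1)[OF a] pos by (simp add: max_def split: if_splits)
qed simp

lemma close': "i \<in> I0 \<Longrightarrow> j \<in> I0 \<Longrightarrow> f \<in> P0 \<Longrightarrow>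
    \<rho> b i j (\<theta> b f) \<le> \<rho> (\<not> b) i j (\<theta> (\<not> b) f) + \<epsilon>"
  using close[of i j f] by (cases b) auto

text \<open>
  From below \<open>bump\<close> is within \<open>\<epsilon>\<close> of \<open>u\<close> by construction. From above this is the Lipschitz condition
  on \<open>u\<close> for the other metric, which exceeds this one by at most \<open>\<epsilon>\<close> at shared points.
\<close>

lemma bump_near:
  assumes nn: "\<And>i f. i \<in> I0 \<Longrightarrow> f \<in> P0 \<Longrightarrow> 0 \<le> u i f"
    and lip: "\<And>i j f h. i \<in> I0 \<Longrightarrow> j \<in> I0 \<Longrightarrow> f \<in> P0 \<Longrightarrow> h \<in> P0 \<Longrightarrow>
         u i f - u j h \<le> \<rho> (\<not> b) i j (\<theta> (\<not> b) (f \<otimes> inv h))"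
    and "i \<in> I0" "f \<in> P0"
  shows "\<bar>bump b u (\<theta> b f) i - u i f\<bar> \<le> \<epsilon>"
proof -
  have "(\<lambda>(j, h). u j h - \<epsilon> - \<rho> b j i (\<theta> b h \<otimes> inv (\<theta> b f))) (i, f) \<le> bump b u (\<theta> b f) i"
    unfolding bump_def by (rule sup0_upper[OF fin0P]) (use assms in auto)
  then have 1: "u i f - \<epsilon> \<le> bump b u (\<theta> b f) i"
    using assms PC[OF \<theta>P, of f b] orbit_pseudometricD(1)[OF opm I0_I, of i b] by simp
  have "bump b u (\<theta> b f) i \<le> u i f + \<epsilon>"
    unfolding bump_def
  proof (subst sup0_le_iff[OF fin0P], safe)
    show "0 \<le> u i f + \<epsilon>" using nn assms pos by simp
    fix j h assume a: "j \<in> I0" "h \<in> P0"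
    have e: "\<theta> b h \<otimes> inv (\<theta> b f) = \<theta> b (h \<otimes> inv f)"
      using a assms by (simp add: \<theta>_mult \<theta>_inv)
    have "\<rho> (\<not> b) j i (\<theta> (\<not> b) (h \<otimes> inv f)) \<le> \<rho> b j i (\<theta> b (h \<otimes> inv f)) + \<epsilon>"
      using close'[of j i "h \<otimes> inv f" "\<not> b"] a assms by simp
    then show "u j h - \<epsilon> - \<rho> b j i (\<theta> b h \<otimes> inv (\<theta> b f)) \<le> u i f + \<epsilon>"
      unfolding e using lip[OF a(1) assms(3) a(2) assms(4)] pos by linarith
  qed
  with 1 show ?thesis by linarith
qed

context
  fixes b0 :: bool and i0 :: nat and D :: real
  assumes i0: "i0 \<in> I b0" and D: "0 \<le> D" "D \<le> real K * \<delta>"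
begin

text \<open>
  \<open>D\<close> minus the distance to the base point \<open>i0\<close> at the root, cut off at \<open>0\<close>, on the block of type
  \<open>b0\<close> at the root.
\<close>

definition peak :: "'g \<Rightarrow> nat \<Rightarrow> real" where
  "peak x j = max 0 (D - \<rho> b0 i0 j (inv x))"

text \<open>
  The function on the block of type \<open>b\<close> through the word \<open>w\<close>, where \<open>w\<close> does not begin with a letter of
  type \<open>b\<close>. It continues \<open>peak\<close> along the tree: each block is reached from the preceding one, which
  is of the other type, through a single \<open>P0\<close>-coset, over which the values at shared points are
  already determined.
\<close>

primrec block :: "(bool \<times> 'g) list \<Rightarrow> bool \<Rightarrow> 'g \<Rightarrow> nat \<Rightarrow> real" where
  "block [] b x j = (if b = b0 then peak x j else bump b (\<lambda>i f. peak (\<theta> b0 f) i) x j)"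
| "block (a # w) b x j = bump b (\<lambda>i f. block w (fst a) (\<theta> (fst a) f \<otimes> snd a) i) x j"

lemma peak_lipschitz:
  assumes "x \<in> P b0" "y \<in> P b0" "i \<in> I b0" "j \<in> I b0"
  shows "peak x i - peak y j \<le> \<rho> b0 i j (x \<otimes> inv y)"
proof -
  have "\<rho> b0 i0 j (\<one> \<otimes> inv y) \<le> \<rho> b0 i0 i (\<one> \<otimes> inv x) + \<rho> b0 i j (x \<otimes> inv y)"
    using \<rho>_triangle[of i0 b0 i j \<one> x y] assms i0 by simp
  then show ?thesis
    using \<rho>_nonneg[of i b0 j "x \<otimes> inv y"] assms PC[of _ b0]
    by (simp add: peak_def max_def)
qed

lemma block_lipschitz:
  assumes "x \<in> P b" "y \<in> P b" "i \<in> I b" "j \<in> I b"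
  shows "block w b x i - block w b y j \<le> \<rho> b i j (x \<otimes> inv y)"
proof (cases w)
  case Nil
  then show ?thesis
    using peak_lipschitz[of x y i j] bump_lipschitz[OF assms] assms by (cases "b = b0") auto
next
  case (Cons a w')
  then show ?thesis using bump_lipschitz[OF assms] by simp
qed

lemma block_nonneg: "0 \<le> block w b x i"
  by (cases w) (auto simp: peak_def bump_nonneg)

text \<open>
  Each letter of \<open>w\<close> is a change of coset and costs \<open>\<delta>\<close>. The bound for \<open>x\<close> outside the coset of
  attachment is the one that the next block inherits.
\<close>

lemma block_decay:
  assumes "reduced w" "\<not> starts b w" "x \<in> P b" "j \<in> I b"
  shows "block w b x j \<le> max 0 (D - real (length w) * \<delta>) \<and>
    (x \<notin> \<theta> b ` P0 \<longrightarrow> block w b x j \<le> max 0 (D - real (Suc (length w)) * \<delta>))"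
  using assms
proof (induction w arbitrary: b x j)
  case Nil
  have pk: "peak x j \<le> D" if "x \<in> P b0" "j \<in> I b0" for x j
    using that \<rho>_nonneg[of i0 b0 j "inv x"] i0 D by (simp add: peak_def)
  show ?case
  proof (cases "b = b0")
    case True
    have "\<delta> \<le> \<rho> b0 i0 j (inv x)" if "x \<notin> \<theta> b ` P0"
    proof (rule sep)
      show "inv x \<noteq> \<one>" using that Nil True PC[of x b] by (metis P0_one \<theta>_one image_eqI inv_eq_1_iff)
    qed (use True Nil i0 in auto)
    then show ?thesis using True Nil pk[of x j] D by (auto simp: peak_def)
  next
    case False
    have "bump b (\<lambda>i f. peak (\<theta> b0 f) i) x j \<le> D"
      by (rule bump_le) (use Nil D pk I0_I in auto)
    moreover have "bump b (\<lambda>i f. peak (\<theta> b0 f) i) x j \<le> max 0 (D - \<delta>)" if "x \<notin> \<theta> b ` P0"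
      by (rule bump_decay) (use that Nil D pk I0_I in \<open>auto simp: max_def\<close>)
    ultimately show ?thesis using False D by auto
  qed
next
  case (Cons a w)
  obtain b' s where a: "a = (b', s)" by fastforce
  define u where "u = (\<lambda>i f. block w b' (\<theta> b' f \<otimes> s) i)"
  have u: "u i f \<le> max 0 (D - real (length (a # w)) * \<delta>)" if "i \<in> I0" "f \<in> P0" for i f
    using Cons.IH[of b' "\<theta> b' f \<otimes> s" i] Cons.prems a that rep_ne_one[of f s b'] I0_I
    by (simp add: u_def S_P)
  have "bump b u x j \<le> max 0 (D - real (length (a # w)) * \<delta>)"
    by (rule bump_le) (use u Cons.prems in auto)
  moreover have "bump b u x j \<le> max 0 (D - real (length (a # w)) * \<delta> - \<delta>)" if "x \<notin> \<theta> b ` P0"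
    by (rule bump_decay) (use u that Cons.prems in auto)
  ultimately show ?case by (simp add: a u_def[symmetric] algebra_simps)
qed

text \<open>
  The value \<open>0\<close> on the blocks formed by means of \<open>\<kappa>\<close> fits with \<open>block\<close>, which has decayed to \<open>0\<close> at
  depth \<open>K\<close> because \<open>D \<le> K * \<delta>\<close>.
\<close>

definition height :: "bool \<Rightarrow> nat \<Rightarrow> 'g \<times> (bool \<times> 'g) list \<times> (bool \<Rightarrow> 'g) \<Rightarrow> real" where
  "height b i \<omega> = (let w = strip b (fst (snd \<omega>)) in if length w < K then block w b (loc b \<omega>) i else 0)"

lemma height_lipschitz:
  assumes "\<omega> \<in> \<Omega>" "g \<in> P b" "i \<in> I b" "j \<in> I b"
  shows "\<bar>height b i \<omega> - height b j (act b (inv g) \<omega>)\<bar> \<le> \<rho> b i j g"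
proof -
  let ?x = "loc b \<omega>" and ?y = "loc b (act b (inv g) \<omega>)"
  have y: "?y = inv g \<otimes> ?x" using assms by (simp add: loc_act)
  have P: "?x \<in> P b" "?y \<in> P b" using assms act_\<Omega> by simp_all
  have c: "?x \<in> carrier G" "g \<in> carrier G" using P assms PC by blast+
  have "?x \<otimes> inv ?y = g" unfolding y using c by (simp add: inv_mult_group m_assoc[symmetric])
  moreover have "?y \<otimes> inv ?x = inv g" unfolding y using c by (simp add: m_assoc)
  ultimately have "block w b ?x i - block w b ?y j \<le> \<rho> b i j g"
     "block w b ?y j - block w b ?x i \<le> \<rho> b j i (inv g)" for w
    using block_lipschitz[of ?x b ?y i j w] block_lipschitz[of ?y b ?x j i w] P assms by simp_all
  then have "\<bar>block w b ?x i - block w b ?y j\<bar> \<le> \<rho> b i j g" for w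
    using orbit_pseudometricD(2)[OF opm, of i b j g] assms by (simp add: abs_le_iff)
  then show ?thesis
    using assms \<rho>_nonneg[of i b j g] by (simp add: height_def strip_act Let_def)
qed

text \<open>
  At the root the Lipschitz bound is attained, so the distances of \<open>i0\<close> to all points of its block
  can be read off from this function.
\<close>

lemma height_root: "j \<in> I b0 \<Longrightarrow> g \<in> P b0 \<Longrightarrow> \<rho> b0 i0 j g \<le> D \<Longrightarrow>
    height b0 i0 root - height b0 j (act b0 (inv g) root) = \<rho> b0 i0 j g"
proof -
  assume a: "j \<in> I b0" "g \<in> P b0" "\<rho> b0 i0 j g \<le> D"
  have "loc b0 (act b0 (inv g) root) = inv g"
    using a PC[of g b0] loc_act[OF root_\<Omega>, of "inv g" b0] by (simp add: loc_root)
  moreover have "strip b0 (fst (snd (act b0 (inv g) root))) = []"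
    using strip_act[OF root_\<Omega>] by (simp add: root_def)
  moreover have "strip b0 (fst (snd root)) = []" by (simp add: root_def)
  ultimately show ?thesis
    using a K D PC[of g b0] orbit_pseudometricD(1)[OF opm i0]
    by (simp add: height_def Let_def loc_root peak_def)
qed

text \<open>
  The two copies of a shared point have nearly equal values: the values of one type determine
  those of the other through \<open>bump\<close>, except at depth \<open>K\<close>, where both vanish.
\<close>

lemma height_near:
  assumes "\<omega> \<in> \<Omega>" "i \<in> I0"
  shows "\<bar>height b i \<omega> - height (\<not> b) i \<omega>\<bar> \<le> \<epsilon>"
proof -
  obtain f w \<kappa> where \<omega>: "\<omega> = (f, w, \<kappa>)" "f \<in> P0" "reduced w" "length w \<le> K"
    using assms by (auto simp: \<Omega>_def V_def)
  have f: "\<theta> b f \<in> carrier G" for b using \<omega> PC[OF \<theta>P] by blast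
  have coset: "\<theta> b (h \<otimes> inv k) = (\<theta> b h \<otimes> s) \<otimes> inv (\<theta> b k \<otimes> s)"
    if "h \<in> P0" "k \<in> P0" "s \<in> P b" for b h k s
    using that PC[of _ b] PC[OF \<theta>P, of _ b]
    by (simp add: \<theta>_mult \<theta>_inv inv_mult_group m_assoc) (simp add: m_assoc[symmetric])
  have "\<bar>height (\<not> c) i \<omega> - height c i \<omega>\<bar> \<le> \<epsilon>" if c: "w = [] \<and> c = b0 \<or> (\<exists>s w'. w = (c, s) # w')" for c
  proof (cases w)
    case Nil
    then have c: "c = b0" using c by auto
    have "\<bar>bump (\<not> b0) (\<lambda>i f. peak (\<theta> b0 f) i) (\<theta> (\<not> b0) f) i - peak (\<theta> b0 f) i\<bar> \<le> \<epsilon>"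
    proof (rule bump_near)
      show "peak (\<theta> b0 h) i - peak (\<theta> b0 k) j \<le> \<rho> (\<not> \<not> b0) i j (\<theta> (\<not> \<not> b0) (h \<otimes> inv k))"
        if "i \<in> I0" "j \<in> I0" "h \<in> P0" "k \<in> P0" for i j h k
        using that peak_lipschitz[of "\<theta> b0 h" "\<theta> b0 k" i j] I0_I by (simp add: \<theta>_mult \<theta>_inv)
    qed (use assms \<omega> in \<open>auto simp: peak_def\<close>)
    then show ?thesis
      using Nil K f c by (simp add: height_def \<omega>(1) loc_def coord_def Let_def)
  next
    case (Cons a w')
    then obtain s where a: "w = (c, s) # w'" using c by auto
    then have s: "s \<in> S c" "s \<noteq> \<one>" "reduced w'" "\<not> starts c w'" using \<omega> by auto
    define u where "u = (\<lambda>i f. block w' c (\<theta> c f \<otimes> s) i)"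
    have hc: "height c i \<omega> = u i f"
      using a \<omega> by (simp add: height_def Let_def u_def loc_def coord_def)
    have st: "\<not> starts (\<not> c) w" using a by simp
    show ?thesis
    proof (cases "length w < K")
      case True
      have "\<bar>bump (\<not> c) u (\<theta> (\<not> c) f) i - u i f\<bar> \<le> \<epsilon>"
      proof (rule bump_near)
        show "u i h - u j k \<le> \<rho> (\<not> \<not> c) i j (\<theta> (\<not> \<not> c) (h \<otimes> inv k))"
          if "i \<in> I0" "j \<in> I0" "h \<in> P0" "k \<in> P0" for i j h k
          using that block_lipschitz[of "\<theta> c h \<otimes> s" c "\<theta> c k \<otimes> s" i j w'] s I0_I coset[of h k s c]
          by (simp add: u_def S_P)
      qed (use assms \<omega> in \<open>auto simp: u_def block_nonneg\<close>)
      moreover have "height (\<not> c) i \<omega> = bump (\<not> c) u (\<theta> (\<not> c) f) i"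
        using True st a f by (simp add: height_def \<omega>(1) Let_def loc_def coord_def u_def)
      ultimately show ?thesis using hc by simp
    next
      case False
      then have "length w = K" using \<omega> by simp
      then have "D - real (Suc (length w')) * \<delta> \<le> 0" using D a by simp
      moreover have "u i f \<le> max 0 (D - real (Suc (length w')) * \<delta>)"
        using block_decay[of w' c "\<theta> c f \<otimes> s" i] s rep_ne_one[of f s c] \<omega> assms I0_I
        by (simp add: u_def S_P)
      moreover have "0 \<le> u i f" by (simp add: u_def block_nonneg)
      moreover have "height (\<not> c) i \<omega> = 0"
        using False st by (simp add: height_def \<omega>(1))
      ultimately show ?thesis using hc pos by simp
    qed
  qed
  moreover have "\<exists>c. w = [] \<and> c = b0 \<or> (\<exists>s w'. w = (c, s) # w')" by (cases w) auto
  ultimately obtain c where c: "\<bar>height (\<not> c) i \<omega> - height c i \<omega>\<bar> \<le> \<epsilon>" by metis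
  show ?thesis
  proof (cases "b = c")
    case True
    then show ?thesis using c by (simp add: abs_minus_commute)
  next
    case False
    then have "b = (\<not> c)" by auto
    then show ?thesis using c by simp
  qed
qed

end

text \<open>
  The amalgam is the full permutation group of \<open>\<Omega>\<close>, with the supremum distances of the functions
  \<open>height\<close> over all choices of the base point \<open>(b0, i0)\<close>.
\<close>

lemma amalgam_of_depth:
  assumes D: "0 \<le> D" "D \<le> real K * \<delta>"
    and bound: "\<And>b i j g. i \<in> I b \<Longrightarrow> j \<in> I b \<Longrightarrow> g \<in> P b \<Longrightarrow> \<rho> b i j g \<le> D"
  shows "\<exists>(B :: nat monoid) e \<sigma>. group B \<and> finite (carrier B) \<and>
    (\<forall>b. e b \<in> mon (G\<lparr>carrier := P b\<rparr>) B) \<and> (\<forall>f\<in>P0. e True (\<theta> True f) = e False (\<theta> False f)) \<and>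
    orbit_pseudometric B (carrier B) (Sigma UNIV I) \<sigma> \<and>
    (\<forall>b. \<forall>i\<in>I b. \<forall>j\<in>I b. \<forall>g\<in>P b. \<sigma> (b, i) (b, j) (e b g) = \<rho> b i j g) \<and>
    (\<forall>i\<in>I0. \<sigma> (True, i) (False, i) \<one>\<^bsub>B\<^esub> \<le> \<epsilon>)"
proof -
  define A where "A = permutation_group \<Omega>"
  define \<Lambda> where "\<Lambda> = Sigma (UNIV :: bool set) I"
  define v where "v = (\<lambda>(b0, i0) (b, i) \<omega>. height b0 i0 D b i \<omega>)"
  define \<sigma> where "\<sigma> = (\<lambda>k l p. sup0 (\<Lambda> \<times> \<Omega>) (\<lambda>(a, \<omega>). \<bar>v a k \<omega> - v a l (inv_into UNIV p \<omega>)\<bar>))"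
  have fin: "finite \<Lambda>" "finite (\<Lambda> \<times> \<Omega>)" using finI finite_\<Omega> by (auto simp: \<Lambda>_def)
  have A: "group A" "finite (carrier A)"
    using finite_\<Omega> group_permutation_group
    by (auto simp: A_def permutation_group_def finite_permutations)
  have opmA: "orbit_pseudometric A (carrier A) (Sigma UNIV I) \<sigma>"
    using orbit_pseudometric_permutations[OF fin(1) finite_\<Omega>]
    by (simp add: A_def \<sigma>_def permutation_group_def)
  have monA: "act b \<in> mon (G\<lparr>carrier := P b\<rparr>) A" for b
    using inj_act act_permutes act_comp by (auto simp: mon_def hom_def A_def permutation_group_def)
  have agree: "act True (\<theta> True f) = act False (\<theta> False f)" if "f \<in> P0" for f
  proof
    fix \<omega> show "act True (\<theta> True f) \<omega> = act False (\<theta> False f) \<omega>"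
      using that act_\<theta>[of "fst \<omega>" "snd \<omega>" f] by (cases "\<omega> \<in> \<Omega>") (auto simp: act_outside)
  qed
  have ext: "\<sigma> (b, i) (b, j) (act b g) = \<rho> b i j g" if a: "i \<in> I b" "j \<in> I b" "g \<in> P b" for b i j g
  proof (rule antisym)
    show "\<sigma> (b, i) (b, j) (act b g) \<le> \<rho> b i j g"
      unfolding \<sigma>_def inv_act[OF a(3)]
      using a height_lipschitz[OF _ D] \<rho>_nonneg
      by (subst sup0_le_iff[OF fin(2)]) (auto simp: v_def \<Lambda>_def)
    have "((b, i), root) \<in> \<Lambda> \<times> \<Omega>" using a root_\<Omega> by (auto simp: \<Lambda>_def)
    from sup0_upper[OF fin(2) this, of "\<lambda>(a, \<omega>). \<bar>v a (b, i) \<omega> - v a (b, j) (inv_into UNIV (act b g) \<omega>)\<bar>"]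
    show "\<rho> b i j g \<le> \<sigma> (b, i) (b, j) (act b g)"
      using height_root[OF a(1) D a(2,3) bound[OF a]] by (simp add: \<sigma>_def v_def inv_act[OF a(3)])
  qed
  have near: "\<sigma> (True, i) (False, i) \<one>\<^bsub>A\<^esub> \<le> \<epsilon>" if "i \<in> I0" for i
    unfolding \<sigma>_def using that height_near[OF _ D, where b = True] pos
    by (subst sup0_le_iff[OF fin(2)]) (auto simp: v_def \<Lambda>_def A_def permutation_group_def)
  obtain B :: "nat monoid" and h where B: "group B" "finite (carrier B)" "h \<in> iso A B"
    using finite_group_nat_copy[OF A] by blast
  interpret A: group A by fact
  interpret B: group B by fact
  interpret h: group_hom A B h
    using B(3) by unfold_locales (simp add: iso_def)
  define k where "k = inv_into (carrier A) h"
  have k: "k \<in> iso B A" unfolding k_def using A.iso_set_sym[OF B(3)] .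
  interpret k: group_hom B A k
    using k by unfold_locales (simp add: iso_def)
  have kh: "k (h x) = x" if "x \<in> carrier A" for x
    using that B(3) by (simp add: k_def iso_def bij_betw_def)
  have actA: "act b g \<in> carrier A" if "g \<in> P b" for b g
    using monA[of b] that by (auto simp: mon_def hom_def)
  have 1: "h \<circ> act b \<in> mon (G\<lparr>carrier := P b\<rparr>) B" for b
  proof -
    have "h \<circ> act b \<in> hom (G\<lparr>carrier := P b\<rparr>) B"
      using monA[of b] actA[of _ b] by (auto simp: mon_def hom_def)
    moreover have "inj_on (h \<circ> act b) (P b)"
      by (rule inj_onI) (metis actA comp_apply inj_act inj_onD kh)
    ultimately show ?thesis by (simp add: mon_def)
  qed
  have 2: "orbit_pseudometric B (carrier B) (Sigma UNIV I) (\<lambda>i j g. \<sigma> i j (k g))"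
    using opmA unfolding orbit_pseudometric_def
    by (metis k.hom_closed k.hom_inv k.hom_mult k.hom_one)
  show ?thesis
    by (rule exI[of _ B], rule exI[of _ "\<lambda>b. h \<circ> act b"], rule exI[of _ "\<lambda>i j g. \<sigma> i j (k g)"])
      (use B 1 2 agree ext near in \<open>auto simp: kh actA k.hom_one\<close>)
qed

end

lemma amalgam_exists:
  "\<exists>(B :: nat monoid) e \<sigma>. group B \<and> finite (carrier B) \<and>
    (\<forall>b. e b \<in> mon (G\<lparr>carrier := P b\<rparr>) B) \<and> (\<forall>f\<in>P0. e True (\<theta> True f) = e False (\<theta> False f)) \<and>
    orbit_pseudometric B (carrier B) (Sigma UNIV I) \<sigma> \<and>
    (\<forall>b. \<forall>i\<in>I b. \<forall>j\<in>I b. \<forall>g\<in>P b. \<sigma> (b, i) (b, j) (e b g) = \<rho> b i j g) \<and>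
    (\<forall>i\<in>I0. \<sigma> (True, i) (False, i) \<one>\<^bsub>B\<^esub> \<le> \<epsilon>)"
proof -
  define X where "X = (SIGMA b:UNIV. I b \<times> I b \<times> P b)"
  have fin: "finite X" using finI finP by (auto simp: X_def)
  define D where "D = sup0 X (\<lambda>(b, i, j, g). \<rho> b i j g)"
  obtain n where n: "D / \<delta> < real n" using reals_Archimedean2 by blast
  have D: "0 \<le> D" unfolding D_def by (rule sup0_nonneg[OF fin])
  then have "0 < n" using n pos by (smt (verit) divide_nonneg_pos of_nat_0 gr0I)
  moreover have "D \<le> real n * \<delta>" using n pos by (simp add: divide_less_eq)
  moreover have "\<rho> b i j g \<le> D" if "i \<in> I b" "j \<in> I b" "g \<in> P b" for b i j g
    using sup0_upper[OF fin, of "(b, i, j, g)" "\<lambda>(b, i, j, g). \<rho> b i j g"] that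
    by (simp add: D_def X_def)
  ultimately show ?thesis using amalgam_of_depth[of n D] D by blast
qed

end

section \<open>A universal rational orbit metric\<close>

definition orbit_dist :: "('g, 'm) monoid_scheme \<Rightarrow> ('i \<Rightarrow> 'i \<Rightarrow> 'g \<Rightarrow> real) \<Rightarrow> 'g \<times> 'i \<Rightarrow> 'g \<times> 'i \<Rightarrow> real" where
  "orbit_dist G \<rho> = (\<lambda>(g, i) (h, j). \<rho> i j (inv\<^bsub>G\<^esub> g \<otimes>\<^bsub>G\<^esub> h))"

text \<open>
  The functions that can be the distances from a further point, for rational metrics.
\<close>

definition katetov :: "('a \<Rightarrow> 'a \<Rightarrow> real) \<Rightarrow> 'a set \<Rightarrow> ('a \<Rightarrow> real) \<Rightarrow> bool" where
  "katetov d A f \<longleftrightarrow> (\<forall>a\<in>A. f a \<in> \<rat> \<and> 0 < f a) \<and>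
     (\<forall>a\<in>A. \<forall>b\<in>A. f a \<le> f b + d a b \<and> d a b \<le> f a + f b)"

definition extension_property :: "'a set \<Rightarrow> ('a \<Rightarrow> 'a \<Rightarrow> real) \<Rightarrow> bool" where
  "extension_property X d \<longleftrightarrow>
     (\<forall>A f. finite A \<and> A \<noteq> {} \<and> A \<subseteq> X \<and> katetov d A f \<longrightarrow> (\<exists>x\<in>X. \<forall>a\<in>A. d x a = f a))"

definition rational_orbit_metric ::
  "('g, 'm) monoid_scheme \<Rightarrow> 'g set \<Rightarrow> 'i set \<Rightarrow> ('i \<Rightarrow> 'i \<Rightarrow> 'g \<Rightarrow> real) \<Rightarrow> bool" where
  "rational_orbit_metric G F I \<rho> \<longleftrightarrow> orbit_pseudometric G F I \<rho> \<and>
     (\<forall>i\<in>I. \<forall>j\<in>I. \<forall>g\<in>F. \<rho> i j g \<in> \<rat> \<and> (\<rho> i j g = 0 \<longrightarrow> i = j \<and> g = \<one>\<^bsub>G\<^esub>))"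

lemma rational_orbit_metricD:
  assumes "rational_orbit_metric G F I \<rho>"
  shows "orbit_pseudometric G F I \<rho>"
    and "i \<in> I \<Longrightarrow> j \<in> I \<Longrightarrow> g \<in> F \<Longrightarrow> \<rho> i j g \<in> \<rat>"
    and "i \<in> I \<Longrightarrow> j \<in> I \<Longrightarrow> g \<in> F \<Longrightarrow> \<rho> i j g = 0 \<Longrightarrow> i = j"
    and "i \<in> I \<Longrightarrow> j \<in> I \<Longrightarrow> g \<in> F \<Longrightarrow> \<rho> i j g = 0 \<Longrightarrow> g = \<one>\<^bsub>G\<^esub>"
  using assms by (auto simp: rational_orbit_metric_def)

definition round_up ::
  "('g, 'm) monoid_scheme \<Rightarrow> nat \<Rightarrow> ('i \<Rightarrow> 'i \<Rightarrow> 'g \<Rightarrow> real) \<Rightarrow> 'i \<Rightarrow> 'i \<Rightarrow> 'g \<Rightarrow> real" where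
  "round_up G N \<rho> i j g =
     (if i = j \<and> g = \<one>\<^bsub>G\<^esub> then 0 else (of_int \<lceil>real N * \<rho> i j g\<rceil> + 1) / real N)"

lemma round_up_bounds:
  assumes "0 < N" "i = j \<and> g = \<one>\<^bsub>G\<^esub> \<Longrightarrow> \<rho> i j g = 0"
  shows "\<rho> i j g \<le> round_up G N \<rho> i j g" "round_up G N \<rho> i j g \<le> \<rho> i j g + 2 / real N"
proof -
  have "real N * \<rho> i j g \<le> of_int \<lceil>real N * \<rho> i j g\<rceil>"
    "of_int \<lceil>real N * \<rho> i j g\<rceil> \<le> real N * \<rho> i j g + 1" by linarith+
  then have "real N * \<rho> i j g / real N \<le> (of_int \<lceil>real N * \<rho> i j g\<rceil> + 1) / real N"
    "(of_int \<lceil>real N * \<rho> i j g\<rceil> + 1) / real N \<le> (real N * \<rho> i j g + 2) / real N"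
    by (intro divide_right_mono; linarith)+
  then show "\<rho> i j g \<le> round_up G N \<rho> i j g" "round_up G N \<rho> i j g \<le> \<rho> i j g + 2 / real N"
    using assms by (auto simp: round_up_def add_divide_distrib)
qed

lemma round_up_lower:
  assumes "0 < N" "0 \<le> \<rho> i j g" "\<not> (i = j \<and> g = \<one>\<^bsub>G\<^esub>)"
  shows "1 / real N \<le> round_up G N \<rho> i j g"
proof -
  have "0 \<le> real N * \<rho> i j g" using assms by simp
  then have "(0::real) \<le> of_int \<lceil>real N * \<rho> i j g\<rceil>" by linarith
  then show ?thesis using assms by (auto simp: round_up_def intro!: divide_right_mono)
qed

text \<open>
  Rounding up is subadditive, so the triangle inequality survives; the extra \<open>1\<close> makes all
  distances positive.
\<close>

lemma rational_orbit_metric_round_up: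
  assumes "group G" and F: "subgroup F G" and opm: "orbit_pseudometric G F I \<rho>" and N: "0 < N"
  shows "rational_orbit_metric G F I (round_up G N \<rho>)"
proof -
  interpret group G by fact
  note FC = subgroup.mem_carrier[OF F]
  have nn: "0 \<le> \<rho> i j g" if "i \<in> I" "j \<in> I" "g \<in> F" for i j g
    using orbit_pseudometric_nonneg[OF is_group F opm that] .
  have pos: "0 < round_up G N \<rho> i j g" if "i \<in> I" "j \<in> I" "g \<in> F" "\<not> (i = j \<and> g = \<one>\<^bsub>G\<^esub>)" for i j g
    using round_up_lower[where G = G and \<rho> = \<rho> and i = i and j = j and g = g, OF N nn[OF that(1-3)] that(4)] N
    by (meson less_le_trans of_nat_0_less_iff zero_less_divide_1_iff)
  have nn': "0 \<le> round_up G N \<rho> i j g" if "i \<in> I" "j \<in> I" "g \<in> F" for i j g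
    using pos[OF that] by (cases "i = j \<and> g = \<one>\<^bsub>G\<^esub>") (auto simp: round_up_def)
  have tri: "round_up G N \<rho> i k (g \<otimes>\<^bsub>G\<^esub> h) \<le> round_up G N \<rho> i j g + round_up G N \<rho> j k h"
    if a: "i \<in> I" "j \<in> I" "k \<in> I" "g \<in> F" "h \<in> F" for i j k g h
  proof -
    consider "i = k \<and> g \<otimes>\<^bsub>G\<^esub> h = \<one>\<^bsub>G\<^esub>" | "i = j \<and> g = \<one>\<^bsub>G\<^esub>" | "j = k \<and> h = \<one>\<^bsub>G\<^esub>"
      | "\<not> (i = k \<and> g \<otimes>\<^bsub>G\<^esub> h = \<one>\<^bsub>G\<^esub>)" "\<not> (i = j \<and> g = \<one>\<^bsub>G\<^esub>)" "\<not> (j = k \<and> h = \<one>\<^bsub>G\<^esub>)" by blast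
    then show ?thesis
    proof cases
      case 1
      then show ?thesis using nn'[of i j g] nn'[of j k h] a by (simp add: round_up_def[of G N \<rho> k k])
    next
      case 2
      then show ?thesis using a FC by (simp add: round_up_def)
    next
      case 3
      then show ?thesis using a FC by (simp add: round_up_def)
    next
      case 4
      have "real N * \<rho> i k (g \<otimes>\<^bsub>G\<^esub> h) \<le> real N * \<rho> i j g + real N * \<rho> j k h"
        using orbit_pseudometricD(3)[OF opm a] N by (simp add: distrib_left[symmetric])
      then have "\<lceil>real N * \<rho> i k (g \<otimes>\<^bsub>G\<^esub> h)\<rceil> \<le> \<lceil>real N * \<rho> i j g\<rceil> + \<lceil>real N * \<rho> j k h\<rceil>"
        by linarith
      then have "(of_int \<lceil>real N * \<rho> i k (g \<otimes>\<^bsub>G\<^esub> h)\<rceil> + 1) / real N \<le>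
          ((of_int \<lceil>real N * \<rho> i j g\<rceil> + 1) + (of_int \<lceil>real N * \<rho> j k h\<rceil> + 1)) / real N"
        by (intro divide_right_mono) linarith+
      then show ?thesis using 4 by (auto simp: round_up_def add_divide_distrib)
    qed
  qed
  have sym: "round_up G N \<rho> i j g = round_up G N \<rho> j i (inv\<^bsub>G\<^esub> g)"
    if a: "i \<in> I" "j \<in> I" "g \<in> F" for i j g
    using orbit_pseudometricD(2)[OF opm a] FC[OF a(3)] by (auto simp: round_up_def)
  have rat: "round_up G N \<rho> i j g \<in> \<rat>" for i j g
    by (auto simp: round_up_def)
  show ?thesis
    unfolding rational_orbit_metric_def orbit_pseudometric_def
  proof (intro conjI ballI impI)
    show "round_up G N \<rho> i i \<one>\<^bsub>G\<^esub> = 0" for i by (simp add: round_up_def)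
    show "i = j" "g = \<one>\<^bsub>G\<^esub>" if "i \<in> I" "j \<in> I" "g \<in> F" "round_up G N \<rho> i j g = 0" for i j g
      using pos[OF that(1-3)] that(4) by auto
  qed (auto intro: tri sym rat)
qed

lemma (in group) inv_mult_cancel:
  "x \<in> carrier G \<Longrightarrow> y \<in> carrier G \<Longrightarrow> inv x \<otimes> (x \<otimes> y) = y"
  "x \<in> carrier G \<Longrightarrow> y \<in> carrier G \<Longrightarrow> x \<otimes> (inv x \<otimes> y) = y"
  by (simp_all add: m_assoc[symmetric])

text \<open>
  A new free orbit, with index \<open>m\<close>, whose point at \<open>\<one>\<close> has prescribed distances \<open>f\<close> to the finite
  set \<open>A\<close>. All other distances are as large as possible: \<open>dist_new j h\<close> is the distance from the
  new point to \<open>(h, j)\<close>, and \<open>dist_self h\<close> is the distance from the new point to its translate by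
  \<open>h\<close>; both are lengths of shortest paths through \<open>A\<close> and its translates.
\<close>

locale orbit_extension = group G for G :: "('g, 'm) monoid_scheme" (structure) +
  fixes \<rho> :: "nat \<Rightarrow> nat \<Rightarrow> 'g \<Rightarrow> real" and m :: nat and A :: "('g \<times> nat) set" and f :: "'g \<times> nat \<Rightarrow> real"
  assumes rom: "rational_orbit_metric G (carrier G) {..<m} \<rho>"
    and A: "finite A" "A \<noteq> {}" "A \<subseteq> carrier G \<times> {..<m}"
    and kat: "katetov (orbit_dist G \<rho>) A f"
begin

lemma tri: "i < m \<Longrightarrow> j < m \<Longrightarrow> k < m \<Longrightarrow> g \<in> carrier G \<Longrightarrow> h \<in> carrier G \<Longrightarrow>
   \<rho> i k (g \<otimes> h) \<le> \<rho> i j g + \<rho> j k h"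
  using orbit_pseudometricD(3)[OF rational_orbit_metricD(1)[OF rom]] by simp

lemma sym: "i < m \<Longrightarrow> j < m \<Longrightarrow> g \<in> carrier G \<Longrightarrow> \<rho> i j g = \<rho> j i (inv g)"
  by (rule orbit_pseudometricD(2)[OF rational_orbit_metricD(1)[OF rom]]) auto

lemma refl: "i < m \<Longrightarrow> \<rho> i i \<one> = 0"
  using orbit_pseudometricD(1)[OF rational_orbit_metricD(1)[OF rom]] by simp

lemma nonneg: "i < m \<Longrightarrow> j < m \<Longrightarrow> g \<in> carrier G \<Longrightarrow> 0 \<le> \<rho> i j g"
  using orbit_pseudometric_nonneg[OF is_group subgroup_self rational_orbit_metricD(1)[OF rom]] by simp

lemma tri_inv: "i < m \<Longrightarrow> j < m \<Longrightarrow> k < m \<Longrightarrow> x \<in> carrier G \<Longrightarrow> y \<in> carrier G \<Longrightarrow> z \<in> carrier G \<Longrightarrow>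
   \<rho> i k (inv x \<otimes> z) \<le> \<rho> i j (inv x \<otimes> y) + \<rho> j k (inv y \<otimes> z)"
proof -
  assume a: "i < m" "j < m" "k < m" "x \<in> carrier G" "y \<in> carrier G" "z \<in> carrier G"
  then have "inv x \<otimes> z = (inv x \<otimes> y) \<otimes> (inv y \<otimes> z)"
    by (simp add: m_assoc inv_mult_cancel)
  then show ?thesis using tri[of i j k "inv x \<otimes> y" "inv y \<otimes> z"] a by simp
qed

definition dist_new :: "nat \<Rightarrow> 'g \<Rightarrow> real" where
  "dist_new j h = Min ((\<lambda>(b, k). f (b, k) + \<rho> k j (inv b \<otimes> h)) ` A)"

lemma dist_new_le: "(b, k) \<in> A \<Longrightarrow> dist_new j h \<le> f (b, k) + \<rho> k j (inv b \<otimes> h)"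
  unfolding dist_new_def using A by (intro Min_le) force+

lemma dist_new_attained: "\<exists>b k. (b, k) \<in> A \<and> dist_new j h = f (b, k) + \<rho> k j (inv b \<otimes> h)"
proof -
  have "dist_new j h \<in> (\<lambda>(b, k). f (b, k) + \<rho> k j (inv b \<otimes> h)) ` A"
    unfolding dist_new_def using A by (intro Min_in) auto
  then show ?thesis by auto
qed

lemma AD: "(b, k) \<in> A \<Longrightarrow> b \<in> carrier G" "(b, k) \<in> A \<Longrightarrow> k < m"
  using A by auto

lemma katD:
  assumes "(b, k) \<in> A"
  shows "f (b, k) \<in> \<rat>" "0 < f (b, k)"
    "(c, l) \<in> A \<Longrightarrow> f (b, k) \<le> f (c, l) + \<rho> k l (inv b \<otimes> c)"
    "(c, l) \<in> A \<Longrightarrow> \<rho> k l (inv b \<otimes> c) \<le> f (b, k) + f (c, l)"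
  using kat assms by (auto simp: katetov_def orbit_dist_def)

lemma dist_new_pos: "j < m \<Longrightarrow> h \<in> carrier G \<Longrightarrow> 0 < dist_new j h"
proof -
  assume a: "j < m" "h \<in> carrier G"
  obtain b k where b: "(b, k) \<in> A" "dist_new j h = f (b, k) + \<rho> k j (inv b \<otimes> h)" using dist_new_attained by blast
  then show ?thesis using a katD(2)[OF b(1)] nonneg[of k j "inv b \<otimes> h"] AD[OF b(1)] by simp
qed

lemma dist_new_rat: "j < m \<Longrightarrow> h \<in> carrier G \<Longrightarrow> dist_new j h \<in> \<rat>"
proof -
  assume a: "j < m" "h \<in> carrier G"
  obtain b k where b: "(b, k) \<in> A" "dist_new j h = f (b, k) + \<rho> k j (inv b \<otimes> h)" using dist_new_attained by blast
  then show ?thesis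
    using a katD(1)[OF b(1)] rational_orbit_metricD(2)[OF rom, of k j "inv b \<otimes> h"] AD[OF b(1)] by simp
qed

lemma dist_new_A: "(b, k) \<in> A \<Longrightarrow> dist_new k b = f (b, k)"
proof -
  assume a: "(b, k) \<in> A"
  obtain c l where c: "(c, l) \<in> A" "dist_new k b = f (c, l) + \<rho> l k (inv c \<otimes> b)" using dist_new_attained by blast
  have "\<rho> l k (inv c \<otimes> b) = \<rho> k l (inv b \<otimes> c)"
    using sym[of l k "inv c \<otimes> b"] AD[OF a] AD[OF c(1)] by (simp add: inv_mult_group)
  then have "f (b, k) \<le> dist_new k b" using katD(3)[OF a c(1)] c by simp
  moreover have "dist_new k b \<le> f (b, k)" using dist_new_le[OF a, of k b] AD[OF a] refl by simp
  ultimately show ?thesis by simp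
qed

lemma dist_new_lip: "i < m \<Longrightarrow> j < m \<Longrightarrow> g \<in> carrier G \<Longrightarrow> h \<in> carrier G \<Longrightarrow> dist_new j (g \<otimes> h) \<le> dist_new i g + \<rho> i j h"
proof -
  assume a: "i < m" "j < m" "g \<in> carrier G" "h \<in> carrier G"
  obtain b k where b: "(b, k) \<in> A" "dist_new i g = f (b, k) + \<rho> k i (inv b \<otimes> g)" using dist_new_attained by blast
  have "\<rho> k j (inv b \<otimes> (g \<otimes> h)) \<le> \<rho> k i (inv b \<otimes> g) + \<rho> i j h"
    using tri[of k i j "inv b \<otimes> g" h] a AD[OF b(1)] by (simp add: m_assoc)
  then show ?thesis using dist_new_le[OF b(1), of j "g \<otimes> h"] b by simp
qed

lemma dist_new_lip': "i < m \<Longrightarrow> j < m \<Longrightarrow> g \<in> carrier G \<Longrightarrow> h \<in> carrier G \<Longrightarrow> dist_new j h \<le> dist_new i g + \<rho> i j (inv g \<otimes> h)"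
  using dist_new_lip[of i j g "inv g \<otimes> h"] by (simp add: inv_mult_cancel)

lemma dist_new_sum: "i < m \<Longrightarrow> j < m \<Longrightarrow> g \<in> carrier G \<Longrightarrow> h \<in> carrier G \<Longrightarrow> \<rho> i j (inv g \<otimes> h) \<le> dist_new i g + dist_new j h"
proof -
  assume a: "i < m" "j < m" "g \<in> carrier G" "h \<in> carrier G"
  obtain b k where b: "(b, k) \<in> A" "dist_new i g = f (b, k) + \<rho> k i (inv b \<otimes> g)" using dist_new_attained by blast
  obtain c l where c: "(c, l) \<in> A" "dist_new j h = f (c, l) + \<rho> l j (inv c \<otimes> h)" using dist_new_attained by blast
  note AD' = AD[OF b(1)] AD[OF c(1)]
  have "\<rho> i j (inv g \<otimes> h) \<le> \<rho> i k (inv g \<otimes> b) + \<rho> k j (inv b \<otimes> h)"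
    using tri_inv[of i k j g b h] a AD' by simp
  moreover have "\<rho> k j (inv b \<otimes> h) \<le> \<rho> k l (inv b \<otimes> c) + \<rho> l j (inv c \<otimes> h)"
    using tri_inv[of k l j b c h] a AD' by simp
  moreover have "\<rho> i k (inv g \<otimes> b) = \<rho> k i (inv b \<otimes> g)"
    using sym[of i k "inv g \<otimes> b"] a AD' by (simp add: inv_mult_group)
  ultimately show ?thesis using katD(4)[OF b(1) c(1)] b c by simp
qed

definition dist_self :: "'g \<Rightarrow> real" where
  "dist_self h = Min ((\<lambda>(b, k). f (b, k) + dist_new k (inv h \<otimes> b)) ` A)"

lemma dist_self_attained: "\<exists>b k. (b, k) \<in> A \<and> dist_self h = dist_new k b + dist_new k (inv h \<otimes> b)"
proof -
  have "dist_self h \<in> (\<lambda>(b, k). f (b, k) + dist_new k (inv h \<otimes> b)) ` A"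
    unfolding dist_self_def using A by (intro Min_in) auto
  then obtain b k where "(b, k) \<in> A" "dist_self h = f (b, k) + dist_new k (inv h \<otimes> b)" by auto
  then show ?thesis using dist_new_A[of b k] by metis
qed

lemma dist_self_le: "i < m \<Longrightarrow> a \<in> carrier G \<Longrightarrow> h \<in> carrier G \<Longrightarrow> dist_self h \<le> dist_new i a + dist_new i (inv h \<otimes> a)"
proof -
  assume a: "i < m" "a \<in> carrier G" "h \<in> carrier G"
  obtain b k where b: "(b, k) \<in> A" "dist_new i a = f (b, k) + \<rho> k i (inv b \<otimes> a)" using dist_new_attained by blast
  have "dist_self h \<le> f (b, k) + dist_new k (inv h \<otimes> b)"
    unfolding dist_self_def using A b by (intro Min_le) force+
  moreover have "dist_new k (inv h \<otimes> b) \<le> dist_new i (inv h \<otimes> a) + \<rho> i k (inv a \<otimes> b)"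
    using dist_new_lip[of i k "inv h \<otimes> a" "inv a \<otimes> b"] a AD[OF b(1)]
    by (simp add: m_assoc inv_mult_cancel)
  moreover have "\<rho> i k (inv a \<otimes> b) = \<rho> k i (inv b \<otimes> a)"
    using sym[of i k "inv a \<otimes> b"] a AD[OF b(1)] by (simp add: inv_mult_group)
  ultimately show ?thesis using b by simp
qed

lemma dist_self_pos: "h \<in> carrier G \<Longrightarrow> 0 < dist_self h"
proof -
  assume h: "h \<in> carrier G"
  obtain b k where b: "(b, k) \<in> A" "dist_self h = dist_new k b + dist_new k (inv h \<otimes> b)" using dist_self_attained by blast
  then show ?thesis using h AD[OF b(1)] dist_new_pos[of k b] dist_new_pos[of k "inv h \<otimes> b"] by simp
qed

lemma dist_self_rat: "h \<in> carrier G \<Longrightarrow> dist_self h \<in> \<rat>"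
proof -
  assume h: "h \<in> carrier G"
  obtain b k where b: "(b, k) \<in> A" "dist_self h = dist_new k b + dist_new k (inv h \<otimes> b)" using dist_self_attained by blast
  then show ?thesis using h AD[OF b(1)] dist_new_rat[of k b] dist_new_rat[of k "inv h \<otimes> b"] by simp
qed

lemma dist_self_inv_le: "h \<in> carrier G \<Longrightarrow> dist_self (inv h) \<le> dist_self h"
proof -
  assume h: "h \<in> carrier G"
  obtain b k where b: "(b, k) \<in> A" "dist_self h = dist_new k b + dist_new k (inv h \<otimes> b)" using dist_self_attained by blast
  then show ?thesis using dist_self_le[of k "inv h \<otimes> b" "inv h"] h AD[OF b(1)]
    by (simp add: inv_mult_cancel)
qed

lemma dist_self_inv: "h \<in> carrier G \<Longrightarrow> dist_self (inv h) = dist_self h"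
  using dist_self_inv_le[of h] dist_self_inv_le[of "inv h"] by simp

lemma dist_new_dist_self: "k < m \<Longrightarrow> g \<in> carrier G \<Longrightarrow> h \<in> carrier G \<Longrightarrow> dist_new k (g \<otimes> h) \<le> dist_self g + dist_new k h"
proof -
  assume a: "k < m" "g \<in> carrier G" "h \<in> carrier G"
  obtain b i where b: "(b, i) \<in> A" "dist_self g = dist_new i b + dist_new i (inv g \<otimes> b)" using dist_self_attained by blast
  note AD' = AD[OF b(1)]
  have "dist_new k (g \<otimes> h) \<le> dist_new i b + \<rho> i k (inv b \<otimes> (g \<otimes> h))"
    using dist_new_lip'[of i k b "g \<otimes> h"] a AD' by simp
  moreover have "\<rho> i k (inv (inv g \<otimes> b) \<otimes> h) \<le> dist_new i (inv g \<otimes> b) + dist_new k h"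
    using dist_new_sum[of i k "inv g \<otimes> b" h] a AD' by simp
  moreover have "inv (inv g \<otimes> b) \<otimes> h = inv b \<otimes> (g \<otimes> h)"
    using a AD' by (simp add: inv_mult_group m_assoc)
  ultimately show ?thesis using b by simp
qed

lemma dist_self_tri: "g \<in> carrier G \<Longrightarrow> h \<in> carrier G \<Longrightarrow> dist_self (g \<otimes> h) \<le> dist_self g + dist_self h"
proof -
  assume a: "g \<in> carrier G" "h \<in> carrier G"
  obtain b j where b: "(b, j) \<in> A" "dist_self h = dist_new j b + dist_new j (inv h \<otimes> b)" using dist_self_attained by blast
  note AD' = AD[OF b(1)]
  have "dist_self (g \<otimes> h) \<le> dist_new j (g \<otimes> b) + dist_new j (inv (g \<otimes> h) \<otimes> (g \<otimes> b))"
    using dist_self_le[of j "g \<otimes> b" "g \<otimes> h"] a AD' by simp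
  moreover have "inv (g \<otimes> h) \<otimes> (g \<otimes> b) = inv h \<otimes> b"
    using a AD' by (simp add: inv_mult_group m_assoc inv_mult_cancel)
  ultimately show ?thesis using dist_new_dist_self[of j g b] b a AD' by simp
qed

definition extended :: "nat \<Rightarrow> nat \<Rightarrow> 'g \<Rightarrow> real" where
  "extended i j h = (if i = m then if j = m then if h = \<one> then 0 else dist_self h else dist_new j h
     else if j = m then dist_new i (inv h) else \<rho> i j h)"

lemma extended_old: "i < m \<Longrightarrow> j < m \<Longrightarrow> extended i j h = \<rho> i j h"
  by (simp add: extended_def)

lemma extended_new: "(b, k) \<in> A \<Longrightarrow> extended m k b = f (b, k)"
  using AD by (auto simp: extended_def dist_new_A)

lemma extended_triangle:
  assumes "i \<le> m" "j \<le> m" "k \<le> m" "g \<in> carrier G" "h \<in> carrier G"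
  shows "extended i k (g \<otimes> h) \<le> extended i j g + extended j k h"
proof -
  have inv: "inv (g \<otimes> h) = inv h \<otimes> inv g" using assms by (simp add: inv_mult_group)
  note [simp] = extended_def
  consider "i < m" "j < m" "k < m" | "i = m" "j < m" "k < m" | "i < m" "j < m" "k = m"
    | "i < m" "j = m" "k < m" | "i = m" "j < m" "k = m" | "i = m" "j = m" "k < m"
    | "i < m" "j = m" "k = m" | "i = m" "j = m" "k = m"
    using assms(1-3)[THEN le_imp_less_or_eq] by blast
  then show ?thesis
  proof cases
    case 1 then show ?thesis using tri[of i j k g h] assms by simp
  next
    case 2 then show ?thesis using dist_new_lip[of j k g h] assms by simp
  next
    case 3 then show ?thesis using dist_new_lip[of j i "inv h" "inv g"] sym[of i j g] assms by (simp add: inv)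
  next
    case 4 then show ?thesis using dist_new_sum[of i k "inv g" h] assms by simp
  next
    case 5
    have "inv (g \<otimes> h) \<otimes> g = inv h" using assms by (simp add: inv m_assoc)
    then have "dist_self (g \<otimes> h) \<le> dist_new j g + dist_new j (inv h)" using dist_self_le[of j g "g \<otimes> h"] assms 5 by simp
    moreover have "0 < dist_new j g" "0 < dist_new j (inv h)" using dist_new_pos 5 assms by simp_all
    ultimately show ?thesis using 5 by simp
  next
    case 6 then show ?thesis using dist_new_dist_self[of k g h] assms by simp
  next
    case 7 then show ?thesis using dist_new_dist_self[of i "inv h" "inv g"] dist_self_inv[of h] assms by (simp add: inv)
  next
    case 8 then show ?thesis using dist_self_tri[of g h] dist_self_pos[of g] dist_self_pos[of h] assms by auto
  qed
qed

lemma rational_orbit_metric_extended: "rational_orbit_metric G (carrier G) {..<Suc m} extended"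
  unfolding rational_orbit_metric_def orbit_pseudometric_def
proof (intro conjI ballI impI)
  show "extended i i \<one> = 0" if "i \<in> {..<Suc m}" for i using that refl by (simp add: extended_def)
  show "extended i j g = extended j i (inv g)" if "i \<in> {..<Suc m}" "j \<in> {..<Suc m}" "g \<in> carrier G" for i j g
    using that sym[of i j g] dist_self_inv[of g] by (auto simp: extended_def)
  show "extended i j g \<in> \<rat>" if "i \<in> {..<Suc m}" "j \<in> {..<Suc m}" "g \<in> carrier G" for i j g
    using that dist_new_rat dist_self_rat rational_orbit_metricD(2)[OF rom, of i j g] by (auto simp: extended_def)
  have "i = j \<and> g = \<one>" if "i \<le> m" "j \<le> m" "g \<in> carrier G" "extended i j g = 0" for i j g
    using that dist_new_pos[of j g] dist_new_pos[of i "inv g"] dist_self_pos[of g] rational_orbit_metricD(3,4)[OF rom, of i j g]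
    by (auto simp: extended_def split: if_splits)
  then show "i = j" "g = \<one>"
    if "i \<in> {..<Suc m}" "j \<in> {..<Suc m}" "g \<in> carrier G" "extended i j g = 0" for i j g
    using that by (simp_all add: less_Suc_eq_le)
qed (use extended_triangle in \<open>auto simp: less_Suc_eq_le\<close>)

end

text \<open>
  Different cosets of \<open>F\<close> are put at a constant distance \<open>M\<close> that is at least the diameter.
\<close>

lemma extend_to_overgroup:
  fixes G (structure)
  assumes "group G" and F: "subgroup F G" and fin: "finite F" "finite I"
    and rom: "rational_orbit_metric G F I \<rho>"
  shows "\<exists>D. rational_orbit_metric G (carrier G) I D \<and> (\<forall>i\<in>I. \<forall>j\<in>I. \<forall>g\<in>F. D i j g = \<rho> i j g)"
proof -
  interpret group G by fact
  note FC = subgroup.mem_carrier[OF F]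
  note opm = rational_orbit_metricD(1)[OF rom]
  have nn: "0 \<le> \<rho> i j g" if "i \<in> I" "j \<in> I" "g \<in> F" for i j g
    using orbit_pseudometric_nonneg[OF is_group F opm that] .
  define T where "T = (\<lambda>(i, j, g). \<rho> i j g) ` (I \<times> I \<times> F)"
  define M where "M = Max (insert 1 T)"
  have T: "finite T" "T \<subseteq> \<rat>" using fin rational_orbit_metricD(2)[OF rom] by (auto simp: T_def)
  have M: "M \<in> \<rat>" "1 \<le> M"
    using T Max_in[of "insert 1 T"] by (auto simp: M_def)
  have bd: "\<rho> i j g \<le> M" if "i \<in> I" "j \<in> I" "g \<in> F" for i j g
  proof -
    have "(\<lambda>(i, j, g). \<rho> i j g) (i, j, g) \<in> T" unfolding T_def by (rule imageI) (use that in auto)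
    then show ?thesis unfolding M_def using T by simp
  qed
  define D where "D i j g = (if g \<in> F then \<rho> i j g else M)" for i j g
  have invF: "inv g \<in> F \<longleftrightarrow> g \<in> F" if "g \<in> carrier G" for g
    using that subgroup.m_inv_closed[OF F] by force
  have tri: "D i k (g \<otimes> h) \<le> D i j g + D j k h"
    if a: "i \<in> I" "j \<in> I" "k \<in> I" "g \<in> carrier G" "h \<in> carrier G" for i j k g h
  proof -
    have 1: "g \<otimes> h \<in> F \<longleftrightarrow> h \<in> F" if "g \<in> F"
    proof
      assume "g \<otimes> h \<in> F"
      then have "inv g \<otimes> (g \<otimes> h) \<in> F" using that subgroup.m_closed[OF F] subgroup.m_inv_closed[OF F] by blast
      then show "h \<in> F" using a by (simp add: inv_mult_cancel)
    qed (use that subgroup.m_closed[OF F] in blast)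
    have 2: "g \<otimes> h \<in> F \<longleftrightarrow> g \<in> F" if "h \<in> F"
    proof
      assume "g \<otimes> h \<in> F"
      then have "(g \<otimes> h) \<otimes> inv h \<in> F" using that subgroup.m_closed[OF F] subgroup.m_inv_closed[OF F] by blast
      then show "g \<in> F" using a by (simp add: m_assoc)
    qed (use that subgroup.m_closed[OF F] in blast)
    show ?thesis
      using 1 2 a M nn[of i j g] nn[of j k h] bd[of i k "g \<otimes> h"] orbit_pseudometricD(3)[OF opm a(1-3), of g h]
      by (auto simp: D_def)
  qed
  have "rational_orbit_metric G (carrier G) I D"
    unfolding rational_orbit_metric_def orbit_pseudometric_def
  proof (intro conjI ballI impI)
    show "D i i \<one> = 0" if "i \<in> I" for i
      using that orbit_pseudometricD(1)[OF opm] subgroup.one_closed[OF F] by (simp add: D_def)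
    show "D i j g = D j i (inv g)" if "i \<in> I" "j \<in> I" "g \<in> carrier G" for i j g
      using that invF[of g] orbit_pseudometricD(2)[OF opm, of i j g] by (auto simp: D_def)
    show "D i j g \<in> \<rat>" if "i \<in> I" "j \<in> I" "g \<in> carrier G" for i j g
      using that rational_orbit_metricD(2)[OF rom] M by (simp add: D_def)
    show "i = j" "g = \<one>" if "i \<in> I" "j \<in> I" "g \<in> carrier G" "D i j g = 0" for i j g
      using that rational_orbit_metricD(3,4)[OF rom, of i j g] M by (auto simp: D_def split: if_splits)
  qed (use tri in auto)
  then show ?thesis by (auto simp: D_def)
qed

text \<open>
  One new orbit is added at each stage, and every request \<open>(A, f)\<close> for a point with prescribed
  distances is considered at infinitely many stages, hence also at one at which all of \<open>A\<close> is there.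
\<close>

lemma universal_orbit_metric:
  fixes G (structure)
  assumes "group G" and cnt: "countable (carrier G)" and F: "subgroup F G" "finite F" and n: "0 < n"
    and rom: "rational_orbit_metric G F {..<n} \<rho>"
  shows "\<exists>D. rational_orbit_metric G (carrier G) (UNIV :: nat set) D \<and>
    (\<forall>i<n. \<forall>j<n. \<forall>g\<in>F. D i j g = \<rho> i j g) \<and>
    extension_property (carrier G \<times> UNIV) (orbit_dist G D)"
proof -
  interpret group G by fact
  obtain D0 where D0: "rational_orbit_metric G (carrier G) {..<n} D0"
      "\<And>i j g. i < n \<Longrightarrow> j < n \<Longrightarrow> g \<in> F \<Longrightarrow> D0 i j g = \<rho> i j g"
    using extend_to_overgroup[OF is_group F _ rom] by auto
  let ?X = "carrier G \<times> (UNIV :: nat set)"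
  define Req where "Req = (SIGMA A:{A. finite A \<and> A \<subseteq> ?X}. PiE A (\<lambda>_. \<rat> :: real set))"
  have cX: "countable ?X" using cnt by simp
  have cReq: "countable Req"
    unfolding Req_def
  proof (rule countable_SIGMA)
    show "countable {A. finite A \<and> A \<subseteq> ?X}" using countable_Collect_finite_subset[OF cX] .
    show "countable (PiE A (\<lambda>_. \<rat> :: real set))" if "A \<in> {A. finite A \<and> A \<subseteq> ?X}" for A
      using that by (intro countable_PiE) (auto simp: countable_rat)
  qed
  define req where "req k = from_nat_into Req (fst (prod_decode k))" for k
  define good where "good m D r \<longleftrightarrow> finite (fst r) \<and> fst r \<noteq> {} \<and> fst r \<subseteq> carrier G \<times> {..<m} \<and>
      katetov (orbit_dist G D) (fst r) (snd r)" for m D and r :: "('a \<times> nat) set \<times> ('a \<times> nat \<Rightarrow> real)"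
  \<comment> \<open>an unusable request is replaced by a default one, so that each stage adds an orbit\<close>
  define task where "task m D r = (if good m D r then r else ({(\<one>, 0)}, \<lambda>_. 1))" for m D r
  define R where "R = rec_nat D0 (\<lambda>k D. orbit_extension.extended G D (n + k) (fst (task (n + k) D (req k))) (snd (task (n + k) D (req k))))"
  have R0: "R 0 = D0" by (simp add: R_def)
  have RS: "R (Suc k) = orbit_extension.extended G (R k) (n + k) (fst (task (n + k) (R k) (req k))) (snd (task (n + k) (R k) (req k)))" for k
    by (simp add: R_def)
  have loc: "orbit_extension G (R k) (n + k) (fst (task (n + k) (R k) (req k))) (snd (task (n + k) (R k) (req k)))"
    if rk: "rational_orbit_metric G (carrier G) {..<n + k} (R k)" for k
  proof -
    have "orbit_dist G (R k) (\<one>, 0) (\<one>, 0) = 0"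
      using orbit_pseudometricD(1)[OF rational_orbit_metricD(1)[OF rk], of 0] n by (simp add: orbit_dist_def)
    then have "good (n + k) (R k) (task (n + k) (R k) (req k))"
      using n by (auto simp: task_def good_def katetov_def)
    then show ?thesis
      using rk by (unfold_locales) (auto simp: good_def)
  qed
  have Rk: "rational_orbit_metric G (carrier G) {..<n + k} (R k)" for k
  proof (induction k)
    case 0 then show ?case using D0 by (simp add: R0)
  next
    case (Suc k)
    show ?case using orbit_extension.rational_orbit_metric_extended[OF loc[OF Suc]] by (simp add: RS)
  qed
  have step: "R (Suc k) i j g = R k i j g" if "i < n + k" "j < n + k" for i j k g
    using orbit_extension.extended_old[OF loc[OF Rk], of i k j g] that by (simp add: RS)
  have stable: "R l i j g = R k i j g" if "k \<le> l" "i < n + k" "j < n + k" for i j k l g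
    using that by (induction l rule: dec_induct) (auto simp: step)
  define D where "D i j g = R (max i j) i j g" for i j g
  have DR: "D i j g = R k i j g" if "i < n + k" "j < n + k" for i j k g
  proof (cases "k \<le> max i j")
    case True then show ?thesis using stable[of k "max i j" i j g] that by (simp add: D_def)
  next
    case False
    then show ?thesis using stable[of "max i j" k i j g] n by (simp add: D_def max_def split: if_splits)
  qed
  have big: "\<exists>k. i < n + k \<and> j < n + k \<and> l < n + k" for i j l
    by (rule exI[of _ "Suc (max i (max j l))"]) auto
  have romD: "rational_orbit_metric G (carrier G) UNIV D"
    unfolding rational_orbit_metric_def orbit_pseudometric_def
  proof (intro conjI ballI impI)
    show "D i i \<one> = 0" for i
      using big[of i i i] orbit_pseudometricD(1)[OF rational_orbit_metricD(1)[OF Rk], of i] by (auto simp: DR)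
    show "D i j g = D j i (inv g)" if g: "g \<in> carrier G" for i j g
    proof -
      obtain k where k: "i < n + k" "j < n + k" using big by blast
      then show ?thesis using orbit_pseudometricD(2)[OF rational_orbit_metricD(1)[OF Rk[of k]], of i j g] g
        by (simp add: DR)
    qed
    show "D i l (g \<otimes> h) \<le> D i j g + D j l h" if g: "g \<in> carrier G" "h \<in> carrier G" for i j l g h
    proof -
      obtain k where k: "i < n + k" "j < n + k" "l < n + k" using big by blast
      then show ?thesis using orbit_pseudometricD(3)[OF rational_orbit_metricD(1)[OF Rk[of k]], of i j l g h] g
        by (simp add: DR)
    qed
    show "D i j g \<in> \<rat>" if g: "g \<in> carrier G" for i j g
    proof -
      obtain k where k: "i < n + k" "j < n + k" using big by blast
      then show ?thesis using rational_orbit_metricD(2)[OF Rk[of k], of i j g] g by (simp add: DR)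
    qed
    show "i = j" "g = \<one>" if g: "g \<in> carrier G" "D i j g = 0" for i j g
    proof -
      obtain k where k: "i < n + k" "j < n + k" using big by blast
      then show "i = j" "g = \<one>" using rational_orbit_metricD(3,4)[OF Rk[of k], of i j g] g by (auto simp: DR)
    qed
  qed
  have "extension_property ?X (orbit_dist G D)"
    unfolding extension_property_def
  proof (intro allI impI, elim conjE)
    fix A f assume A: "finite A" "A \<noteq> {}" "A \<subseteq> ?X" "katetov (orbit_dist G D) A f"
    let ?f = "restrict f A"
    have "(A, ?f) \<in> Req" using A by (auto simp: Req_def katetov_def)
    then obtain r where r: "from_nat_into Req r = (A, ?f)"
      using from_nat_into_surj[OF cReq] by blast
    have "finite (snd ` A)" using A by simp
    then obtain t where "\<forall>i\<in>snd ` A. i < t" unfolding finite_nat_set_iff_bounded by (rule exE)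
    then have t: "i \<in> snd ` A \<Longrightarrow> i < t" for i by blast
    \<comment> \<open>a stage that treats this request and comes after all indices in \<open>A\<close>\<close>
    define k where "k = prod_encode (r, t)"
    have "t \<le> k" unfolding k_def by (rule le_prod_encode_2)
    then have tk: "i < n + k" if "(g, i) \<in> A" for g i using t[of i] that by force
    have req: "req k = (A, ?f)" by (simp add: req_def k_def r)
    have "orbit_dist G (R k) a b = orbit_dist G D a b" if "a \<in> A" "b \<in> A" for a b
      using that DR[of "snd a" k "snd b"] tk[of "fst a" "snd a"] tk[of "fst b" "snd b"]
      by (simp add: orbit_dist_def case_prod_beta)
    then have kat: "katetov (orbit_dist G (R k)) A ?f"
      using A(4) by (simp add: katetov_def)
    have "good (n + k) (R k) (A, ?f)"
      using A kat tk by (auto simp: good_def)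
    then have task: "task (n + k) (R k) (req k) = (A, ?f)" by (simp add: task_def req)
    have "D (n + k) i g = f (g, i)" if "(g, i) \<in> A" for g i
      using orbit_extension.extended_new[OF loc[OF Rk], of g i k] that tk[OF that]
      by (simp add: task DR[of _ "Suc k"] RS)
    then have "\<forall>a\<in>A. orbit_dist G D (\<one>, n + k) a = f a"
      using A by (auto simp: orbit_dist_def)
    then show "\<exists>x\<in>?X. \<forall>a\<in>A. orbit_dist G D x a = f a" by (intro bexI[of _ "(\<one>, n + k)"]) auto
  qed
  moreover have "\<forall>i<n. \<forall>j<n. \<forall>g\<in>F. D i j g = \<rho> i j g"
    using D0 DR[of _ 0] by (simp add: R0)
  ultimately show ?thesis using romD by blast
qed

section \<open>Isometries from dense relations, and the rational Urysohn space\<close>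

lemma dist_quadrilateral:
  fixes a b c d :: "'u::metric_space"
  shows "\<bar>dist a b - dist c d\<bar> \<le> dist a c + dist b d"
  using dist_triangle[of a b c] dist_triangle[of c b d] dist_triangle[of c d a] dist_triangle[of a d b]
  by (simp add: dist_commute)

lemma isometry_continuous:
  assumes "isometric_on UNIV f" shows "continuous_on UNIV f"
  unfolding continuous_on_iff using assms by (auto simp: isometric_on_def)

lemma isometries_eq_on_dense:
  fixes f g :: "'u::metric_space \<Rightarrow> 'v::metric_space"
  assumes "isometric_on UNIV f" "isometric_on UNIV g" "closure S = UNIV" "\<And>x. x \<in> S \<Longrightarrow> f x = g x"
  shows "f = g"
proof
  fix x
  have "closed {x. f x = g x}"
    using isometry_continuous assms(1,2) by (intro closed_Collect_eq)
  then have "closure S \<subseteq> {x. f x = g x}" using assms(4) by (intro closure_minimal) auto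
  then show "f x = g x" using assms(3) by auto
qed

lemma isometric_relation_limits:
  fixes R :: "('a::metric_space \<times> 'b::metric_space) set"
  assumes "complete (UNIV :: 'b set)"
    and iso: "\<And>x y x' y'. (x, y) \<in> R \<Longrightarrow> (x', y') \<in> R \<Longrightarrow> dist x x' = dist y y'"
    and dense: "closure (Domain R) = UNIV"
  shows "\<exists>u v y. (\<forall>n. (u n, v n) \<in> R) \<and> u \<longlonglongrightarrow> x \<and> v \<longlonglongrightarrow> y"
proof -
  obtain u where u: "\<And>n. u n \<in> Domain R" "u \<longlonglongrightarrow> x"
    using dense closure_sequential[of x "Domain R"] by auto
  then have "\<forall>n. \<exists>v. (u n, v) \<in> R" by blast
  then obtain v where v: "\<And>n. (u n, v n) \<in> R" by metis
  have "Cauchy u" using u by (simp add: LIMSEQ_imp_Cauchy)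
  then have "Cauchy v"
    unfolding Cauchy_def using iso[OF v v] by simp
  then obtain y where "v \<longlonglongrightarrow> y" using assms(1) by (auto simp: complete_def)
  then show ?thesis using u v by blast
qed

text \<open>
  Since domain and range are both dense, the closure of the relation is the graph of a bijection.
\<close>

lemma isometric_relation_extension:
  fixes R :: "('u::metric_space \<times> 'u) set"
  assumes compl: "complete (UNIV :: 'u set)"
    and iso: "\<And>x y x' y'. (x, y) \<in> R \<Longrightarrow> (x', y') \<in> R \<Longrightarrow> dist x x' = dist y y'"
    and dense: "closure (Domain R) = UNIV" "closure (Range R) = UNIV"
  shows "\<exists>\<phi> \<in> carrier isometry_group. \<forall>(x, y) \<in> R. \<phi> x = y"
proof -
  define L where "L x y \<longleftrightarrow> (\<exists>u v. (\<forall>n. (u n, v n) \<in> R) \<and> u \<longlonglongrightarrow> x \<and> v \<longlonglongrightarrow> y)" for x y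
  have tot: "\<exists>y. L x y" for x
    using isometric_relation_limits[OF compl iso dense(1), of x] by (auto simp: L_def)
  have sur: "\<exists>x. L x y" for y
  proof -
    have "\<exists>u v x. (\<forall>n. (u n, v n) \<in> R\<inverse>) \<and> u \<longlonglongrightarrow> y \<and> v \<longlonglongrightarrow> x"
      by (rule isometric_relation_limits[OF compl]) (use iso dense in auto)
    then show ?thesis by (auto simp: L_def)
  qed
  have Liso: "dist x x' = dist y y'" if L: "L x y" "L x' y'" for x y x' y'
  proof -
    obtain u v where s: "\<forall>n. (u n, v n) \<in> R" "u \<longlonglongrightarrow> x" "v \<longlonglongrightarrow> y"
      using L(1) unfolding L_def by (elim exE conjE)
    obtain u' v' where t: "\<forall>n. (u' n, v' n) \<in> R" "u' \<longlonglongrightarrow> x'" "v' \<longlonglongrightarrow> y'"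
      using L(2) unfolding L_def by (elim exE conjE)
    have "(\<lambda>n. dist (u n) (u' n)) \<longlonglongrightarrow> dist x x'" "(\<lambda>n. dist (v n) (v' n)) \<longlonglongrightarrow> dist y y'"
      using s t by (auto intro: tendsto_dist)
    then show ?thesis using iso[OF s(1)[rule_format] t(1)[rule_format]] LIMSEQ_unique by simp
  qed
  have LR: "L x y" if "(x, y) \<in> R" for x y
    unfolding L_def using that by (intro exI[of _ "\<lambda>_. x"] exI[of _ "\<lambda>_. y"]) auto
  define \<phi> where "\<phi> x = (SOME y. L x y)" for x
  have \<phi>: "L x (\<phi> x)" for x unfolding \<phi>_def using tot by (rule someI_ex)
  have eq: "\<phi> x = y" if "L x y" for x y
    using Liso[OF \<phi>[of x] that] by simp
  have "surj \<phi>" by (metis sur eq surj_def)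
  moreover have "isometric_on UNIV \<phi>" using Liso[OF \<phi> \<phi>] by (simp add: isometric_on_def)
  ultimately show ?thesis using eq LR by (intro bexI[of _ \<phi>]) (auto simp: isometry_group_def)
qed

definition rational_metric_on :: "'a set \<Rightarrow> ('a \<Rightarrow> 'a \<Rightarrow> real) \<Rightarrow> bool" where
  "rational_metric_on X d \<longleftrightarrow>
     (\<forall>x\<in>X. \<forall>y\<in>X. d x y \<in> \<rat> \<and> (d x y = 0 \<longleftrightarrow> x = y) \<and> d x y = d y x) \<and>
     (\<forall>x\<in>X. \<forall>y\<in>X. \<forall>z\<in>X. d x z \<le> d x y + d y z)"

lemma rational_metric_onD:
  assumes "rational_metric_on X d" "x \<in> X" "y \<in> X"
  shows "d x y \<in> \<rat>" "d x y = 0 \<longleftrightarrow> x = y" "d x y = d y x" "0 \<le> d x y"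
    "z \<in> X \<Longrightarrow> d x z \<le> d x y + d y z"
proof -
  show 1: "d x y \<in> \<rat>" "d x y = 0 \<longleftrightarrow> x = y" "d x y = d y x" "z \<in> X \<Longrightarrow> d x z \<le> d x y + d y z"
    using assms unfolding rational_metric_on_def by blast+
  have "d x x \<le> d x y + d y x" "d x x = 0"
    using assms unfolding rational_metric_on_def by blast+
  then show "0 \<le> d x y" using 1 by simp
qed

lemma rational_metric_onI:
  assumes "\<And>x y. x \<in> X \<Longrightarrow> y \<in> X \<Longrightarrow> d x y \<in> \<rat>"
    "\<And>x y. x \<in> X \<Longrightarrow> y \<in> X \<Longrightarrow> d x y = 0 \<longleftrightarrow> x = y"
    "\<And>x y. x \<in> X \<Longrightarrow> y \<in> X \<Longrightarrow> d x y = d y x"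
    "\<And>x y z. x \<in> X \<Longrightarrow> y \<in> X \<Longrightarrow> z \<in> X \<Longrightarrow> d x z \<le> d x y + d y z"
  shows "rational_metric_on X d"
  unfolding rational_metric_on_def using assms(1,2,4) by (intro conjI ballI) (blast intro: assms(3))+

lemma rational_urysohn_metric: "rational_urysohn Q \<Longrightarrow> rational_metric_on Q dist"
  by (rule rational_metric_onI) (auto simp: rational_urysohn_def dist_commute dist_triangle)

text \<open>
  A copy of \<open>X\<close> exists somewhere in \<open>Q\<close>; ultrahomogeneity moves its part over \<open>A\<close> to the prescribed
  place.
\<close>

lemma rational_urysohn_extend:
  fixes X :: "'a set"
  assumes Q: "rational_urysohn Q" and X: "finite X" "rational_metric_on X d"
    and A: "A \<subseteq> X" "e ` A \<subseteq> Q" "\<And>a b. a \<in> A \<Longrightarrow> b \<in> A \<Longrightarrow> dist (e a) (e b) = d a b"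
  shows "\<exists>e'. e' ` X \<subseteq> Q \<and> (\<forall>x\<in>X. \<forall>y\<in>X. dist (e' x) (e' y) = d x y) \<and> (\<forall>a\<in>A. e' a = e a)"
proof -
  note dX = rational_metric_onD[OF X(2)]
  obtain h :: "'a \<Rightarrow> nat" where h: "inj_on h X"
    using finite_imp_inj_to_nat_seg[OF X(1)] by blast
  define k where "k = inv_into X h"
  have kh: "k (h x) = x" if "x \<in> X" for x using h that by (simp add: k_def)
  define D where "D m n = (if m \<in> h ` X \<and> n \<in> h ` X then d (k m) (k n) else 0)" for m n
  have D: "D (h x) (h y) = d x y" if "x \<in> X" "y \<in> X" for x y using that by (simp add: D_def kh)
  have "Metric_space (h ` X) D"
  proof
    show "0 \<le> D m n" for m n by (auto simp: D_def kh dX(4))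
    show "D m n = D n m" for m n
      by (auto simp: D_def kh intro: dX(3))
    show "D m n = 0 \<longleftrightarrow> m = n" if "m \<in> h ` X" "n \<in> h ` X" for m n
      using that h dX(2) by (auto simp: D inj_on_eq_iff)
    show "D m p \<le> D m n + D n p" if "m \<in> h ` X" "n \<in> h ` X" "p \<in> h ` X" for m n p
      using that by (auto simp: D dX(5))
  qed
  moreover have "\<forall>m\<in>h ` X. \<forall>n\<in>h ` X. D m n \<in> \<rat>" by (auto simp: D dX(1))
  ultimately obtain f where f: "f ` h ` X \<subseteq> Q" "\<And>m n. m \<in> h ` X \<Longrightarrow> n \<in> h ` X \<Longrightarrow> dist (f m) (f n) = D m n"
    using Q X(1) unfolding rational_urysohn_def by (metis finite_imageI)
  define f' where "f' x = f (h x)" for x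
  have f': "f' ` X \<subseteq> Q" "\<And>x y. x \<in> X \<Longrightarrow> y \<in> X \<Longrightarrow> dist (f' x) (f' y) = d x y"
    using f by (auto simp: f'_def D)
  have inj: "inj_on f' X" by (rule inj_onI) (metis dX(2) f'(2) dist_self)
  define r where "r u = e (inv_into X f' u)" for u
  have r: "r (f' a) = e a" if "a \<in> A" for a using that A inj by (auto simp: r_def)
  have "finite (f' ` A)" "f' ` A \<subseteq> Q" "r ` f' ` A \<subseteq> Q" "isometric_on (f' ` A) r"
    using A X f' by (auto simp: finite_subset r isometric_on_def subset_iff)
  then obtain g where g: "bij_betw g Q Q" "isometric_on Q g" "\<And>u. u \<in> f' ` A \<Longrightarrow> g u = r u"
    using Q unfolding rational_urysohn_def by metis
  have "(g \<circ> f') ` X \<subseteq> Q" using g(1) f'(1) unfolding bij_betw_def image_comp[symmetric] by blast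
  moreover have "dist ((g \<circ> f') x) ((g \<circ> f') y) = d x y" if "x \<in> X" "y \<in> X" for x y
    using that g(2) f' by (auto simp: isometric_on_def image_subset_iff)
  moreover have "(g \<circ> f') a = e a" if "a \<in> A" for a using that g(3) r by simp
  ultimately show ?thesis by blast
qed

lemma rational_urysohn_extension_property:
  assumes Q: "rational_urysohn Q"
  shows "extension_property Q dist"
  unfolding extension_property_def
proof (intro allI impI, elim conjE)
  fix A f assume A: "finite A" "A \<noteq> {}" "A \<subseteq> Q" and f: "katetov dist A f"
  note dQ = rational_metric_onD[OF rational_urysohn_metric[OF Q]]
  have f': "f a \<in> \<rat>" "0 < f a" "b \<in> A \<Longrightarrow> f a \<le> f b + dist a b" "b \<in> A \<Longrightarrow> dist a b \<le> f a + f b"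
    if "a \<in> A" for a b
    using f that by (auto simp: katetov_def)
  define d where "d x y = (case x of None \<Rightarrow> (case y of None \<Rightarrow> 0 | Some b \<Rightarrow> f b)
      | Some a \<Rightarrow> (case y of None \<Rightarrow> f a | Some b \<Rightarrow> dist a b))" for x y
  have "rational_metric_on (insert None (Some ` A)) d"
  proof (rule rational_metric_onI)
    fix x y z assume "x \<in> insert None (Some ` A)" "y \<in> insert None (Some ` A)" "z \<in> insert None (Some ` A)"
    then show "d x z \<le> d x y + d y z"
      using f' by (auto simp: d_def dist_triangle less_imp_le) (metis add.commute dist_commute)+
  qed (use A f' dQ in \<open>force simp: d_def dist_commute subset_iff\<close>)+
  then have "\<exists>e. e ` insert None (Some ` A) \<subseteq> Q \<and>
      (\<forall>x\<in>insert None (Some ` A). \<forall>y\<in>insert None (Some ` A). dist (e x) (e y) = d x y) \<and>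
      (\<forall>a\<in>Some ` A. e a = the a)"
  proof (intro rational_urysohn_extend[OF Q])
    show "dist (the x) (the y) = d x y" if "x \<in> Some ` A" "y \<in> Some ` A" for x y
      using that by (auto simp: d_def)
  qed (use A in auto)
  then obtain e where e: "e ` insert None (Some ` A) \<subseteq> Q" "\<And>x y. x \<in> insert None (Some ` A) \<Longrightarrow> y \<in> insert None (Some ` A) \<Longrightarrow> dist (e x) (e y) = d x y"
     "\<And>a. a \<in> Some ` A \<Longrightarrow> e a = the a"
    by blast
  have "dist (e None) a = f a" if "a \<in> A" for a
    using e(2)[of None "Some a"] e(3)[of "Some a"] that by (simp add: d_def)
  then show "\<exists>x\<in>Q. \<forall>a\<in>A. dist x a = f a" using e(1) by auto
qed

text \<open>
  Two finite spaces whose distances differ by at most \<open>2 * c\<close> can be placed side by side with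
  corresponding points at distance \<open>c\<close>. Extending the identity of the second space to this union
  gives the copy of the first.
\<close>

lemma rational_urysohn_approximate:
  fixes X :: "'a set"
  assumes Q: "rational_urysohn Q" and X: "finite X" "rational_metric_on X d"
    and T: "T \<subseteq> X" "q ` T \<subseteq> Q" and c: "c \<in> \<rat>" "0 < c"
    and near: "\<And>s t. s \<in> T \<Longrightarrow> t \<in> T \<Longrightarrow> \<bar>d s t - dist (q s) (q t)\<bar> \<le> 2 * c"
  shows "\<exists>e. e ` X \<subseteq> Q \<and> (\<forall>x\<in>X. \<forall>y\<in>X. dist (e x) (e y) = d x y) \<and> (\<forall>t\<in>T. dist (e t) (q t) \<le> c)"
proof (cases "T = {}")
  case True
  then show ?thesis using rational_urysohn_extend[OF Q X, of "{}"] by auto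
next
  case False
  have finT: "finite T" using T X finite_subset by blast
  note dX = rational_metric_onD[OF X(2)]
  note dQ = rational_metric_onD[OF rational_urysohn_metric[OF Q]]
  define cr where "cr x u = Min ((\<lambda>t. d x t + c + dist (q t) u) ` T)" for x u
  have cr_le: "cr x u \<le> d x t + c + dist (q t) u" if "t \<in> T" for x u t
    unfolding cr_def using that finT by simp
  have cr_at: "\<exists>t\<in>T. cr x u = d x t + c + dist (q t) u" for x u
  proof -
    have "cr x u \<in> (\<lambda>t. d x t + c + dist (q t) u) ` T"
      unfolding cr_def using finT False by (intro Min_in) auto
    then show ?thesis by auto
  qed
  have cr_rat: "cr x u \<in> \<rat>" and cr_pos: "0 < cr x u" if "x \<in> X" "u \<in> Q" for x u
  proof -
    obtain t where t: "t \<in> T" "cr x u = d x t + c + dist (q t) u" using cr_at by blast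
    then show "cr x u \<in> \<rat>" "0 < cr x u"
      using dX(1,4)[of x t] dQ(1)[of "q t" u] c T that by (auto simp: subset_iff intro: add_nonneg_pos add_pos_nonneg)
  qed
  have cr1: "cr x u \<le> d x y + cr y u" if "x \<in> X" "y \<in> X" for x y u
  proof -
    obtain t where t: "t \<in> T" "cr y u = d y t + c + dist (q t) u" using cr_at by blast
    then have "t \<in> X" using T by blast
    then show ?thesis using cr_le[OF t(1), of x u] t dX(5)[OF that, of t] by simp
  qed
  have cr2: "cr x u \<le> cr x w + dist w u" for x w u
  proof -
    obtain t where t: "t \<in> T" "cr x w = d x t + c + dist (q t) w" using cr_at by blast
    then show ?thesis using cr_le[OF t(1), of x u] dist_triangle[of "q t" u w] by simp
  qed
  have cr3: "d x y \<le> cr x u + cr y u" if "x \<in> X" "y \<in> X" for x y u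
  proof -
    obtain s where s: "s \<in> T" "cr x u = d x s + c + dist (q s) u" using cr_at by blast
    obtain t where t: "t \<in> T" "cr y u = d y t + c + dist (q t) u" using cr_at by blast
    have st: "s \<in> X" "t \<in> X" using s t T by auto
    have "d x y \<le> d x s + (d s t + d t y)"
      using dX(5)[OF that(1) st(1), of y] dX(5)[OF st, of y] that by linarith
    moreover have "d s t \<le> dist (q s) u + dist (q t) u + 2 * c"
      using near[OF s(1) t(1)] dist_triangle2[of "q s" "q t" u] by linarith
    moreover have "d t y = d y t" using dX(3)[OF st(2) that(2)] .
    ultimately show ?thesis using s t by simp
  qed
  have cr4: "dist u w \<le> cr x u + cr x w" if "x \<in> X" for x u w
  proof -
    obtain s where s: "s \<in> T" "cr x u = d x s + c + dist (q s) u" using cr_at by blast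
    obtain t where t: "t \<in> T" "cr x w = d x t + c + dist (q t) w" using cr_at by blast
    have st: "s \<in> X" "t \<in> X" using s t T by auto
    have "d s t \<le> d x s + d x t" using dX(5)[OF st(1) that, of t] dX(3)[OF that st(1)] st by simp
    moreover have "dist u w \<le> dist (q s) u + (dist (q s) (q t) + dist (q t) w)"
      using dist_triangle3[of u w "q s"] dist_triangle[of "q s" w "q t"] by linarith
    ultimately show ?thesis using s t near[OF s(1) t(1)] by linarith
  qed
  define D where "D x y = (case x of Inl a \<Rightarrow> (case y of Inl b \<Rightarrow> d a b | Inr w \<Rightarrow> cr a w)
      | Inr u \<Rightarrow> (case y of Inl b \<Rightarrow> cr b u | Inr w \<Rightarrow> dist u w))" for x y
  let ?Z = "Inl ` X \<union> Inr ` (q ` T)"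
  have "rational_metric_on ?Z D"
  proof (rule rational_metric_onI)
    fix x y z assume "x \<in> ?Z" "y \<in> ?Z" "z \<in> ?Z"
    moreover have "cr b w \<le> cr a w + d a b" if "a \<in> X" "b \<in> X" for a b w
      using cr1[of b a w] dX(3)[of a b] that by simp
    moreover have "cr a u \<le> dist u w + cr a w" for a u w
      using cr2[of a u w] by (simp add: dist_commute)
    ultimately show "D x z \<le> D x y + D y z"
      by (auto simp: D_def intro: dX(5) cr1 cr2 cr3 cr4 dist_triangle)
  next
    fix x y assume xy: "x \<in> ?Z" "y \<in> ?Z"
    show "D x y \<in> \<rat>" using xy T(2) dX(1) cr_rat dQ(1) by (auto simp: D_def subset_iff)
    show "D x y = 0 \<longleftrightarrow> x = y" using xy T(2) dX(2) cr_pos by (force simp: D_def subset_iff)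
    show "D x y = D y x" using xy dX(3) by (auto simp: D_def dist_commute)
  qed
  moreover have "finite ?Z" using X finT by simp
  ultimately have "\<exists>e. e ` ?Z \<subseteq> Q \<and> (\<forall>x\<in>?Z. \<forall>y\<in>?Z. dist (e x) (e y) = D x y) \<and>
      (\<forall>u\<in>Inr ` (q ` T). e u = (\<lambda>z. case z of Inr u \<Rightarrow> u) u)"
  proof (intro rational_urysohn_extend[OF Q])
    show "dist (case x of Inr u \<Rightarrow> u) (case y of Inr u \<Rightarrow> u) = D x y"
      if "x \<in> Inr ` q ` T" "y \<in> Inr ` q ` T" for x y using that by (auto simp: D_def)
  qed (use T(2) in auto)
  then obtain e where e0: "e ` ?Z \<subseteq> Q" "\<forall>x\<in>?Z. \<forall>y\<in>?Z. dist (e x) (e y) = D x y"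
     "\<forall>u\<in>Inr ` (q ` T). e u = (\<lambda>z. case z of Inr u \<Rightarrow> u) u"
    by (elim exE conjE)
  then have e: "e ` ?Z \<subseteq> Q" "\<And>x y. x \<in> ?Z \<Longrightarrow> y \<in> ?Z \<Longrightarrow> dist (e x) (e y) = D x y"
     "\<And>u. u \<in> q ` T \<Longrightarrow> e (Inr u) = u" by auto
  have "dist (e (Inl t)) (q t) \<le> c" if "t \<in> T" for t
    using e(2)[of "Inl t" "Inr (q t)"] e(3)[of "q t"] that T cr_le[OF that, of t "q t"] dX(2)[of t t]
    by (auto simp: D_def)
  moreover have "dist (e (Inl x)) (e (Inl y)) = d x y" if "x \<in> X" "y \<in> X" for x y
    using e(2)[of "Inl x" "Inl y"] that by (simp add: D_def)
  ultimately show ?thesis using e(1) by (intro exI[of _ "\<lambda>x. e (Inl x)"]) auto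
qed

section \<open>Back and forth between countable rational metric spaces\<close>

definition isometric_relation ::
  "'a set \<Rightarrow> ('a \<Rightarrow> 'a \<Rightarrow> real) \<Rightarrow> 'b set \<Rightarrow> ('b \<Rightarrow> 'b \<Rightarrow> real) \<Rightarrow> ('a \<times> 'b) set \<Rightarrow> bool" where
  "isometric_relation X d Y d' R \<longleftrightarrow> finite R \<and> R \<noteq> {} \<and> R \<subseteq> X \<times> Y \<and>
     (\<forall>(x, y)\<in>R. \<forall>(x', y')\<in>R. d x x' = d' y y')"

lemma isometric_relation_converse:
  "isometric_relation X d Y d' R \<Longrightarrow> isometric_relation Y d' X d (R\<inverse>)"
proof -
  assume R: "isometric_relation X d Y d' R"
  have "d' y y' = d x x'" if "(x, y) \<in> R" "(x', y') \<in> R" for x y x' y'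
    using R that unfolding isometric_relation_def by fastforce
  moreover have "finite R" "R \<noteq> {}" "R \<subseteq> X \<times> Y" using R by (auto simp: isometric_relation_def)
  ultimately show ?thesis unfolding isometric_relation_def by blast
qed

lemma isometric_relation_extend:
  assumes X: "rational_metric_on X d" and Y: "rational_metric_on Y d'" "extension_property Y d'"
    and R: "isometric_relation X d Y d' R" and x: "x \<in> X"
  shows "\<exists>R'. isometric_relation X d Y d' R' \<and> R \<subseteq> R' \<and> x \<in> Domain R'"
proof (cases "x \<in> Domain R")
  case True
  then show ?thesis using R by blast
next
  case False
  note dX = rational_metric_onD[OF X] and dY = rational_metric_onD[OF Y(1)]
  have R': "finite R" "R \<noteq> {}" "R \<subseteq> X \<times> Y"
    and iso: "\<And>u v u' v'. (u, v) \<in> R \<Longrightarrow> (u', v') \<in> R \<Longrightarrow> d u u' = d' v v'"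
    using R by (auto simp: isometric_relation_def)
  have uniq: "u = u'" if "(u, v) \<in> R" "(u', v) \<in> R" for u u' v
    using iso[OF that] dY(2)[of v v] dX(2)[of u u'] that R'(3) by auto
  define h where "h v = (THE u. (u, v) \<in> R)" for v
  have h: "h v = u" if "(u, v) \<in> R" for u v
    unfolding h_def using that uniq by blast
  have "katetov d' (Range R) (\<lambda>v. d x (h v))"
    unfolding katetov_def
  proof (intro conjI ballI)
    fix v assume "v \<in> Range R"
    then obtain u where u: "(u, v) \<in> R" "u \<in> X" using R' by auto
    have "x \<noteq> u" using False u by blast
    then show "d x (h v) \<in> \<rat>" "0 < d x (h v)"
      using dX(1,2,4)[OF x u(2)] h[OF u(1)] by auto
    fix v' assume "v' \<in> Range R"
    then obtain u' where u': "(u', v') \<in> R" "u' \<in> X" using R' by auto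
    show "d x (h v) \<le> d x (h v') + d' v v'"
      using dX(5)[OF x u'(2) u(2)] iso[OF u'(1) u(1)] iso[OF u(1) u'(1)] dX(3)[OF u(2) u'(2)]
      by (simp add: h[OF u(1)] h[OF u'(1)])
    show "d' v v' \<le> d x (h v) + d x (h v')"
      using dX(5)[OF u(2) x u'(2)] iso[OF u(1) u'(1)] dX(3)[OF u(2) x]
      by (simp add: h[OF u(1)] h[OF u'(1)])
  qed
  moreover have "finite (Range R)" "Range R \<noteq> {}" "Range R \<subseteq> Y" using R' by (auto simp: finite_Range)
  ultimately obtain y where y: "y \<in> Y" "\<And>v. v \<in> Range R \<Longrightarrow> d' y v = d x (h v)"
    using Y(2) unfolding extension_property_def by metis
  have new: "d x u = d' y v" "d u x = d' v y" if "(u, v) \<in> R" for u v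
  proof -
    have uv: "u \<in> X" "v \<in> Y" using that R' by auto
    show 1: "d x u = d' y v" using y(2)[of v] h[OF that] RangeI[OF that] by simp
    show "d u x = d' v y" using dX(3)[OF x uv(1)] dY(3)[OF y(1) uv(2)] 1 by simp
  qed
  have "d x x = d' y y" using dX(2)[OF x x] dY(2)[OF y(1) y(1)] by simp
  then have "isometric_relation X d Y d' (insert (x, y) R)"
    using R' x y(1) new iso by (auto simp: isometric_relation_def)
  then show ?thesis by blast
qed

lemma isometric_back_and_forth:
  assumes X: "rational_metric_on X d" "extension_property X d" "countable X"
    and Y: "rational_metric_on Y d'" "extension_property Y d'" "countable Y"
    and A: "finite A" "A \<noteq> {}" "A \<subseteq> X" "e ` A \<subseteq> Y" "\<And>a b. a \<in> A \<Longrightarrow> b \<in> A \<Longrightarrow> d' (e a) (e b) = d a b"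
  shows "\<exists>\<iota>. bij_betw \<iota> X Y \<and> (\<forall>x\<in>X. \<forall>y\<in>X. d' (\<iota> x) (\<iota> y) = d x y) \<and> (\<forall>a\<in>A. \<iota> a = e a)"
proof -
  note dX = rational_metric_onD[OF X(1)] and dY = rational_metric_onD[OF Y(1)]
  have ne: "X \<noteq> {}" "Y \<noteq> {}" using A by auto
  let ?ok = "isometric_relation X d Y d'"
  define R0 where "R0 = (\<lambda>a. (a, e a)) ` A"
  have R0: "?ok R0" using A by (auto simp: isometric_relation_def R0_def)
  have step: "\<exists>R'. ?ok R' \<and> R \<subseteq> R' \<and> from_nat_into X n \<in> Domain R' \<and> from_nat_into Y n \<in> Range R'"
    if ok: "?ok R" for R n
  proof -
    obtain R1 where R1: "?ok R1" "R \<subseteq> R1" "from_nat_into X n \<in> Domain R1"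
      using isometric_relation_extend[OF X(1) Y(1,2) ok from_nat_into[OF ne(1)]] by blast
    obtain R2 where R2: "isometric_relation Y d' X d R2" "R1\<inverse> \<subseteq> R2" "from_nat_into Y n \<in> Domain R2"
      using isometric_relation_extend[OF Y(1) X(1,2) isometric_relation_converse[OF R1(1)] from_nat_into[OF ne(2)]]
      by blast
    show ?thesis
    proof (intro exI[of _ "R2\<inverse>"] conjI)
      show "?ok (R2\<inverse>)" by (rule isometric_relation_converse[OF R2(1)])
      show "R \<subseteq> R2\<inverse>" "from_nat_into X n \<in> Domain (R2\<inverse>)" using R1(2,3) R2(2) by auto
      show "from_nat_into Y n \<in> Range (R2\<inverse>)" using R2(3) by auto
    qed
  qed
  have "\<exists>R. \<forall>n. (?ok (R n) \<and> (n = 0 \<longrightarrow> R n = R0)) \<and>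
    (R n \<subseteq> R (Suc n) \<and> from_nat_into X n \<in> Domain (R (Suc n)) \<and> from_nat_into Y n \<in> Range (R (Suc n)))"
    by (rule dependent_nat_choice) (use R0 step in auto)
  then obtain R where R_all: "\<forall>n. (?ok (R n) \<and> (n = 0 \<longrightarrow> R n = R0)) \<and>
    (R n \<subseteq> R (Suc n) \<and> from_nat_into X n \<in> Domain (R (Suc n)) \<and> from_nat_into Y n \<in> Range (R (Suc n)))"
    by (rule exE)
  have R: "?ok (R n)" "R 0 = R0" "R n \<subseteq> R (Suc n)"
    "from_nat_into X n \<in> Domain (R (Suc n))" "from_nat_into Y n \<in> Range (R (Suc n))" for n
    using spec[OF R_all, of n] spec[OF R_all, of 0] by blast+
  define U where "U = (\<Union>n. R n)"
  have mono: "R m \<subseteq> R n" if "m \<le> n" for m n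
    by (rule lift_Suc_mono_le[where f = R, OF R(3) that])
  have iso: "d x x' = d' y y'" if xy: "(x, y) \<in> U" "(x', y') \<in> U" for x y x' y'
  proof -
    obtain m n where "(x, y) \<in> R m" "(x', y') \<in> R n" using xy by (auto simp: U_def)
    then have "(x, y) \<in> R (max m n)" "(x', y') \<in> R (max m n)"
      using mono[of m "max m n"] mono[of n "max m n"] by auto
    then show ?thesis using R(1)[of "max m n"] by (auto simp: isometric_relation_def)
  qed
  have UXY: "U \<subseteq> X \<times> Y" using R(1) unfolding U_def isometric_relation_def by blast
  have dom: "\<exists>y. (x, y) \<in> U" if "x \<in> X" for x
  proof -
    obtain n where "from_nat_into X n = x" using from_nat_into_surj[OF X(3) \<open>x \<in> X\<close>] by blast
    then show ?thesis using R(4)[of n] by (auto simp: U_def)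
  qed
  have ran: "\<exists>x. (x, y) \<in> U" if "y \<in> Y" for y
  proof -
    obtain n where "from_nat_into Y n = y" using from_nat_into_surj[OF Y(3) \<open>y \<in> Y\<close>] by blast
    then show ?thesis using R(5)[of n] by (auto simp: U_def)
  qed
  define \<iota> where "\<iota> x = (SOME y. (x, y) \<in> U)" for x
  have \<iota>: "(x, \<iota> x) \<in> U" if "x \<in> X" for x
    unfolding \<iota>_def using dom[OF that] by (rule someI_ex)
  have uniq: "\<iota> x = y" if "(x, y) \<in> U" for x y
  proof -
    have x: "x \<in> X" "y \<in> Y" using that UXY by auto
    have "d' (\<iota> x) y = 0" using iso[OF \<iota>[OF x(1)] that] dX(2)[OF x(1) x(1)] by simp
    then show ?thesis using dY(2)[of "\<iota> x" y] \<iota>[OF x(1)] x UXY by auto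
  qed
  have isom: "d' (\<iota> x) (\<iota> y) = d x y" if "x \<in> X" "y \<in> X" for x y
    using iso[OF \<iota>[OF that(1)] \<iota>[OF that(2)]] by simp
  have "inj_on \<iota> X"
  proof (rule inj_onI)
    fix x y assume a: "x \<in> X" "y \<in> X" "\<iota> x = \<iota> y"
    have "\<iota> y \<in> Y" using \<iota> a UXY by blast
    then show "x = y" using isom[OF a(1,2)] a dX(2)[OF a(1,2)] dY(2)[of "\<iota> y" "\<iota> y"] by simp
  qed
  moreover have "\<iota> ` X = Y"
  proof
    show "\<iota> ` X \<subseteq> Y" using \<iota> UXY by blast
    show "Y \<subseteq> \<iota> ` X"
    proof
      fix y assume "y \<in> Y"
      then obtain x where "(x, y) \<in> U" using ran by blast
      then show "y \<in> \<iota> ` X" using uniq[of x y] UXY by blast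
    qed
  qed
  moreover have "\<iota> a = e a" if "a \<in> A" for a
    using uniq[of a "e a"] R(2) that by (auto simp: U_def R0_def)
  ultimately have "bij_betw \<iota> X Y \<and> (\<forall>x\<in>X. \<forall>y\<in>X. d' (\<iota> x) (\<iota> y) = d x y) \<and> (\<forall>a\<in>A. \<iota> a = e a)"
    using isom unfolding bij_betw_def by blast
  then show ?thesis by (rule exI[where x = \<iota>])
qed

lemma rational_metric_on_orbit_dist:
  fixes G (structure)
  assumes "group G" and D: "rational_orbit_metric G (carrier G) I D"
  shows "rational_metric_on (carrier G \<times> I) (orbit_dist G D)"
proof -
  interpret group G by fact
  note opm = rational_orbit_metricD(1)[OF D]
  show ?thesis
  proof (rule rational_metric_onI)
    fix x y assume "x \<in> carrier G \<times> I" "y \<in> carrier G \<times> I"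
    then obtain g i h j where xy: "x = (g, i)" "y = (h, j)" "g \<in> carrier G" "h \<in> carrier G" "i \<in> I" "j \<in> I"
      by auto
    have gh: "inv g \<otimes> h \<in> carrier G" using xy by simp
    show "orbit_dist G D x y \<in> \<rat>"
      using rational_orbit_metricD(2)[OF D xy(5,6) gh] xy by (simp add: orbit_dist_def)
    show "orbit_dist G D x y = orbit_dist G D y x"
      using orbit_pseudometricD(2)[OF opm xy(5,6) gh] xy by (simp add: orbit_dist_def inv_mult_group)
    show "orbit_dist G D x y = 0 \<longleftrightarrow> x = y"
    proof
      assume "orbit_dist G D x y = 0"
      then have 1: "D i j (inv g \<otimes> h) = 0" using xy by (simp add: orbit_dist_def)
      then have "i = j" "inv g \<otimes> h = \<one>" using rational_orbit_metricD(3,4)[OF D xy(5,6) gh] by auto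
      then have "g = h" using xy by (metis inv_closed inv_equality inv_inv)
      then show "x = y" using xy \<open>i = j\<close> by simp
    next
      assume "x = y"
      then show "orbit_dist G D x y = 0" using xy orbit_pseudometricD(1)[OF opm] by (simp add: orbit_dist_def)
    qed
    fix z assume "z \<in> carrier G \<times> I"
    then obtain k l where z: "z = (k, l)" "k \<in> carrier G" "l \<in> I" by auto
    have "inv g \<otimes> k = (inv g \<otimes> h) \<otimes> (inv h \<otimes> k)"
      using xy z by (simp add: m_assoc inv_mult_cancel)
    then show "orbit_dist G D x z \<le> orbit_dist G D x y + orbit_dist G D y z"
      using orbit_pseudometricD(3)[OF opm xy(5,6) z(3) gh, of "inv h \<otimes> k"] xy z by (simp add: orbit_dist_def)
  qed
qed

text \<open>
  Left translations preserve \<open>orbit_dist\<close>, hence give isometries of the dense set \<open>Q\<close> onto itself.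
\<close>

lemma action_of_orbit_metric:
  fixes G (structure) and \<iota> :: "'g \<times> nat \<Rightarrow> 'u::metric_space"
  assumes "group G" and compl: "complete (UNIV :: 'u set)" and Q: "closure Q = UNIV"
    and \<iota>: "bij_betw \<iota> (carrier G \<times> UNIV) Q"
      "\<And>x y. x \<in> carrier G \<times> UNIV \<Longrightarrow> y \<in> carrier G \<times> UNIV \<Longrightarrow> dist (\<iota> x) (\<iota> y) = orbit_dist G D x y"
  shows "\<exists>\<beta> \<in> topspace (hom_topology G). \<forall>g\<in>carrier G. \<forall>h\<in>carrier G. \<forall>n. \<beta> g (\<iota> (h, n)) = \<iota> (g \<otimes> h, n)"
proof -
  interpret group G by fact
  define R where "R g = (\<lambda>(h, n). (\<iota> (h, n), \<iota> (g \<otimes> h, n))) ` (carrier G \<times> UNIV)" for g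
  have ex: "\<exists>\<phi> \<in> carrier isometry_group. \<forall>(x, y) \<in> R g. \<phi> x = y" if g: "g \<in> carrier G" for g
  proof (rule isometric_relation_extension[OF compl])
    show "dist x x' = dist y y'" if "(x, y) \<in> R g" "(x', y') \<in> R g" for x y x' y'
      using that g by (auto simp: R_def \<iota>(2) orbit_dist_def inv_mult_group m_assoc inv_mult_cancel)
    have "Domain (R g) = \<iota> ` (carrier G \<times> UNIV)"
      by (force simp: R_def)
    then show "closure (Domain (R g)) = UNIV" using \<iota>(1) Q by (simp add: bij_betw_def)
    have "\<iota> (h, n) \<in> Range (R g)" if "h \<in> carrier G" for h n
    proof (rule RangeI)
      show "(\<iota> (inv g \<otimes> h, n), \<iota> (h, n)) \<in> R g"
        unfolding R_def using that g inv_mult_cancel(2)[OF g that]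
        by (intro image_eqI[of _ _ "(inv g \<otimes> h, n)"]) auto
    qed
    then have "\<iota> ` (carrier G \<times> UNIV) \<subseteq> Range (R g)" by auto
    moreover have "Range (R g) \<subseteq> \<iota> ` (carrier G \<times> UNIV)" using g by (force simp: R_def)
    ultimately have "Range (R g) = \<iota> ` (carrier G \<times> UNIV)" by blast
    then show "closure (Range (R g)) = UNIV" using \<iota>(1) Q by (simp add: bij_betw_def)
  qed
  define \<beta> where "\<beta> = restrict (\<lambda>g. SOME \<phi>. \<phi> \<in> carrier isometry_group \<and> (\<forall>(x, y) \<in> R g. \<phi> x = y)) (carrier G)"
  have \<beta>: "\<beta> g \<in> carrier isometry_group \<and> (\<forall>(x, y) \<in> R g. \<beta> g x = y)" if "g \<in> carrier G" for g
  proof -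
    have "\<exists>\<phi>. \<phi> \<in> carrier isometry_group \<and> (\<forall>(x, y) \<in> R g. \<phi> x = y)" using ex[OF that] by blast
    from someI_ex[OF this] show ?thesis using that by (simp add: \<beta>_def)
  qed
  have \<beta>\<iota>: "\<beta> g (\<iota> (h, n)) = \<iota> (g \<otimes> h, n)" if "g \<in> carrier G" "h \<in> carrier G" for g h n
    using \<beta>[OF that(1)] that(2) by (force simp: R_def)
  have iso: "isometric_on UNIV (\<beta> g)" if "g \<in> carrier G" for g
    using \<beta>[OF that] by (simp add: isometry_group_def)
  have "\<beta> (g \<otimes> h) = \<beta> g \<circ> \<beta> h" if gh: "g \<in> carrier G" "h \<in> carrier G" for g h
  proof (rule isometries_eq_on_dense[OF _ _ Q])
    show "isometric_on UNIV (\<beta> (g \<otimes> h))" "isometric_on UNIV (\<beta> g \<circ> \<beta> h)"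
      using iso gh by (auto simp: isometric_on_def)
    fix x assume "x \<in> Q"
    then obtain k n where "x = \<iota> (k, n)" "k \<in> carrier G" using \<iota>(1) by (auto simp: bij_betw_def)
    then show "\<beta> (g \<otimes> h) x = (\<beta> g \<circ> \<beta> h) x" using gh by (simp add: \<beta>\<iota> m_assoc)
  qed
  then have "\<beta> \<in> hom G isometry_group"
    using \<beta> by (auto simp: hom_def isometry_group_def)
  moreover have "\<beta> \<in> extensional (carrier G)" by (simp add: \<beta>_def)
  ultimately show ?thesis using \<beta>\<iota> by (auto simp: topspace_hom_topology)
qed

section \<open>Density of the homomorphisms that realise a given extension\<close>

lemma hom_isometryD:
  fixes G (structure) and \<beta> :: "'g \<Rightarrow> 'u::metric_space \<Rightarrow> 'u"
  assumes "group G" "\<beta> \<in> hom G isometry_group"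
  shows "g \<in> carrier G \<Longrightarrow> dist (\<beta> g x) (\<beta> g y) = dist x y"
    and "g \<in> carrier G \<Longrightarrow> h \<in> carrier G \<Longrightarrow> \<beta> (g \<otimes> h) x = \<beta> g (\<beta> h x)"
    and "\<beta> \<one> x = x"
    and "g \<in> carrier G \<Longrightarrow> \<beta> (inv g) (\<beta> g x) = x"
    and "g \<in> carrier G \<Longrightarrow> h \<in> carrier G \<Longrightarrow> dist (\<beta> g x) (\<beta> h y) = dist x (\<beta> (inv g \<otimes> h) y)"
proof -
  interpret group G by fact
  have iso: "\<beta> g \<in> carrier isometry_group" if "g \<in> carrier G" for g
    using assms(2) that by (auto simp: hom_def)
  show d: "dist (\<beta> g x) (\<beta> g y) = dist x y" if "g \<in> carrier G" for g x y
    using iso[OF that] by (auto simp: isometry_group_def isometric_on_def)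
  show m: "\<beta> (g \<otimes> h) x = \<beta> g (\<beta> h x)" if "g \<in> carrier G" "h \<in> carrier G" for g h x
    using assms(2) that by (simp add: hom_def isometry_group_def)
  show o: "\<beta> \<one> x = x" for x
  proof -
    have "dist (\<beta> \<one> (\<beta> \<one> x)) (\<beta> \<one> x) = 0" using m[of \<one> \<one> x] by simp
    then show ?thesis using d[of \<one> "\<beta> \<one> x" x] by simp
  qed
  show i: "\<beta> (inv g) (\<beta> g x) = x" if "g \<in> carrier G" for g x
    using m[of "inv g" g x] o that by simp
  show "dist (\<beta> g x) (\<beta> h y) = dist x (\<beta> (inv g \<otimes> h) y)" if "g \<in> carrier G" "h \<in> carrier G" for g h x y
    using d[of "inv g" "\<beta> g x" "\<beta> h y"] i[of g x] m[of "inv g" h y] that by simp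
qed

lemma orbit_pseudometric_action:
  fixes G (structure) and \<beta> :: "'g \<Rightarrow> 'u::metric_space \<Rightarrow> 'u"
  assumes "group G" "\<beta> \<in> hom G isometry_group" "F \<subseteq> carrier G"
  shows "orbit_pseudometric G F I (\<lambda>i j g. dist (x i) (\<beta> g (x j)))"
proof -
  note H = hom_isometryD[OF assms(1,2)]
  interpret group G by fact
  show ?thesis
    unfolding orbit_pseudometric_def
  proof (intro conjI ballI)
    show "dist (x i) (\<beta> \<one> (x i)) = 0" for i by (simp add: H(3))
    show "dist (x i) (\<beta> g (x j)) = dist (x j) (\<beta> (inv g) (x i))" if "g \<in> F" for i j g
      using H(5)[of g \<one> "x j" "x i"] that assms(3) by (auto simp: H(3) dist_commute)
    show "dist (x i) (\<beta> (g \<otimes> h) (x k)) \<le> dist (x i) (\<beta> g (x j)) + dist (x j) (\<beta> h (x k))"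
      if "g \<in> F" "h \<in> F" for i j k g h
      using dist_triangle[of "x i" "\<beta> (g \<otimes> h) (x k)" "\<beta> g (x j)"] H(1)[of g "x j" "\<beta> h (x k)"]
        H(2)[of g h "x k"] subsetD[OF assms(3) that(1)] subsetD[OF assms(3) that(2)] by simp
  qed
qed

lemma rational_orbit_metric_separated:
  assumes "group G" "subgroup F G" "finite F" "finite I" "rational_orbit_metric G F I \<rho>"
  shows "\<exists>\<delta>>0. \<forall>i\<in>I. \<forall>j\<in>I. \<forall>g\<in>F. g \<noteq> \<one>\<^bsub>G\<^esub> \<longrightarrow> \<delta> \<le> \<rho> i j g"
proof -
  define T where "T = (\<lambda>(i, j, g). \<rho> i j g) ` {(i, j, g). i \<in> I \<and> j \<in> I \<and> g \<in> F \<and> g \<noteq> \<one>\<^bsub>G\<^esub>}"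
  have "finite {(i, j, g). i \<in> I \<and> j \<in> I \<and> g \<in> F \<and> g \<noteq> \<one>\<^bsub>G\<^esub>}"
    by (rule finite_subset[of _ "I \<times> I \<times> F"]) (use assms in auto)
  then have T: "finite T" by (simp add: T_def)
  have pos: "0 < t" if "t \<in> T" for t
  proof -
    obtain i j g where t: "t = \<rho> i j g" "i \<in> I" "j \<in> I" "g \<in> F" "g \<noteq> \<one>\<^bsub>G\<^esub>"
      using \<open>t \<in> T\<close> by (auto simp: T_def)
    then show ?thesis
      using orbit_pseudometric_nonneg[OF assms(1,2) rational_orbit_metricD(1)[OF assms(5)] t(2-4)]
        rational_orbit_metricD(4)[OF assms(5) t(2-4)] by force
  qed
  have "\<rho> i j g \<in> T" if "i \<in> I" "j \<in> I" "g \<in> F" "g \<noteq> \<one>\<^bsub>G\<^esub>" for i j g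
    unfolding T_def using that by (intro image_eqI[of _ _ "(i, j, g)"]) auto
  then have "\<forall>i\<in>I. \<forall>j\<in>I. \<forall>g\<in>F. g \<noteq> \<one>\<^bsub>G\<^esub> \<longrightarrow> Min (insert 1 T) \<le> \<rho> i j g"
    using T by simp
  moreover have "0 < Min (insert 1 T)" using T pos by simp
  ultimately show ?thesis by blast
qed

text \<open>
  The amalgam \<open>B\<close> is put into \<open>G\<close> over the copy of \<open>F2\<close> that it contains. Points of the two given
  systems get the indices below \<open>n\<close> and from \<open>n\<close> on, respectively.
\<close>

lemma hall_amalgam:
  fixes G (structure) and n l m :: nat and \<theta> :: "'g \<Rightarrow> 'g"
  assumes hall: "hall_universal_group G"
    and F1: "subgroup F1 G" "finite F1" and F2: "subgroup F2 G" "finite F2"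
    and F: "subgroup F G" "F \<subseteq> F1" and \<theta>: "\<theta> \<in> mon (G\<lparr>carrier := F\<rparr>) G" "\<theta> ` F \<subseteq> F2"
    and opm: "orbit_pseudometric G F1 {..<n} \<rho>1" "orbit_pseudometric G F2 {..<l} \<rho>2"
    and ml: "m \<le> n" "m \<le> l" and \<delta>: "0 < \<delta>" and \<epsilon>: "0 \<le> \<epsilon>"
    and sep1: "\<And>i j g. i < n \<Longrightarrow> j < n \<Longrightarrow> g \<in> F1 \<Longrightarrow> g \<noteq> \<one> \<Longrightarrow> \<delta> \<le> \<rho>1 i j g"
    and sep2: "\<And>i j g. i < l \<Longrightarrow> j < l \<Longrightarrow> g \<in> F2 \<Longrightarrow> g \<noteq> \<one> \<Longrightarrow> \<delta> \<le> \<rho>2 i j g"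
    and close: "\<And>i j f. i < m \<Longrightarrow> j < m \<Longrightarrow> f \<in> F \<Longrightarrow> \<bar>\<rho>1 i j f - \<rho>2 i j (\<theta> f)\<bar> \<le> \<epsilon>"
  shows "\<exists>F3 \<theta>1 \<sigma>. subgroup F3 G \<and> finite F3 \<and> F2 \<subseteq> F3 \<and> \<theta>1 \<in> mon (G\<lparr>carrier := F1\<rparr>) G \<and> \<theta>1 ` F1 \<subseteq> F3 \<and>
    (\<forall>f\<in>F. \<theta>1 f = \<theta> f) \<and> orbit_pseudometric G F3 {..<n + l} \<sigma> \<and>
    (\<forall>i<n. \<forall>j<n. \<forall>f\<in>F1. \<sigma> i j (\<theta>1 f) = \<rho>1 i j f) \<and>
    (\<forall>i<l. \<forall>j<l. \<forall>f\<in>F2. \<sigma> (n + i) (n + j) f = \<rho>2 i j f) \<and> (\<forall>i<m. \<sigma> i (n + i) \<one> \<le> \<epsilon>)"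
proof -
  interpret group G using hall by (simp add: hall_universal_group_def locally_finite_group_def)
  have \<theta>': "\<theta> \<in> mon (G\<lparr>carrier := F\<rparr>) (G\<lparr>carrier := F2\<rparr>)"
    using \<theta> by (auto simp: mon_def hom_def)
  interpret metric_amalgam G F "\<lambda>b. if b then F1 else F2" "\<lambda>b. if b then id else \<theta>"
    "\<lambda>b. if b then {..<n} else {..<l}" "{..<m}" "\<lambda>b. if b then \<rho>1 else \<rho>2" \<epsilon> \<delta>
  proof (intro metric_amalgam.intro metric_amalgam_axioms.intro)
    show "subgroup F G" "finite F" using F F1 finite_subset by auto
    show "(if b then id else \<theta>) \<in> mon (G\<lparr>carrier := F\<rparr>) (G\<lparr>carrier := if b then F1 else F2\<rparr>)" for b
      using \<theta>' F by (auto simp: mon_def hom_def)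
  qed (use assms in \<open>auto split: if_splits\<close>)
  from amalgam_exists obtain B :: "nat monoid" and e \<sigma> where B: "group B" "finite (carrier B)"
    and e0: "\<forall>b. e b \<in> mon (G\<lparr>carrier := if b then F1 else F2\<rparr>) B"
      "\<forall>f\<in>F. e True ((if True then id else \<theta>) f) = e False ((if False then id else \<theta>) f)"
    and \<sigma>0: "orbit_pseudometric B (carrier B) (SIGMA b:UNIV. if b then {..<n} else {..<l}) \<sigma>"
      "\<forall>b. \<forall>i\<in>if b then {..<n} else {..<l}. \<forall>j\<in>if b then {..<n} else {..<l}. \<forall>g\<in>if b then F1 else F2.
         \<sigma> (b, i) (b, j) (e b g) = (if b then \<rho>1 else \<rho>2) i j g"
      "\<forall>i\<in>{..<m}. \<sigma> (True, i) (False, i) \<one>\<^bsub>B\<^esub> \<le> \<epsilon>"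
    by (elim exE conjE)
  have e: "\<And>b. e b \<in> mon (G\<lparr>carrier := if b then F1 else F2\<rparr>) B" "\<And>f. f \<in> F \<Longrightarrow> e True f = e False (\<theta> f)"
    using e0 by simp_all
  have \<sigma>: "orbit_pseudometric B (carrier B) (SIGMA b:UNIV. if b then {..<n} else {..<l}) \<sigma>"
    "\<And>b i j g. i \<in> (if b then {..<n} else {..<l}) \<Longrightarrow> j \<in> (if b then {..<n} else {..<l}) \<Longrightarrow>
       g \<in> (if b then F1 else F2) \<Longrightarrow> \<sigma> (b, i) (b, j) (e b g) = (if b then \<rho>1 else \<rho>2) i j g"
    "\<And>i. i < m \<Longrightarrow> \<sigma> (True, i) (False, i) \<one>\<^bsub>B\<^esub> \<le> \<epsilon>"
    using \<sigma>0 by blast+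
  have e1: "e True \<in> mon (G\<lparr>carrier := F1\<rparr>) B" and e2: "e False \<in> mon (G\<lparr>carrier := F2\<rparr>) B"
    using e(1)[of True] e(1)[of False] by auto
  interpret B: group B by fact
  have e2C: "e False g \<in> carrier B" and e2m: "h \<in> F2 \<Longrightarrow> e False (g \<otimes> h) = e False g \<otimes>\<^bsub>B\<^esub> e False h"
    if "g \<in> F2" for g h using e2 that by (auto simp: mon_def hom_def)
  have e2inj: "inj_on (e False) F2" using e2 by (simp add: mon_def)
  have F2c: "g \<otimes> h \<in> F2" if "g \<in> F2" "h \<in> F2" for g h using subgroup.m_closed[OF F2(1) that] .
  have "group_hom (G\<lparr>carrier := F2\<rparr>) B (e False)"
    using e2 subgroup.subgroup_is_group[OF F2(1) is_group] B(1)
    by (auto simp: group_hom_def group_hom_axioms_def mon_def)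
  then have A: "subgroup (e False ` F2) B" using group_hom.img_is_subgroup by fastforce
  define r where "r = inv_into F2 (e False)"
  have r: "r (e False g) = g" if "g \<in> F2" for g using that e2inj by (simp add: r_def)
  have rmon: "r \<in> mon (B\<lparr>carrier := e False ` F2\<rparr>) G"
    using subgroup.mem_carrier[OF F2(1)] by (auto simp: mon_def hom_def inj_on_def r e2m[symmetric] F2c)
  obtain h where h: "h \<in> mon B G" "\<And>x. x \<in> e False ` F2 \<Longrightarrow> h x = r x"
    using hall B A rmon unfolding hall_universal_group_def by metis
  have he2: "h (e False g) = g" if "g \<in> F2" for g using h(2) r that by simp
  interpret h: group_hom B G h
    using h(1) by unfold_locales (simp add: mon_def)
  have hinj: "inj_on h (carrier B)" using h(1) by (simp add: mon_def)
  define F3 where "F3 = h ` carrier B"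
  define k where "k = inv_into (carrier B) h"
  have kh: "k (h x) = x" if "x \<in> carrier B" for x using that hinj by (simp add: k_def)
  define idx where "idx i = (if i < n then (True, i) else (False, i - n))" for i
  define \<sigma>' where "\<sigma>' i j g = \<sigma> (idx i) (idx j) (k g)" for i j g
  have idx: "idx i \<in> (SIGMA b:UNIV. if b then {..<n} else {..<l})" if "i < n + l" for i
    using that by (auto simp: idx_def)
  have e1C: "e True g \<in> carrier B" if "g \<in> F1" for g using e1 that by (auto simp: mon_def hom_def)
  show ?thesis
  proof (intro exI conjI)
    show "subgroup F3 G" unfolding F3_def by (rule h.img_is_subgroup)
    show "finite F3" unfolding F3_def using B(2) by simp
    show "F2 \<subseteq> F3" unfolding F3_def using he2 e2C by (metis image_eqI subsetI)
    show "h \<circ> e True \<in> mon (G\<lparr>carrier := F1\<rparr>) G"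
      using e1 hinj by (auto simp: mon_def hom_def inj_on_def Pi_iff)
    show "(h \<circ> e True) ` F1 \<subseteq> F3" using e1C by (auto simp: F3_def)
    show "\<forall>f\<in>F. (h \<circ> e True) f = \<theta> f" using e(2) he2 \<theta>(2) by (auto simp: image_subset_iff)
    show "orbit_pseudometric G F3 {..<n + l} \<sigma>'"
      unfolding orbit_pseudometric_def
    proof (intro conjI ballI)
      show "\<sigma>' i i \<one> = 0" if "i \<in> {..<n + l}" for i
        using orbit_pseudometricD(1)[OF \<sigma>(1) idx, of i] kh[of "\<one>\<^bsub>B\<^esub>"] that by (simp add: \<sigma>'_def)
      show "\<sigma>' i j g = \<sigma>' j i (inv g)" if g: "i \<in> {..<n + l}" "j \<in> {..<n + l}" "g \<in> F3" for i j g
      proof -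
        obtain x where x: "x \<in> carrier B" "g = h x" using g by (auto simp: F3_def)
        then have "inv g = h (inv\<^bsub>B\<^esub> x)" by simp
        then show ?thesis
          using orbit_pseudometricD(2)[OF \<sigma>(1) idx idx, of i j x] x g kh by (simp add: \<sigma>'_def del: h.hom_inv)
      qed
      show "\<sigma>' i q (g \<otimes> g') \<le> \<sigma>' i j g + \<sigma>' j q g'"
        if g: "i \<in> {..<n + l}" "j \<in> {..<n + l}" "q \<in> {..<n + l}" "g \<in> F3" "g' \<in> F3" for i j q g g'
      proof -
        obtain x y where x: "x \<in> carrier B" "g = h x" "y \<in> carrier B" "g' = h y" using g by (auto simp: F3_def)
        then have "g \<otimes> g' = h (x \<otimes>\<^bsub>B\<^esub> y)" by simp
        then show ?thesis
          using orbit_pseudometricD(3)[OF \<sigma>(1) idx idx idx, of i j q x y] x g kh by (simp add: \<sigma>'_def del: h.hom_mult)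
      qed
    qed
    show "\<forall>i<n. \<forall>j<n. \<forall>f\<in>F1. \<sigma>' i j ((h \<circ> e True) f) = \<rho>1 i j f"
      using \<sigma>(2)[of _ True] kh e1C by (simp add: \<sigma>'_def idx_def)
    show "\<forall>i<l. \<forall>j<l. \<forall>f\<in>F2. \<sigma>' (n + i) (n + j) f = \<rho>2 i j f"
    proof (intro allI impI ballI)
      fix i j f assume a: "i < l" "j < l" "f \<in> F2"
      then have "k f = e False f" using kh[of "e False f"] he2 e2C by simp
      then show "\<sigma>' (n + i) (n + j) f = \<rho>2 i j f"
        using \<sigma>(2)[of i False j f] a by (simp add: \<sigma>'_def idx_def)
    qed
    show "\<forall>i<m. \<sigma>' i (n + i) \<one> \<le> \<epsilon>"
      using \<sigma>(3) kh[of "\<one>\<^bsub>B\<^esub>"] ml by (auto simp: \<sigma>'_def idx_def)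
  qed
qed

lemma rational_metric_on_subset:
  "rational_metric_on X d \<Longrightarrow> A \<subseteq> X \<Longrightarrow> rational_metric_on A d"
  unfolding rational_metric_on_def by (meson subsetD)

text \<open>
  The orbit metric becomes the action on the completion of a universal orbit metric on \<open>G\<close>, which
  is identified with the given space by the back-and-forth argument. The finite part with which
  that argument starts is chosen near the points \<open>\<beta>0 g (z j)\<close>.
\<close>

lemma realize_orbit_metric:
  fixes G (structure) and \<beta>0 :: "'g \<Rightarrow> 'u::metric_space \<Rightarrow> 'u" and k :: nat
  assumes "group G" "countable (carrier G)" and U: "urysohn_space TYPE('u)"
    and F3: "subgroup F3 G" "finite F3" and k: "0 < k" and \<sigma>: "rational_orbit_metric G F3 {..<k} \<sigma>"
    and F2: "subgroup F2 G" "F2 \<subseteq> F3" and J: "J \<subseteq> {..<k}"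
    and \<beta>0: "\<beta>0 \<in> hom G isometry_group" and c: "c \<in> \<rat>" "0 < c"
    and near: "\<And>i j g. i \<in> J \<Longrightarrow> j \<in> J \<Longrightarrow> g \<in> F2 \<Longrightarrow> \<bar>\<sigma> i j g - dist (z i) (\<beta>0 g (z j))\<bar> \<le> c"
  shows "\<exists>\<beta> \<in> topspace (hom_topology G). \<exists>w. (\<forall>i<k. \<forall>j<k. \<forall>g\<in>F3. dist (w i) (\<beta> g (w j)) = \<sigma> i j g) \<and>
     (\<forall>j\<in>J. \<forall>g\<in>F2. dist (\<beta> g (w j)) (\<beta>0 g (z j)) \<le> 2 * c)"
proof -
  interpret group G by fact
  obtain Q :: "'u set" where Q: "rational_urysohn Q" "closure Q = UNIV" and compl: "complete (UNIV :: 'u set)"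
    using U by (auto simp: urysohn_space_def)
  obtain D where D: "rational_orbit_metric G (carrier G) (UNIV :: nat set) D"
      "\<And>i j g. i < k \<Longrightarrow> j < k \<Longrightarrow> g \<in> F3 \<Longrightarrow> D i j g = \<sigma> i j g"
      "extension_property (carrier G \<times> UNIV) (orbit_dist G D)"
    using universal_orbit_metric[OF is_group assms(2) F3 k \<sigma>] by auto
  note rm = rational_metric_on_orbit_dist[OF is_group D(1)]
  let ?X = "F3 \<times> {..<k}" and ?T = "F2 \<times> J"
  have XG: "?X \<subseteq> carrier G \<times> UNIV" using subgroup.subset[OF F3(1)] by auto
  have F2G: "g \<in> carrier G" if "g \<in> F2" for g using subgroup.mem_carrier[OF F2(1) that] .
  have "\<exists>u\<in>Q. dist u v < c / 2" for v
    using Q(2) c closure_approachable[of v Q] half_gt_zero[OF c(2)] by blast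
  then obtain p where p: "\<And>v. p v \<in> Q" "\<And>v. dist (p v) v < c / 2" by metis
  define q where "q = (\<lambda>(g, j). p (\<beta>0 g (z j)))"
  have "\<exists>e. e ` ?X \<subseteq> Q \<and> (\<forall>x\<in>?X. \<forall>y\<in>?X. dist (e x) (e y) = orbit_dist G D x y) \<and>
      (\<forall>t\<in>?T. dist (e t) (q t) \<le> c)"
  proof (rule rational_urysohn_approximate[OF Q(1)])
    show "finite ?X" using F3 by simp
    show "rational_metric_on ?X (orbit_dist G D)" by (rule rational_metric_on_subset[OF rm XG])
    show "?T \<subseteq> ?X" using F2(2) J by auto
    show "q ` ?T \<subseteq> Q" using p by (auto simp: q_def)
    fix s t assume "s \<in> ?T" "t \<in> ?T"
    then obtain g i h j where st: "s = (g, i)" "t = (h, j)" "g \<in> F2" "h \<in> F2" "i \<in> J" "j \<in> J" by auto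
    have gh: "inv g \<otimes> h \<in> F2" using st subgroup.m_closed[OF F2(1)] subgroup.m_inv_closed[OF F2(1)] by blast
    have "orbit_dist G D s t = \<sigma> i j (inv g \<otimes> h)"
      using st D(2)[of i j "inv g \<otimes> h"] gh F2(2) J by (auto simp: orbit_dist_def)
    moreover have "dist (\<beta>0 g (z i)) (\<beta>0 h (z j)) = dist (z i) (\<beta>0 (inv g \<otimes> h) (z j))"
      using hom_isometryD(5)[OF is_group \<beta>0] st F2G by blast
    moreover have "\<bar>dist (q s) (q t) - dist (\<beta>0 g (z i)) (\<beta>0 h (z j))\<bar> \<le> c / 2 + c / 2"
      using dist_quadrilateral[of "p (\<beta>0 g (z i))" "p (\<beta>0 h (z j))" "\<beta>0 g (z i)" "\<beta>0 h (z j)"]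
        p(2)[of "\<beta>0 g (z i)"] p(2)[of "\<beta>0 h (z j)"] by (simp add: st q_def)
    ultimately show "\<bar>orbit_dist G D s t - dist (q s) (q t)\<bar> \<le> 2 * c"
      using near[OF st(5,6) gh] by linarith
  qed (use c in auto)
  then obtain e where e: "e ` ?X \<subseteq> Q" "\<forall>x\<in>?X. \<forall>y\<in>?X. dist (e x) (e y) = orbit_dist G D x y"
    "\<forall>t\<in>?T. dist (e t) (q t) \<le> c" by (elim exE conjE)
  have "\<exists>\<iota>. bij_betw \<iota> (carrier G \<times> UNIV) Q \<and>
      (\<forall>x\<in>carrier G \<times> UNIV. \<forall>y\<in>carrier G \<times> UNIV. dist (\<iota> x) (\<iota> y) = orbit_dist G D x y) \<and> (\<forall>a\<in>?X. \<iota> a = e a)"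
  proof (rule isometric_back_and_forth[OF rm D(3) _ rational_urysohn_metric[OF Q(1)] rational_urysohn_extension_property[OF Q(1)]])
    show "countable (carrier G \<times> (UNIV :: nat set))" "countable Q"
      using assms(2) Q by (auto simp: rational_urysohn_def)
    show "?X \<noteq> {}" using k subgroup.one_closed[OF F3(1)] by auto
  qed (use F3 XG e in auto)
  then obtain \<iota> where \<iota>: "bij_betw \<iota> (carrier G \<times> UNIV) Q"
      "\<forall>x\<in>carrier G \<times> UNIV. \<forall>y\<in>carrier G \<times> UNIV. dist (\<iota> x) (\<iota> y) = orbit_dist G D x y"
      "\<forall>a\<in>?X. \<iota> a = e a" by (elim exE conjE)
  obtain \<beta> where \<beta>: "\<beta> \<in> topspace (hom_topology G)"
      "\<And>g h n. g \<in> carrier G \<Longrightarrow> h \<in> carrier G \<Longrightarrow> \<beta> g (\<iota> (h, n)) = \<iota> (g \<otimes> h, n)"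
    using action_of_orbit_metric[OF is_group compl Q(2) \<iota>(1)] \<iota>(2) by blast
  define w where "w i = \<iota> (\<one>, i)" for i
  have \<beta>w: "\<beta> g (w i) = \<iota> (g, i)" if "g \<in> carrier G" for g i
    using \<beta>(2)[OF that one_closed] that by (simp add: w_def)
  show ?thesis
  proof (intro bexI[OF _ \<beta>(1)] exI conjI allI ballI impI)
    fix i j g assume a: "i < k" "j < k" "g \<in> F3"
    have g: "g \<in> carrier G" using a subgroup.mem_carrier[OF F3(1)] by blast
    then show "dist (w i) (\<beta> g (w j)) = \<sigma> i j g"
      using \<iota>(2) D(2)[OF a] \<beta>w[OF g, of j] by (simp add: w_def orbit_dist_def)
  next
    fix j g assume a: "j \<in> J" "g \<in> F2"
    then have "(g, j) \<in> ?X" "(g, j) \<in> ?T" using F2(2) J by auto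
    then have "dist (\<iota> (g, j)) (q (g, j)) \<le> c" using \<iota>(3) e(3) by simp
    then show "dist (\<beta> g (w j)) (\<beta>0 g (z j)) \<le> 2 * c"
      using p(2)[of "\<beta>0 g (z j)"] dist_triangle[of "\<iota> (g, j)" "\<beta>0 g (z j)" "q (g, j)"] c
        \<beta>w[OF F2G[OF a(2)], of j]
      by (simp add: q_def)
  qed
qed

text \<open>
  The orbit metric \<open>\<rho>\<close> lives on \<open>F1\<close> and \<open>n\<close> points, of which the first \<open>m\<close> correspond to the points
  \<open>y\<close>; the embedding \<open>\<theta>\<close> of \<open>F\<close> is to be extended to \<open>F1\<close> and the points \<open>y\<close> may move by less than
  \<open>\<epsilon>\<close>, while the realisation has to be accurate up to \<open>\<delta>\<close>.
\<close>

definition realizes_extension ::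
  "('g, 'm) monoid_scheme \<Rightarrow> 'g set \<Rightarrow> 'g set \<Rightarrow> ('g \<Rightarrow> 'g) \<Rightarrow> nat \<Rightarrow> nat \<Rightarrow> (nat \<Rightarrow> nat \<Rightarrow> 'g \<Rightarrow> real) \<Rightarrow>
   (nat \<Rightarrow> 'u::metric_space) \<Rightarrow> real \<Rightarrow> real \<Rightarrow> ('g \<Rightarrow> 'u \<Rightarrow> 'u) \<Rightarrow> bool" where
  "realizes_extension G F F1 \<theta> m n \<rho> y \<epsilon> \<delta> \<beta> \<longleftrightarrow>
     (\<exists>\<theta>1 y'. \<theta>1 \<in> mon (G\<lparr>carrier := F1\<rparr>) G \<and> (\<forall>f\<in>F. \<theta>1 f = \<theta> f) \<and> (\<forall>i<m. dist (y i) (y' i) < \<epsilon>) \<and>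
        (\<forall>i<n. \<forall>j<n. \<forall>f\<in>F1. \<bar>dist (y' i) (\<beta> (\<theta>1 f) (y' j)) - \<rho> i j f\<bar> < \<delta>))"

text \<open>
  Let \<open>F2\<close> be generated by \<open>S\<close> and the image of \<open>\<theta>\<close>, and let \<open>\<rho>2\<close> be a rational approximation of the
  orbit pseudometric of \<open>\<beta>0\<close> on \<open>F2\<close> and the points of \<open>y\<close> and \<open>Z\<close>. Amalgamate it with \<open>\<rho>\<close> and
  realise the result close to \<open>\<beta>0\<close>.
\<close>

lemma realizes_extension_dense:
  fixes G (structure) and \<beta>0 :: "'g \<Rightarrow> 'u::metric_space \<Rightarrow> 'u"
  assumes hall: "hall_universal_group G" and U: "urysohn_space TYPE('u)"
    and \<beta>0: "\<beta>0 \<in> hom G isometry_group"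
    and S: "finite S" "S \<subseteq> carrier G" and Z: "finite Z" and \<eta>: "0 < \<eta>"
    and F1: "subgroup F1 G" "finite F1" and F: "subgroup F G" "F \<subseteq> F1"
    and \<theta>: "\<theta> \<in> mon (G\<lparr>carrier := F\<rparr>) G" and \<rho>: "rational_orbit_metric G F1 {..<n} \<rho>" and m: "m \<le> n"
    and pos: "0 < \<epsilon>" "0 < \<delta>"
    and close: "\<And>i j f. i < m \<Longrightarrow> j < m \<Longrightarrow> f \<in> F \<Longrightarrow> \<bar>dist (y i) (\<beta>0 (\<theta> f) (y j)) - \<rho> i j f\<bar> < \<epsilon>"
  shows "\<exists>\<beta> \<in> topspace (hom_topology G). (\<forall>g\<in>S. \<forall>z\<in>Z. dist (\<beta> g z) (\<beta>0 g z) < \<eta>) \<and>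
      realizes_extension G F F1 \<theta> m n \<rho> y \<epsilon> \<delta> \<beta>"
proof -
  have lf: "locally_finite_group G" and cnt: "countable (carrier G)"
    using hall by (auto simp: hall_universal_group_def)
  interpret group G using lf by (simp add: locally_finite_group_def)
  have \<theta>F: "\<theta> ` F \<subseteq> carrier G" using \<theta> by (auto simp: mon_def hom_def)
  have finF: "finite F" using F F1 finite_subset by blast
  define F2 where "F2 = generate G (S \<union> \<theta> ` F)"
  have F2: "subgroup F2 G" "finite F2" "S \<subseteq> F2" "\<theta> ` F \<subseteq> F2"
    using lf S \<theta>F finF generate_is_subgroup[of "S \<union> \<theta> ` F"] generate.incl[of _ "S \<union> \<theta> ` F" G]
    by (auto simp: F2_def locally_finite_group_def)
  have F2G: "F2 \<subseteq> carrier G" using subgroup.subset[OF F2(1)] .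
  \<comment> \<open>one extra point makes the list nonempty\<close>
  obtain zs where zs: "set zs = insert undefined Z" using Z by (metis finite_insert finite_list)
  define l where "l = m + length zs"
  have l: "0 < l" "m \<le> l" using zs by (auto simp: l_def)
  define z where "z i = (if i < m then y i else zs ! (i - m))" for i
  have Zz: "\<exists>j. j < l \<and> z j = x" if "x \<in> Z" for x
  proof -
    have "x \<in> set zs" using that zs by simp
    then obtain i where "i < length zs" "zs ! i = x" by (auto simp: in_set_conv_nth)
    then show ?thesis by (intro exI[of _ "m + i"]) (simp add: l_def z_def)
  qed
  define err where "err = (\<lambda>(i, j, f). \<bar>dist (y i) (\<beta>0 (\<theta> f) (y j)) - \<rho> i j f\<bar>)"
  have finE: "finite ({..<m} \<times> {..<m} \<times> F)" using finF by simp
  define \<epsilon>' where "\<epsilon>' = sup0 ({..<m} \<times> {..<m} \<times> F) err"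
  have \<epsilon>': "0 \<le> \<epsilon>'" "\<epsilon>' < \<epsilon>"
  proof -
    show "0 \<le> \<epsilon>'" unfolding \<epsilon>'_def by (rule sup0_nonneg[OF finE])
    show "\<epsilon>' < \<epsilon>" unfolding \<epsilon>'_def sup0_def using finE pos close by (subst Max_less_iff) (auto simp: err_def)
  qed
  have err: "\<bar>dist (y i) (\<beta>0 (\<theta> f) (y j)) - \<rho> i j f\<bar> \<le> \<epsilon>'" if "i < m" "j < m" "f \<in> F" for i j f
    using sup0_upper[OF finE, of "(i, j, f)" err] that by (simp add: \<epsilon>'_def err_def)
  \<comment> \<open>finitely many strict inequalities leave room; all errors below are multiples of \<open>t = 1 / N\<close>
    and sum up to at most \<open>16 * t < s\<close>\<close>
  define s where "s = min (\<epsilon> - \<epsilon>') (min \<eta> \<delta>)"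
  have s: "0 < s" using \<epsilon>' \<eta> pos by (simp add: s_def)
  obtain N :: nat where N0: "16 / s < real N" using reals_Archimedean2 by blast
  have "0 < 16 / s" using s by simp
  then have N: "0 < N" using N0 by (metis gr0I less_asym of_nat_0)
  define t where "t = 1 / real N"
  have t: "0 < t" "16 * t < s" using N0 s N by (auto simp: t_def field_simps)
  have two: "2 / real N = 2 * t" by (simp add: t_def)
  let ?\<rho>0 = "\<lambda>i j g. dist (z i) (\<beta>0 g (z j))"
  define \<rho>2 where "\<rho>2 = round_up G N ?\<rho>0"
  have opm0: "orbit_pseudometric G F2 {..<l} ?\<rho>0" by (rule orbit_pseudometric_action[OF is_group \<beta>0 F2G])
  have rom2: "rational_orbit_metric G F2 {..<l} \<rho>2"
    unfolding \<rho>2_def by (rule rational_orbit_metric_round_up[OF is_group F2(1) opm0 N])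
  have \<rho>2: "?\<rho>0 i j g \<le> \<rho>2 i j g" "\<rho>2 i j g \<le> ?\<rho>0 i j g + 2 * t" for i j g
    using round_up_bounds[where i = i and j = j and g = g and G = G and \<rho> = ?\<rho>0, OF N] hom_isometryD(3)[OF is_group \<beta>0] by (simp_all add: \<rho>2_def two)
  obtain \<delta>1 where \<delta>1: "0 < \<delta>1" "\<And>i j g. i < n \<Longrightarrow> j < n \<Longrightarrow> g \<in> F1 \<Longrightarrow> g \<noteq> \<one> \<Longrightarrow> \<delta>1 \<le> \<rho> i j g"
    using rational_orbit_metric_separated[OF is_group F1 _ \<rho>] by auto
  obtain \<delta>2 where \<delta>2: "0 < \<delta>2" "\<And>i j g. i < l \<Longrightarrow> j < l \<Longrightarrow> g \<in> F2 \<Longrightarrow> g \<noteq> \<one> \<Longrightarrow> \<delta>2 \<le> \<rho>2 i j g"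
    using rational_orbit_metric_separated[OF is_group F2(1,2) _ rom2] by auto
  have "\<exists>F3 \<theta>1 \<sigma>. subgroup F3 G \<and> finite F3 \<and> F2 \<subseteq> F3 \<and> \<theta>1 \<in> mon (G\<lparr>carrier := F1\<rparr>) G \<and> \<theta>1 ` F1 \<subseteq> F3 \<and>
    (\<forall>f\<in>F. \<theta>1 f = \<theta> f) \<and> orbit_pseudometric G F3 {..<n + l} \<sigma> \<and>
    (\<forall>i<n. \<forall>j<n. \<forall>f\<in>F1. \<sigma> i j (\<theta>1 f) = \<rho> i j f) \<and>
    (\<forall>i<l. \<forall>j<l. \<forall>f\<in>F2. \<sigma> (n + i) (n + j) f = \<rho>2 i j f) \<and> (\<forall>i<m. \<sigma> i (n + i) \<one> \<le> \<epsilon>' + 2 * t)"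
  proof (rule hall_amalgam[OF hall F1 F2(1,2) F \<theta> F2(4) rational_orbit_metricD(1)[OF \<rho>]
        rational_orbit_metricD(1)[OF rom2] m l(2), of "min \<delta>1 \<delta>2"])
    show "0 < min \<delta>1 \<delta>2" using \<delta>1 \<delta>2 by simp
    show "0 \<le> \<epsilon>' + 2 * t" using \<epsilon>' t by simp
    show "min \<delta>1 \<delta>2 \<le> \<rho> i j g" if "i < n" "j < n" "g \<in> F1" "g \<noteq> \<one>" for i j g
      using \<delta>1(2)[OF that] by simp
    show "min \<delta>1 \<delta>2 \<le> \<rho>2 i j g" if "i < l" "j < l" "g \<in> F2" "g \<noteq> \<one>" for i j g
      using \<delta>2(2)[OF that] by simp
    show "\<bar>\<rho> i j f - \<rho>2 i j (\<theta> f)\<bar> \<le> \<epsilon>' + 2 * t" if "i < m" "j < m" "f \<in> F" for i j f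
      using err[OF that] \<rho>2[where i = i and j = j and g = "\<theta> f"] that by (simp add: z_def)
  qed
  then obtain F3 \<theta>1 \<sigma> where F3: "subgroup F3 G" "finite F3" "F2 \<subseteq> F3"
    and \<theta>1: "\<theta>1 \<in> mon (G\<lparr>carrier := F1\<rparr>) G" "\<theta>1 ` F1 \<subseteq> F3" "\<forall>f\<in>F. \<theta>1 f = \<theta> f"
    and \<sigma>: "orbit_pseudometric G F3 {..<n + l} \<sigma>" "\<forall>i<n. \<forall>j<n. \<forall>f\<in>F1. \<sigma> i j (\<theta>1 f) = \<rho> i j f"
      "\<forall>i<l. \<forall>j<l. \<forall>f\<in>F2. \<sigma> (n + i) (n + j) f = \<rho>2 i j f" "\<forall>i<m. \<sigma> i (n + i) \<one> \<le> \<epsilon>' + 2 * t"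
    by (elim exE conjE)
  define \<tau> where "\<tau> = round_up G N \<sigma>"
  have \<tau>: "rational_orbit_metric G F3 {..<n + l} \<tau>"
    unfolding \<tau>_def by (rule rational_orbit_metric_round_up[OF is_group F3(1) \<sigma>(1) N])
  have \<tau>\<sigma>: "\<sigma> i j g \<le> \<tau> i j g" "\<tau> i j g \<le> \<sigma> i j g + 2 * t" if "i < n + l" "j < n + l" for i j g
    using round_up_bounds[where i = i and j = j and g = g and G = G and \<rho> = \<sigma>, OF N] orbit_pseudometricD(1)[OF \<sigma>(1), of i] that
    by (auto simp: \<tau>_def two)
  have "\<exists>\<beta> \<in> topspace (hom_topology G). \<exists>w. (\<forall>i<n + l. \<forall>j<n + l. \<forall>g\<in>F3. dist (w i) (\<beta> g (w j)) = \<tau> i j g) \<and>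
     (\<forall>j\<in>{n..<n + l}. \<forall>g\<in>F2. dist (\<beta> g (w j)) (\<beta>0 g (z (j - n))) \<le> 2 * (4 * t))"
  proof (rule realize_orbit_metric[OF is_group cnt U F3(1,2) _ \<tau> F2(1) F3(3) _ \<beta>0])
    show "4 * t \<in> \<rat>" "0 < 4 * t" using t by (auto simp: t_def)
    fix i j g assume a: "i \<in> {n..<n + l}" "j \<in> {n..<n + l}" "g \<in> F2"
    then have "\<sigma> (n + (i - n)) (n + (j - n)) g = \<rho>2 (i - n) (j - n) g" by (intro \<sigma>(3)[rule_format]) auto
    then show "\<bar>\<tau> i j g - dist (z (i - n)) (\<beta>0 g (z (j - n)))\<bar> \<le> 4 * t"
      using \<tau>\<sigma>[of i j g] \<rho>2[where i = "i - n" and j = "j - n" and g = g] a t by simp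
  qed (use l in auto)
  then obtain \<beta> w where \<beta>: "\<beta> \<in> topspace (hom_topology G)"
    and w0: "\<forall>i<n + l. \<forall>j<n + l. \<forall>g\<in>F3. dist (w i) (\<beta> g (w j)) = \<tau> i j g"
    and near0: "\<forall>j\<in>{n..<n + l}. \<forall>g\<in>F2. dist (\<beta> g (w j)) (\<beta>0 g (z (j - n))) \<le> 2 * (4 * t)"
    by (elim bexE exE conjE)
  have w: "dist (w i) (\<beta> g (w j)) = \<tau> i j g" if "i < n + l" "j < n + l" "g \<in> F3" for i j g
    using w0 that by blast
  have near: "dist (\<beta> g (w (n + j))) (\<beta>0 g (z j)) \<le> 8 * t" if "j < l" "g \<in> F2" for j g
    using bspec[OF bspec[OF near0, of "n + j"] that(2)] that(1) by simp
  have \<beta>h: "\<beta> \<in> hom G isometry_group" using \<beta> by (simp add: topspace_hom_topology)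
  note H = hom_isometryD[OF is_group \<beta>h] and H0 = hom_isometryD[OF is_group \<beta>0]
  have near1: "dist (w (n + j)) (z j) \<le> 8 * t" if "j < l" for j
    using near[OF that subgroup.one_closed[OF F2(1)]] by (simp add: H(3) H0(3))
  have "\<forall>g\<in>S. \<forall>x\<in>Z. dist (\<beta> g x) (\<beta>0 g x) < \<eta>"
  proof (intro ballI)
    fix g x assume a: "g \<in> S" "x \<in> Z"
    obtain j where j: "j < l" "z j = x" using Zz a by blast
    have "dist (\<beta> g x) (\<beta> g (w (n + j))) \<le> 8 * t"
      using near1[OF j(1)] H(1)[of g x "w (n + j)"] a S j by (auto simp: dist_commute)
    moreover have "dist (\<beta> g (w (n + j))) (\<beta>0 g x) \<le> 8 * t" using near[OF j(1)] a F2(3) j by auto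
    ultimately show "dist (\<beta> g x) (\<beta>0 g x) < \<eta>"
      using dist_triangle[of "\<beta> g x" "\<beta>0 g x" "\<beta> g (w (n + j))"] t by (simp add: s_def)
  qed
  moreover have "realizes_extension G F F1 \<theta> m n \<rho> y \<epsilon> \<delta> \<beta>"
    unfolding realizes_extension_def
  proof (intro exI conjI allI impI ballI)
    show "\<theta>1 \<in> mon (G\<lparr>carrier := F1\<rparr>) G" by (rule \<theta>1(1))
    show "\<theta>1 f = \<theta> f" if "f \<in> F" for f using \<theta>1(3) that by blast
    show "dist (y i) (w i) < \<epsilon>" if i: "i < m" for i
    proof -
      have "dist (w i) (w (n + i)) = \<tau> i (n + i) \<one>"
        using w[of i "n + i" \<one>] i m l subgroup.one_closed[OF F3(1)] by (simp add: H(3))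
      also have "\<dots> \<le> \<epsilon>' + 4 * t" using \<tau>\<sigma>[of i "n + i" \<one>] \<sigma>(4) i m l t by force
      finally have "dist (w i) (w (n + i)) \<le> \<epsilon>' + 4 * t" .
      moreover have "dist (w (n + i)) (y i) \<le> 8 * t" using near1[of i] i l by (simp add: z_def)
      ultimately show ?thesis
        using dist_triangle[of "w i" "y i" "w (n + i)"] t by (simp add: s_def dist_commute)
    qed
    show "\<bar>dist (w i) (\<beta> (\<theta>1 f) (w j)) - \<rho> i j f\<bar> < \<delta>" if a: "i < n" "j < n" "f \<in> F1" for i j f
      using w[of i j "\<theta>1 f"] \<tau>\<sigma>[of i j "\<theta>1 f"] \<sigma>(2) \<theta>1(2) a t by (auto simp: s_def image_subset_iff)
  qed
  ultimately show ?thesis using \<beta> by blast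
qed

section \<open>The comeager set of generic homomorphisms\<close>

lemma continuous_map_by_dist_bound:
  fixes F :: "'a \<Rightarrow> 'u::metric_space"
  assumes "\<And>x0 e. x0 \<in> topspace X \<Longrightarrow> 0 < e \<Longrightarrow>
     \<exists>r. continuous_map X euclideanreal r \<and> r x0 < e \<and> (\<forall>x\<in>topspace X. dist (F x) (F x0) \<le> r x)"
  shows "continuous_map X euclidean F"
proof -
  have "continuous_map X Met_TC.mtopology F"
    unfolding Met_TC.continuous_map_to_metric
  proof (intro ballI allI impI)
    fix x0 e assume x: "x0 \<in> topspace X" "0 < (e::real)"
    obtain r where r: "continuous_map X euclideanreal r" "r x0 < e" "\<And>x. x \<in> topspace X \<Longrightarrow> dist (F x) (F x0) \<le> r x"
      using assms[OF x] by blast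
    show "\<exists>U. openin X U \<and> x0 \<in> U \<and> (\<forall>y\<in>U. F y \<in> Met_TC.mball (F x0) e)"
    proof (intro exI conjI ballI)
      show "openin X {x \<in> topspace X. r x \<in> {..<e}}"
        by (rule openin_continuous_map_preimage[OF r(1)]) simp
      show "x0 \<in> {x \<in> topspace X. r x \<in> {..<e}}" using x r(2) by simp
      show "F y \<in> Met_TC.mball (F x0) e" if "y \<in> {x \<in> topspace X. r x \<in> {..<e}}" for y
        using that r(3)[of y] by (auto simp: Met_TC.mball_def dist_commute)
    qed
  qed
  then show ?thesis by simp
qed

lemma continuous_map_dist_euclidean:
  fixes F E :: "'a \<Rightarrow> 'u::metric_space"
  assumes "continuous_map X euclidean F" "continuous_map X euclidean E"
  shows "continuous_map X euclideanreal (\<lambda>x. dist (F x) (E x))"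
  using continuous_map_mdist[of X "metric (UNIV :: 'u set, dist)" F E] assms by simp

lemma continuous_map_isometry_topology:
  "continuous_map X isometry_topology F \<longleftrightarrow>
     (\<forall>x\<in>topspace X. F x \<in> carrier isometry_group) \<and> (\<forall>z. continuous_map X euclidean (\<lambda>x. F x z))"
  by (auto simp: isometry_topology_def continuous_map_in_subtopology continuous_map_componentwise_UNIV)

lemma continuous_map_eval:
  fixes z :: "'u::metric_space"
  shows "continuous_map isometry_topology euclidean (\<lambda>f. f z)"
  using continuous_map_isometry_topology[of "isometry_topology :: ('u \<Rightarrow> 'u) topology" "\<lambda>f. f"] by simp

lemma continuous_map_action:
  fixes z :: "'u::metric_space"
  assumes "g \<in> carrier G"
  shows "continuous_map (hom_topology G) euclidean (\<lambda>\<beta>. \<beta> g z)"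
proof -
  have "continuous_map (hom_topology G) (isometry_topology :: ('u \<Rightarrow> 'u) topology) (\<lambda>\<beta>. \<beta> g)"
    unfolding hom_topology_def
    by (intro continuous_map_from_subtopology continuous_map_product_projection assms)
  then show ?thesis by (simp add: continuous_map_isometry_topology)
qed

lemma product_topology_neighbourhood:
  assumes "openin (product_topology X I) U" "x \<in> U"
  obtains V J where "finite J" "J \<subseteq> I" "\<And>i. i \<in> J \<Longrightarrow> openin (X i) (V i) \<and> x i \<in> V i"
    "\<And>y. y \<in> topspace (product_topology X I) \<Longrightarrow> (\<And>i. i \<in> J \<Longrightarrow> y i \<in> V i) \<Longrightarrow> y \<in> U"
proof -
  obtain V where V: "finite {i \<in> I. V i \<noteq> topspace (X i)}" "\<forall>i\<in>I. openin (X i) (V i)"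
     "x \<in> PiE I V" "PiE I V \<subseteq> U"
    using bspec[OF assms(1)[unfolded openin_product_topology_alt] assms(2)] by (elim exE conjE)
  show ?thesis
  proof (rule that[OF V(1)])
    fix y assume y: "y \<in> topspace (product_topology X I)"
      "\<And>i. i \<in> {i \<in> I. V i \<noteq> topspace (X i)} \<Longrightarrow> y i \<in> V i"
    have "y i \<in> V i" if "i \<in> I" for i
      using y(2)[of i] y(1) that by (cases "V i = topspace (X i)") auto
    then have "y \<in> PiE I V" using y(1) by (auto simp: PiE_iff)
    then show "y \<in> U" using V(4) by blast
  qed (use V in auto)
qed

lemma isometry_topology_neighbourhood:
  assumes "openin isometry_topology U" "f \<in> U"
  obtains Z \<eta> where "finite Z" "0 < \<eta>"
    "\<And>h. h \<in> carrier isometry_group \<Longrightarrow> (\<And>z. z \<in> Z \<Longrightarrow> dist (h z) (f z) < \<eta>) \<Longrightarrow> h \<in> U"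
proof -
  obtain W where W: "openin (product_topology (\<lambda>_. euclidean) UNIV) W" "U = W \<inter> carrier isometry_group"
    using assms(1) unfolding isometry_topology_def openin_subtopology by blast
  obtain V J where J: "finite J" "\<And>i. i \<in> J \<Longrightarrow> openin euclidean (V i) \<and> f i \<in> V i"
    "\<And>y. (\<And>i. i \<in> J \<Longrightarrow> y i \<in> V i) \<Longrightarrow> y \<in> W"
    by (rule product_topology_neighbourhood[OF W(1), of f]) (use assms W in auto)
  have "\<exists>e>0. \<forall>u. dist u (f i) < e \<longrightarrow> u \<in> V i" if "i \<in> J" for i
    using J(2)[OF that] by (simp add: open_dist)
  then obtain e where e: "\<And>i. i \<in> J \<Longrightarrow> 0 < e i" "\<And>i u. i \<in> J \<Longrightarrow> dist u (f i) < e i \<Longrightarrow> u \<in> V i"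
    by metis
  show ?thesis
  proof (rule that[OF J(1), of "Min (insert 1 (e ` J))"])
    show "0 < Min (insert 1 (e ` J))" using J(1) e(1) by simp
    fix h assume h: "h \<in> carrier isometry_group" "\<And>z. z \<in> J \<Longrightarrow> dist (h z) (f z) < Min (insert 1 (e ` J))"
    have "h \<in> W"
    proof (rule J(3))
      fix i assume i: "i \<in> J"
      then have "dist (h i) (f i) < e i" using h(2)[OF i] J(1) by simp
      then show "h i \<in> V i" using e(2)[OF i] by blast
    qed
    then show "h \<in> U" using W h by simp
  qed
qed

lemma hom_topology_neighbourhood:
  assumes "openin (hom_topology G) U" "\<beta>0 \<in> U"
  shows "\<exists>S Z \<eta>. finite S \<and> S \<subseteq> carrier G \<and> finite Z \<and> 0 < \<eta> \<and>
    (\<forall>\<beta>\<in>topspace (hom_topology G). (\<forall>g\<in>S. \<forall>z\<in>Z. dist (\<beta> g z) (\<beta>0 g z) < \<eta>) \<longrightarrow> \<beta> \<in> U)"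
proof -
  obtain W where W: "openin (product_topology (\<lambda>_. isometry_topology) (carrier G)) W" "U = W \<inter> hom G isometry_group"
    using assms(1) unfolding hom_topology_def openin_subtopology by blast
  obtain V J where J: "finite J" "J \<subseteq> carrier G" "\<And>i. i \<in> J \<Longrightarrow> openin isometry_topology (V i) \<and> \<beta>0 i \<in> V i"
    "\<And>y. y \<in> topspace (product_topology (\<lambda>_. isometry_topology) (carrier G)) \<Longrightarrow> (\<And>i. i \<in> J \<Longrightarrow> y i \<in> V i) \<Longrightarrow> y \<in> W"
    by (rule product_topology_neighbourhood[OF W(1), of \<beta>0]) (use assms W in auto)
  have "\<exists>Z e. finite Z \<and> 0 < e \<and>
     (\<forall>h\<in>carrier isometry_group. (\<forall>z\<in>Z. dist (h z) (\<beta>0 i z) < e) \<longrightarrow> h \<in> V i)" if i: "i \<in> J" for i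
  proof -
    obtain Z e where "finite Z" "0 < e"
      "\<And>h. h \<in> carrier isometry_group \<Longrightarrow> (\<And>z. z \<in> Z \<Longrightarrow> dist (h z) (\<beta>0 i z) < e) \<Longrightarrow> h \<in> V i"
      using isometry_topology_neighbourhood[OF J(3)[OF i, THEN conjunct1] J(3)[OF i, THEN conjunct2]] by metis
    then show ?thesis by (intro exI[of _ Z] exI[of _ e]) simp
  qed
  then have "\<forall>i\<in>J. \<exists>p. finite (fst p) \<and> 0 < snd p \<and>
     (\<forall>h\<in>carrier isometry_group. (\<forall>z\<in>fst p. dist (h z) (\<beta>0 i z) < snd p) \<longrightarrow> h \<in> V i)"
    by simp
  then obtain p where p: "\<forall>i\<in>J. finite (fst (p i)) \<and> 0 < snd (p i) \<and>
     (\<forall>h\<in>carrier isometry_group. (\<forall>z\<in>fst (p i). dist (h z) (\<beta>0 i z) < snd (p i)) \<longrightarrow> h \<in> V i)"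
    by (rule bchoice[THEN exE])
  define Z e where "Z = (\<lambda>i. fst (p i))" and "e = (\<lambda>i. snd (p i))"
  have Z: "finite (Z i)" "0 < e i"
     "h \<in> carrier isometry_group \<Longrightarrow> (\<forall>z\<in>Z i. dist (h z) (\<beta>0 i z) < e i) \<Longrightarrow> h \<in> V i" if "i \<in> J" for i h
    using bspec[OF p that] by (auto simp: Z_def e_def)
  show ?thesis
  proof (intro exI[of _ J] exI[of _ "\<Union>i\<in>J. Z i"] exI[of _ "Min (insert 1 (e ` J))"] conjI ballI impI J(1,2))
    show "finite (\<Union>i\<in>J. Z i)" using J(1) Z(1) by blast
    show "0 < Min (insert 1 (e ` J))" using J(1) Z(2) by simp
    fix \<beta> assume \<beta>: "\<beta> \<in> topspace (hom_topology G)"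
      "\<forall>g\<in>J. \<forall>z\<in>\<Union>i\<in>J. Z i. dist (\<beta> g z) (\<beta>0 g z) < Min (insert 1 (e ` J))"
    have hom: "\<beta> \<in> hom G isometry_group" "\<beta> \<in> extensional (carrier G)"
      using \<beta>(1) by (auto simp: topspace_hom_topology)
    have "\<beta> \<in> W"
    proof (rule J(4))
      show "\<beta> \<in> topspace (product_topology (\<lambda>_. isometry_topology) (carrier G))"
        using hom by (auto simp: topspace_isometry_topology hom_def PiE_iff)
      fix i assume i: "i \<in> J"
      have "dist (\<beta> i z) (\<beta>0 i z) < e i" if "z \<in> Z i" for z
        using bspec[OF bspec[OF \<beta>(2) i], of z] that i J(1) by auto
      moreover have "\<beta> i \<in> carrier isometry_group" using hom(1) i J(2) by (auto simp: hom_def)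
      ultimately show "\<beta> i \<in> V i" using Z(3)[OF i] by blast
    qed
    then show "\<beta> \<in> U" using W hom by simp
  qed
qed

lemma openin_finite_conditions:
  assumes "finite K" "\<And>k. k \<in> K \<Longrightarrow> openin X {x \<in> topspace X. P k x}"
  shows "openin X {x \<in> topspace X. \<forall>k\<in>K. P k x}"
  using assms
proof (induction K)
  case (insert k K)
  have "{x \<in> topspace X. \<forall>j\<in>insert k K. P j x} = {x \<in> topspace X. P k x} \<inter> {x \<in> topspace X. \<forall>j\<in>K. P j x}"
    by auto
  then show ?case using insert by auto
qed simp

lemma openin_realizes_extension:
  fixes y :: "nat \<Rightarrow> 'u::metric_space"
  assumes "finite F1" "F1 \<subseteq> carrier G"
  shows "openin (hom_topology G) {\<beta> \<in> topspace (hom_topology G). realizes_extension G F F1 \<theta> m n \<rho> y \<epsilon> \<delta> \<beta>}"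
proof (subst openin_subopen, safe)
  fix \<beta> assume \<beta>: "\<beta> \<in> topspace (hom_topology G)" "realizes_extension G F F1 \<theta> m n \<rho> y \<epsilon> \<delta> \<beta>"
  then obtain \<theta>1 y' where *: "\<theta>1 \<in> mon (G\<lparr>carrier := F1\<rparr>) G" "\<forall>f\<in>F. \<theta>1 f = \<theta> f" "\<forall>i<m. dist (y i) (y' i) < \<epsilon>"
      "\<forall>i<n. \<forall>j<n. \<forall>f\<in>F1. \<bar>dist (y' i) (\<beta> (\<theta>1 f) (y' j)) - \<rho> i j f\<bar> < \<delta>"
    unfolding realizes_extension_def by (elim exE conjE)
  define P where "P = (\<lambda>(i, j, f) \<gamma>. \<bar>dist (y' i) (\<gamma> (\<theta>1 f) (y' j)) - \<rho> i j f\<bar> < \<delta>)"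
  let ?K = "{..<n} \<times> {..<n} \<times> F1"
  let ?T = "{\<gamma> \<in> topspace (hom_topology G). \<forall>k\<in>?K. P k \<gamma>}"
  have "openin (hom_topology G) ?T"
  proof (rule openin_finite_conditions)
    show "finite ?K" using assms by simp
    fix k assume "k \<in> ?K"
    then obtain i j f where k: "k = (i, j, f)" "f \<in> F1" by auto
    have "\<theta>1 f \<in> carrier G" using *(1) k by (auto simp: mon_def hom_def)
    then have c: "continuous_map (hom_topology G) euclideanreal (\<lambda>\<gamma>. dist (y' i) (\<gamma> (\<theta>1 f) (y' j)))"
      by (intro continuous_map_dist_euclidean continuous_map_action) auto
    have "openin (hom_topology G) {\<gamma> \<in> topspace (hom_topology G). dist (y' i) (\<gamma> (\<theta>1 f) (y' j)) \<in> {t. \<bar>t - \<rho> i j f\<bar> < \<delta>}}"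
    proof (rule openin_continuous_map_preimage[OF c])
      have "{t. \<bar>t - \<rho> i j f\<bar> < \<delta>} = ball (\<rho> i j f) \<delta>" by (auto simp: dist_real_def)
      then show "openin euclideanreal {t. \<bar>t - \<rho> i j f\<bar> < \<delta>}" by simp
    qed
    then show "openin (hom_topology G) {\<gamma> \<in> topspace (hom_topology G). P k \<gamma>}" by (simp add: k P_def)
  qed
  moreover have "\<beta> \<in> ?T" using \<beta>(1) *(4) by (auto simp: P_def)
  moreover have "?T \<subseteq> {\<beta> \<in> topspace (hom_topology G). realizes_extension G F F1 \<theta> m n \<rho> y \<epsilon> \<delta> \<beta>}"
  proof safe
    fix \<gamma> assume "\<forall>k\<in>?K. P k \<gamma>"
    then have "\<forall>i<n. \<forall>j<n. \<forall>f\<in>F1. \<bar>dist (y' i) (\<gamma> (\<theta>1 f) (y' j)) - \<rho> i j f\<bar> < \<delta>" by (auto simp: P_def)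
    then show "realizes_extension G F F1 \<theta> m n \<rho> y \<epsilon> \<delta> \<gamma>"
      unfolding realizes_extension_def using *(1-3) by blast
  qed
  ultimately show "\<exists>T. openin (hom_topology G) T \<and> \<beta> \<in> T \<and>
      T \<subseteq> {\<beta> \<in> topspace (hom_topology G). realizes_extension G F F1 \<theta> m n \<rho> y \<epsilon> \<delta> \<beta>}" by blast
qed

text \<open>
  The homomorphisms for which the given data pose an extension problem without solution.
\<close>

definition unrealized_extension ::
  "('g, 'm) monoid_scheme \<Rightarrow> 'g set \<Rightarrow> 'g set \<Rightarrow> ('g \<Rightarrow> 'g) \<Rightarrow> nat \<Rightarrow> nat \<Rightarrow> (nat \<Rightarrow> nat \<Rightarrow> 'g \<Rightarrow> real) \<Rightarrow>
   (nat \<Rightarrow> 'u::metric_space) \<Rightarrow> real \<Rightarrow> real \<Rightarrow> ('g \<Rightarrow> 'u \<Rightarrow> 'u) set" where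
  "unrealized_extension G F F1 \<theta> m n \<rho> y \<epsilon> \<delta> = {\<beta> \<in> topspace (hom_topology G).
     subgroup F1 G \<and> finite F1 \<and> subgroup F G \<and> F \<subseteq> F1 \<and> \<theta> \<in> mon (G\<lparr>carrier := F\<rparr>) G \<and>
     rational_orbit_metric G F1 {..<n} \<rho> \<and> m \<le> n \<and> 0 < \<epsilon> \<and> 0 < \<delta> \<and>
     (\<forall>i<m. \<forall>j<m. \<forall>f\<in>F. \<bar>dist (y i) (\<beta> (\<theta> f) (y j)) - \<rho> i j f\<bar> < \<epsilon>) \<and>
     \<not> realizes_extension G F F1 \<theta> m n \<rho> y \<epsilon> \<delta> \<beta>}"

text \<open>
  Every open set that meets this set contains a homomorphism with a realisation, and having one is
  an open condition.
\<close>

lemma nowhere_dense_unrealized_extension: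
  fixes G :: "('g, 'm) monoid_scheme" and y :: "nat \<Rightarrow> 'u::metric_space"
  assumes hall: "hall_universal_group G" and U: "urysohn_space TYPE('u)"
  shows "(hom_topology G) interior_of ((hom_topology G) closure_of
     (unrealized_extension G F F1 \<theta> m n \<rho> y \<epsilon> \<delta>)) = {}"
proof (rule ccontr)
  let ?X = "hom_topology G :: ('g \<Rightarrow> 'u \<Rightarrow> 'u) topology"
  let ?N = "unrealized_extension G F F1 \<theta> m n \<rho> y \<epsilon> \<delta>"
  let ?E = "{\<beta> \<in> topspace ?X. realizes_extension G F F1 \<theta> m n \<rho> y \<epsilon> \<delta> \<beta>}"
  let ?O = "?X interior_of (?X closure_of ?N)"
  assume "?O \<noteq> {}"
  then obtain \<gamma> where \<gamma>: "\<gamma> \<in> ?O" by blast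
  have O: "openin ?X ?O" "?O \<subseteq> ?X closure_of ?N" by (auto simp: interior_of_subset)
  then have "\<gamma> \<in> ?X closure_of ?N" using \<gamma> by blast
  then obtain \<beta>0 where \<beta>0: "\<beta>0 \<in> ?N" "\<beta>0 \<in> ?O"
    using O(1) \<gamma> unfolding in_closure_of by blast
  obtain S Z \<eta> where SZ: "finite S" "S \<subseteq> carrier G" "finite Z" "0 < \<eta>"
    "\<forall>\<beta>\<in>topspace ?X. (\<forall>g\<in>S. \<forall>z\<in>Z. dist (\<beta> g z) (\<beta>0 g z) < \<eta>) \<longrightarrow> \<beta> \<in> ?O"
    using hom_topology_neighbourhood[OF O(1) \<beta>0(2)] by (elim exE conjE)
  have D: "subgroup F1 G" "finite F1" "subgroup F G" "F \<subseteq> F1" "\<theta> \<in> mon (G\<lparr>carrier := F\<rparr>) G"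
     "rational_orbit_metric G F1 {..<n} \<rho>" "m \<le> n" "0 < \<epsilon>" "0 < \<delta>"
     "\<And>i j f. i < m \<Longrightarrow> j < m \<Longrightarrow> f \<in> F \<Longrightarrow> \<bar>dist (y i) (\<beta>0 (\<theta> f) (y j)) - \<rho> i j f\<bar> < \<epsilon>"
     "\<beta>0 \<in> hom G isometry_group"
    using \<beta>0(1) unfolding unrealized_extension_def topspace_hom_topology by blast+
  obtain \<beta> where \<beta>: "\<beta> \<in> topspace ?X" "\<forall>g\<in>S. \<forall>z\<in>Z. dist (\<beta> g z) (\<beta>0 g z) < \<eta>"
      "realizes_extension G F F1 \<theta> m n \<rho> y \<epsilon> \<delta> \<beta>"
    using realizes_extension_dense[OF hall U D(11) SZ(1-4) D(1-9), of y] D(10) by blast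
  then have "\<beta> \<in> ?O" using SZ(5) by blast
  then have "\<beta> \<in> ?X closure_of ?N" using O(2) by blast
  then have cl: "\<forall>T. \<beta> \<in> T \<and> openin ?X T \<longrightarrow> (\<exists>\<gamma>. \<gamma> \<in> ?N \<and> \<gamma> \<in> T)"
    by (simp add: in_closure_of)
  have "openin ?X ?E"
    using openin_realizes_extension[OF D(2) subgroup.subset[OF D(1)]] .
  moreover have "\<beta> \<in> ?E" using \<beta> by blast
  ultimately have "\<exists>\<gamma>. \<gamma> \<in> ?N \<and> \<gamma> \<in> ?E" using spec[OF cl, of ?E] by blast
  then show False by (auto simp: unrealized_extension_def)
qed

text \<open>
  Extensional functions and rational values make these sets countable. Here \<open>\<rho>\<close> is uncurried to a
  function \<open>r\<close> on triples.
\<close>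

definition extension_data ::
  "('g, 'm) monoid_scheme \<Rightarrow> 'u::metric_space set \<Rightarrow> 'g set \<times> 'g set \<times> nat \<times> nat \<Rightarrow>
    (('g \<Rightarrow> 'g) \<times> (nat \<times> nat \<times> 'g \<Rightarrow> real) \<times> (nat \<Rightarrow> 'u) \<times> real \<times> real) set" where
  "extension_data G Q = (\<lambda>(F, F1, m, n). PiE F (\<lambda>_. carrier G) \<times> PiE ({..<n} \<times> {..<n} \<times> F1) (\<lambda>_. \<rat>) \<times>
      PiE {..<m} (\<lambda>_. Q) \<times> \<rat> \<times> \<rat>)"

definition generic_actions ::
  "('g, 'm) monoid_scheme \<Rightarrow> 'u::metric_space set \<Rightarrow> ('g \<Rightarrow> 'u \<Rightarrow> 'u) set" where
  "generic_actions G Q = {\<beta> \<in> topspace (hom_topology G).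
     \<forall>F F1 m n. \<forall>(\<theta>, r, y, \<epsilon>, \<delta>) \<in> extension_data G Q (F, F1, m, n).
       \<beta> \<notin> unrealized_extension G F F1 \<theta> m n (\<lambda>i j f. r (i, j, f)) y \<epsilon> \<delta>}"

lemma meager_in_subset:
  assumes "meager_in X B" "A \<subseteq> B" shows "meager_in X A"
proof -
  obtain \<N> where N: "countable \<N>" "B = \<Union>\<N>" "\<And>N. N \<in> \<N> \<Longrightarrow> N \<subseteq> topspace X \<and> X interior_of (X closure_of N) = {}"
    using assms(1) unfolding meager_in_def by blast
  show ?thesis
    unfolding meager_in_def
  proof (intro exI[of _ "(\<lambda>N. N \<inter> A) ` \<N>"] conjI ballI)
    show "countable ((\<lambda>N. N \<inter> A) ` \<N>)" using N(1) by simp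
    show "A = \<Union>((\<lambda>N. N \<inter> A) ` \<N>)" using N(2) assms(2) by blast
    fix M assume "M \<in> (\<lambda>N. N \<inter> A) ` \<N>"
    then obtain K where K: "K \<in> \<N>" "M = K \<inter> A" by blast
    have "X interior_of (X closure_of M) \<subseteq> X interior_of (X closure_of K)"
      using K(2) by (intro interior_of_mono closure_of_mono) blast
    then show "M \<subseteq> topspace X" "X interior_of (X closure_of M) = {}" using N(3)[OF K(1)] K(2) by auto
  qed
qed

lemma comeager_generic_actions:
  fixes G :: "('g, 'm) monoid_scheme" and Q :: "'u::metric_space set"
  assumes hall: "hall_universal_group G" and U: "urysohn_space TYPE('u)" and Q: "countable Q"
    and A: "generic_actions G Q \<subseteq> A" "A \<subseteq> topspace (hom_topology G)"
  shows "comeager_in (hom_topology G) A"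
proof -
  have cG: "countable (carrier G)" using hall by (simp add: hall_universal_group_def)
  define Fin where "Fin = {F. finite F \<and> F \<subseteq> carrier G}"
  have cFin: "countable Fin" unfolding Fin_def by (rule countable_Collect_finite_subset[OF cG])
  define bad where "bad = (\<lambda>(F, F1, m, n). (\<lambda>(\<theta>, r, y, \<epsilon>, \<delta>).
     unrealized_extension G F F1 \<theta> m n (\<lambda>i j f. r (i, j, f)) y \<epsilon> \<delta>) ` extension_data G Q (F, F1, m, n))"
  define \<N> where "\<N> = (\<Union>t\<in>Fin \<times> Fin \<times> UNIV \<times> UNIV. bad t)"
  have "countable (extension_data G Q t)" if "t \<in> Fin \<times> Fin \<times> UNIV \<times> UNIV" for t
    using that cG Q unfolding extension_data_def Fin_def
    by (auto intro!: countable_SIGMA countable_PiE simp: countable_rat)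
  then have "countable (bad t)" if "t \<in> Fin \<times> Fin \<times> UNIV \<times> UNIV" for t
    using that by (cases t) (auto simp: bad_def)
  then have "countable \<N>"
    unfolding \<N>_def using cFin by (intro countable_UN) auto
  moreover have "N \<subseteq> topspace (hom_topology G) \<and> (hom_topology G) interior_of ((hom_topology G) closure_of N) = {}"
    if "N \<in> \<N>" for N
    using that nowhere_dense_unrealized_extension[OF hall U]
    by (auto simp: \<N>_def bad_def unrealized_extension_def)
  ultimately have m: "meager_in (hom_topology G) (\<Union>\<N>)" unfolding meager_in_def by blast
  have "topspace (hom_topology G) - A \<subseteq> \<Union>\<N>"
  proof
    fix \<beta> assume \<beta>: "\<beta> \<in> topspace (hom_topology G) - A"
    then have "\<beta> \<notin> generic_actions G Q" using A by blast
    then obtain F F1 m n \<theta> r y \<epsilon> \<delta> where d: "(\<theta>, r, y, \<epsilon>, \<delta>) \<in> extension_data G Q (F, F1, m, n)"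
       and b: "\<beta> \<in> unrealized_extension G F F1 \<theta> m n (\<lambda>i j f. r (i, j, f)) y \<epsilon> \<delta>"
      using \<beta> unfolding generic_actions_def by blast
    have "F \<in> Fin" "F1 \<in> Fin"
      using b subgroup.subset finite_subset by (auto simp: unrealized_extension_def Fin_def)
    then show "\<beta> \<in> \<Union>\<N>"
      using d b by (fastforce simp: \<N>_def bad_def)
  qed
  then show ?thesis using meager_in_subset[OF m] A(2) by (simp add: comeager_in_def)
qed

section \<open>Conjugacy of generic homomorphisms\<close>

lemma rational_orbit_metric_cong:
  assumes "group G" and F: "subgroup F G" and \<rho>: "rational_orbit_metric G F I \<rho>"
    and eq: "\<And>i j g. i \<in> I \<Longrightarrow> j \<in> I \<Longrightarrow> g \<in> F \<Longrightarrow> \<rho>' i j g = \<rho> i j g"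
  shows "rational_orbit_metric G F I \<rho>'"
proof -
  note cl = subgroup.m_closed[OF F] subgroup.m_inv_closed[OF F] subgroup.one_closed[OF F]
  show ?thesis
    unfolding rational_orbit_metric_def orbit_pseudometric_def
  proof (intro conjI ballI impI)
    show "\<rho>' i i \<one>\<^bsub>G\<^esub> = 0" if "i \<in> I" for i
      using that orbit_pseudometricD(1)[OF rational_orbit_metricD(1)[OF \<rho>] that] cl by (simp add: eq)
    show "\<rho>' i j g = \<rho>' j i (inv\<^bsub>G\<^esub> g)" if "i \<in> I" "j \<in> I" "g \<in> F" for i j g
      using orbit_pseudometricD(2)[OF rational_orbit_metricD(1)[OF \<rho>] that] that cl(2) by (simp add: eq)
    show "\<rho>' i k (g \<otimes>\<^bsub>G\<^esub> h) \<le> \<rho>' i j g + \<rho>' j k h"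
      if "i \<in> I" "j \<in> I" "k \<in> I" "g \<in> F" "h \<in> F" for i j k g h
      using orbit_pseudometricD(3)[OF rational_orbit_metricD(1)[OF \<rho>] that] that cl(1) by (simp add: eq)
    show "\<rho>' i j g \<in> \<rat>" if "i \<in> I" "j \<in> I" "g \<in> F" for i j g
      using rational_orbit_metricD(2)[OF \<rho> that] that by (simp add: eq)
    show "i = j" "g = \<one>\<^bsub>G\<^esub>" if "i \<in> I" "j \<in> I" "g \<in> F" "\<rho>' i j g = 0" for i j g
      using rational_orbit_metricD(3,4)[OF \<rho> that(1-3)] that by (simp_all add: eq)
  qed
qed

text \<open>
  Arbitrary real data are replaced by rational ones; the strict inequality \<open>close\<close> absorbs the
  rounding errors.
\<close>

lemma generic_extension:
  fixes G (structure) and \<beta> :: "'g \<Rightarrow> 'u::metric_space \<Rightarrow> 'u"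
  assumes "group G" and Q: "closure Q = UNIV" and \<beta>: "\<beta> \<in> generic_actions G Q"
    and F1: "subgroup F1 G" "finite F1" and F: "subgroup F G" "F \<subseteq> F1"
    and \<theta>: "\<theta> \<in> mon (G\<lparr>carrier := F\<rparr>) G" and \<rho>: "orbit_pseudometric G F1 {..<n} \<rho>" and m: "m \<le> n"
    and pos: "0 < \<epsilon>" "0 < \<delta>"
    and close: "\<And>i j f. i < m \<Longrightarrow> j < m \<Longrightarrow> f \<in> F \<Longrightarrow> \<bar>dist (y i) (\<beta> (\<theta> f) (y j)) - \<rho> i j f\<bar> < \<epsilon>"
  shows "realizes_extension G F F1 \<theta> m n \<rho> y \<epsilon> \<delta> \<beta>"
proof -
  interpret group G by fact
  have \<beta>h: "\<beta> \<in> hom G isometry_group"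
    using \<beta> by (simp add: generic_actions_def topspace_hom_topology)
  note H = hom_isometryD[OF is_group \<beta>h]
  have \<theta>C: "\<theta> f \<in> carrier G" if "f \<in> F" for f using \<theta> that by (auto simp: mon_def hom_def)
  have finF: "finite F" using F F1 finite_subset by blast
  define err where "err = (\<lambda>(i, j, f). \<bar>dist (y i) (\<beta> (\<theta> f) (y j)) - \<rho> i j f\<bar>)"
  have finE: "finite ({..<m} \<times> {..<m} \<times> F)" using finF by simp
  define \<epsilon>' where "\<epsilon>' = sup0 ({..<m} \<times> {..<m} \<times> F) err"
  have \<epsilon>': "\<epsilon>' < \<epsilon>" "0 \<le> \<epsilon>'"
  proof -
    show "\<epsilon>' < \<epsilon>" unfolding \<epsilon>'_def sup0_def using finE pos close by (subst Max_less_iff) (auto simp: err_def)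
    show "0 \<le> \<epsilon>'" unfolding \<epsilon>'_def by (rule sup0_nonneg[OF finE])
  qed
  have err: "\<bar>dist (y i) (\<beta> (\<theta> f) (y j)) - \<rho> i j f\<bar> \<le> \<epsilon>'" if "i < m" "j < m" "f \<in> F" for i j f
    using sup0_upper[OF finE, of "(i, j, f)" err] that by (simp add: \<epsilon>'_def err_def)
  define s where "s = min (\<epsilon> - \<epsilon>') \<delta>"
  have s: "0 < s" using \<epsilon>' pos by (simp add: s_def)
  obtain N :: nat where N0: "8 / s < real N" using reals_Archimedean2 by blast
  have "0 < 8 / s" using s by simp
  then have N: "0 < N" using N0 by (metis gr0I less_asym of_nat_0)
  define t where "t = 1 / real N"
  have t: "0 < t" "8 * t < s" "t \<in> \<rat>" using N0 s N by (auto simp: t_def field_simps)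
  have two: "2 / real N = 2 * t" by (simp add: t_def)
  obtain \<epsilon>1 where \<epsilon>1: "\<epsilon>1 \<in> \<rat>" "\<epsilon>' + 4 * t < \<epsilon>1" "\<epsilon>1 < \<epsilon> - t"
    using Rats_dense_in_real[of "\<epsilon>' + 4 * t" "\<epsilon> - t"] t by (auto simp: s_def)
  define r where "r = restrict (\<lambda>(i, j, f). round_up G N \<rho> i j f) ({..<n} \<times> {..<n} \<times> F1)"
  have r: "r (i, j, f) = round_up G N \<rho> i j f" if "i < n" "j < n" "f \<in> F1" for i j f
    using that by (simp add: r_def)
  have rom: "rational_orbit_metric G F1 {..<n} (round_up G N \<rho>)"
    by (rule rational_orbit_metric_round_up[OF is_group F1(1) \<rho> N])
  have rom': "rational_orbit_metric G F1 {..<n} (\<lambda>i j f. r (i, j, f))"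
    by (rule rational_orbit_metric_cong[OF is_group F1(1) rom]) (simp add: r)
  have r\<rho>: "\<rho> i j f \<le> r (i, j, f)" "r (i, j, f) \<le> \<rho> i j f + 2 * t" if "i < n" "j < n" "f \<in> F1" for i j f
    using round_up_bounds[where i = i and j = j and g = f and G = G and \<rho> = \<rho>, OF N]
      orbit_pseudometricD(1)[OF \<rho>, of i] that by (auto simp: r two)
  have "\<exists>u\<in>Q. dist u v < t" for v
    using Q t(1) closure_approachable[of v Q] by blast
  then obtain p where p: "\<And>v. p v \<in> Q" "\<And>v. dist (p v) v < t" by metis
  define y1 where "y1 = restrict (\<lambda>i. p (y i)) {..<m}"
  have y1: "dist (y1 i) (y i) < t" if "i < m" for i using that p by (simp add: y1_def)
  define \<theta>' where "\<theta>' = restrict \<theta> F"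
  have \<theta>': "\<theta>' \<in> mon (G\<lparr>carrier := F\<rparr>) G"
    using \<theta> subgroup.m_closed[OF F(1)] by (auto simp: mon_def hom_def \<theta>'_def inj_on_def)
  have data: "(\<theta>', r, y1, \<epsilon>1, t) \<in> extension_data G Q (F, F1, m, n)"
    using \<theta>C p rational_orbit_metricD(2)[OF rom'] \<epsilon>1 t
    by (auto simp: extension_data_def \<theta>'_def y1_def r_def)
  have V: "\<bar>dist (y1 i) (\<beta> (\<theta>' f) (y1 j)) - r (i, j, f)\<bar> < \<epsilon>1" if a: "i < m" "j < m" "f \<in> F" for i j f
  proof -
    have "\<bar>dist (y1 i) (\<beta> (\<theta> f) (y1 j)) - dist (y i) (\<beta> (\<theta> f) (y j))\<bar> \<le> dist (y1 i) (y i) + dist (y1 j) (y j)"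
      using dist_quadrilateral[of "y1 i" "\<beta> (\<theta> f) (y1 j)" "y i" "\<beta> (\<theta> f) (y j)"]
        H(1)[OF \<theta>C[OF a(3)], of "y1 j" "y j"] by simp
    then show ?thesis
      using y1[OF a(1)] y1[OF a(2)] err[OF a] r\<rho>[of i j f] a m F(2) \<epsilon>1 by (auto simp: \<theta>'_def subset_iff)
  qed
  have \<beta>top: "\<beta> \<in> topspace (hom_topology G)" using \<beta> by (simp add: generic_actions_def)
  have "\<forall>F F1 m n. \<forall>(\<theta>, r, y, \<epsilon>, \<delta>) \<in> extension_data G Q (F, F1, m, n).
       \<beta> \<notin> unrealized_extension G F F1 \<theta> m n (\<lambda>i j f. r (i, j, f)) y \<epsilon> \<delta>"
    using \<beta> by (simp add: generic_actions_def)
  then have "\<forall>(\<theta>, r, y, \<epsilon>, \<delta>) \<in> extension_data G Q (F, F1, m, n).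
       \<beta> \<notin> unrealized_extension G F F1 \<theta> m n (\<lambda>i j f. r (i, j, f)) y \<epsilon> \<delta>"
    by (elim allE)
  from bspec[OF this data]
  have nb: "\<beta> \<notin> unrealized_extension G F F1 \<theta>' m n (\<lambda>i j f. r (i, j, f)) y1 \<epsilon>1 t"
    by simp
  have \<epsilon>1pos: "0 < \<epsilon>1" using \<epsilon>1 \<epsilon>' t by linarith
  have "realizes_extension G F F1 \<theta>' m n (\<lambda>i j f. r (i, j, f)) y1 \<epsilon>1 t \<beta>"
  proof (rule ccontr)
    assume "\<not> ?thesis"
    then have "\<beta> \<in> unrealized_extension G F F1 \<theta>' m n (\<lambda>i j f. r (i, j, f)) y1 \<epsilon>1 t"
      unfolding unrealized_extension_def using \<beta>top F1 F \<theta>' rom' m \<epsilon>1pos t(1) V by blast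
    with nb show False by contradiction
  qed
  then obtain \<theta>1 y' where *: "\<theta>1 \<in> mon (G\<lparr>carrier := F1\<rparr>) G" "\<forall>f\<in>F. \<theta>1 f = \<theta>' f" "\<forall>i<m. dist (y1 i) (y' i) < \<epsilon>1"
      "\<forall>i<n. \<forall>j<n. \<forall>f\<in>F1. \<bar>dist (y' i) (\<beta> (\<theta>1 f) (y' j)) - r (i, j, f)\<bar> < t"
    unfolding realizes_extension_def by (elim exE conjE)
  show ?thesis
    unfolding realizes_extension_def
  proof (intro exI conjI allI impI ballI)
    show "\<theta>1 \<in> mon (G\<lparr>carrier := F1\<rparr>) G" by (rule *(1))
    show "\<theta>1 f = \<theta> f" if "f \<in> F" for f using *(2) that by (simp add: \<theta>'_def)
    show "dist (y i) (y' i) < \<epsilon>" if "i < m" for i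
      using y1[OF that] *(3)[rule_format, OF that] \<epsilon>1(3) dist_triangle[of "y i" "y' i" "y1 i"]
      by (simp add: dist_commute)
    show "\<bar>dist (y' i) (\<beta> (\<theta>1 f) (y' j)) - \<rho> i j f\<bar> < \<delta>" if "i < n" "j < n" "f \<in> F1" for i j f
      using *(4)[rule_format, OF that] r\<rho>[OF that] t by (auto simp: s_def)
  qed
qed

text \<open>
  A finite stage of the back and forth between \<open>\<alpha>\<close> and \<open>\<beta>\<close>: \<open>\<theta>\<close> matches group elements and the pairs
  in \<open>R\<close> match points.
\<close>

definition approximate_matching ::
  "('g, 'm) monoid_scheme \<Rightarrow> ('g \<Rightarrow> 'u::metric_space \<Rightarrow> 'u) \<Rightarrow> ('g \<Rightarrow> 'u \<Rightarrow> 'u) \<Rightarrow> real \<Rightarrow>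
   'g set \<Rightarrow> ('g \<Rightarrow> 'g) \<Rightarrow> ('u \<times> 'u) set \<Rightarrow> bool" where
  "approximate_matching G \<alpha> \<beta> \<epsilon> F \<theta> R \<longleftrightarrow>
     subgroup F G \<and> finite F \<and> \<theta> \<in> mon (G\<lparr>carrier := F\<rparr>) G \<and> finite R \<and>
     (\<forall>p\<in>R. \<forall>q\<in>R. \<forall>f\<in>F. \<bar>dist (fst p) (\<alpha> f (fst q)) - dist (snd p) (\<beta> (\<theta> f) (snd q))\<bar> < \<epsilon>)"

text \<open>
  The orbit pseudometric of \<open>\<alpha>\<close> on \<open>F1\<close> and all points in question is the one that \<open>\<beta>\<close> has to
  realise. The points on the side of \<open>\<alpha>\<close> stay, those on the side of \<open>\<beta>\<close> move by less than \<open>\<epsilon>\<close>.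
\<close>

lemma approximate_matching_extend:
  fixes G (structure) and \<beta> :: "'g \<Rightarrow> 'u::metric_space \<Rightarrow> 'u"
  assumes "group G" and Q: "closure Q = UNIV"
    and \<alpha>: "\<alpha> \<in> hom G isometry_group" and \<beta>: "\<beta> \<in> generic_actions G Q"
    and M: "approximate_matching G \<alpha> \<beta> \<epsilon> F \<theta> R" and pos: "0 < \<epsilon>" "0 < \<delta>"
    and F1: "subgroup F1 G" "finite F1" "F \<subseteq> F1" and X: "finite X"
  shows "\<exists>\<theta>1 R1. approximate_matching G \<alpha> \<beta> \<delta> F1 \<theta>1 R1 \<and> (\<forall>f\<in>F. \<theta>1 f = \<theta> f) \<and> X \<subseteq> fst ` R1 \<and>
    (\<forall>p\<in>R. \<exists>q\<in>R1. fst q = fst p \<and> dist (snd p) (snd q) < \<epsilon>)"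
proof -
  have F: "subgroup F G" "finite F" "\<theta> \<in> mon (G\<lparr>carrier := F\<rparr>) G" "finite R"
    and close: "\<And>p q f. p \<in> R \<Longrightarrow> q \<in> R \<Longrightarrow> f \<in> F \<Longrightarrow>
       \<bar>dist (fst p) (\<alpha> f (fst q)) - dist (snd p) (\<beta> (\<theta> f) (snd q))\<bar> < \<epsilon>"
    using M by (auto simp: approximate_matching_def)
  obtain ps where ps: "set ps = R" using finite_list[OF F(4)] by blast
  obtain xs where xs: "set xs = X" using finite_list[OF X] by blast
  define m where "m = length ps"
  define n where "n = m + length xs"
  define x where "x i = (if i < m then fst (ps ! i) else xs ! (i - m))" for i
  have psR: "ps ! i \<in> R" if "i < m" for i using that ps nth_mem[of i ps] by (simp add: m_def)
  have "realizes_extension G F F1 \<theta> m n (\<lambda>i j g. dist (x i) (\<alpha> g (x j))) (\<lambda>i. snd (ps ! i)) \<epsilon> \<delta> \<beta>"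
  proof (rule generic_extension[OF assms(1) Q \<beta> F1(1,2) F(1) F1(3) F(3) _ _ pos])
    show "orbit_pseudometric G F1 {..<n} (\<lambda>i j g. dist (x i) (\<alpha> g (x j)))"
      by (rule orbit_pseudometric_action[OF assms(1) \<alpha> subgroup.subset[OF F1(1)]])
    show "m \<le> n" by (simp add: n_def)
    show "\<bar>dist (snd (ps ! i)) (\<beta> (\<theta> f) (snd (ps ! j))) - dist (x i) (\<alpha> f (x j))\<bar> < \<epsilon>"
      if "i < m" "j < m" "f \<in> F" for i j f
      using close[OF psR[OF that(1)] psR[OF that(2)] that(3)] that by (simp add: x_def abs_minus_commute)
  qed
  then obtain \<theta>1 y' where *: "\<theta>1 \<in> mon (G\<lparr>carrier := F1\<rparr>) G" "\<forall>f\<in>F. \<theta>1 f = \<theta> f"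
      "\<forall>i<m. dist (snd (ps ! i)) (y' i) < \<epsilon>"
      "\<forall>i<n. \<forall>j<n. \<forall>f\<in>F1. \<bar>dist (y' i) (\<beta> (\<theta>1 f) (y' j)) - dist (x i) (\<alpha> f (x j))\<bar> < \<delta>"
    unfolding realizes_extension_def by (elim exE conjE)
  define R1 where "R1 = (\<lambda>i. (x i, y' i)) ` {..<n}"
  show ?thesis
  proof (intro exI conjI ballI)
    show "approximate_matching G \<alpha> \<beta> \<delta> F1 \<theta>1 R1"
      using F1 *(1,4) by (auto simp: approximate_matching_def R1_def abs_minus_commute)
    show "\<theta>1 f = \<theta> f" if "f \<in> F" for f using *(2) that by blast
    show "X \<subseteq> fst ` R1"
    proof
      fix u assume "u \<in> X"
      then obtain i where "i < length xs" "xs ! i = u" using xs by (metis in_set_conv_nth)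
      then have "m + i < n" "x (m + i) = u" by (simp_all add: n_def x_def)
      then show "u \<in> fst ` R1" by (force simp: R1_def image_image)
    qed
    fix p assume "p \<in> R"
    then obtain i where i: "i < m" "ps ! i = p" using ps by (metis in_set_conv_nth m_def)
    have "i < n" using i by (simp add: n_def)
    then have "(x i, y' i) \<in> R1" by (simp add: R1_def)
    then show "\<exists>q\<in>R1. fst q = fst p \<and> dist (snd p) (snd q) < \<epsilon>"
      using i *(3) by (intro bexI[of _ "(x i, y' i)"]) (auto simp: x_def)
  qed
qed

lemma approximate_matching_converse:
  fixes G (structure)
  assumes "group G" "approximate_matching G \<alpha> \<beta> \<epsilon> F \<theta> R"
  shows "approximate_matching G \<beta> \<alpha> \<epsilon> (\<theta> ` F) (inv_into F \<theta>) (prod.swap ` R)"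
proof -
  interpret group G by fact
  have F: "subgroup F G" "finite F" "\<theta> \<in> hom (G\<lparr>carrier := F\<rparr>) G" "inj_on \<theta> F" "finite R"
    and close: "\<And>p q f. p \<in> R \<Longrightarrow> q \<in> R \<Longrightarrow> f \<in> F \<Longrightarrow>
       \<bar>dist (fst p) (\<alpha> f (fst q)) - dist (snd p) (\<beta> (\<theta> f) (snd q))\<bar> < \<epsilon>"
    using assms(2) by (auto simp: approximate_matching_def mon_def)
  have "group_hom (G\<lparr>carrier := F\<rparr>) G \<theta>"
    using F(3) subgroup.subgroup_is_group[OF F(1) is_group] is_group
    by (simp add: group_hom_def group_hom_axioms_def)
  then have sub: "subgroup (\<theta> ` F) G" using group_hom.img_is_subgroup by fastforce
  have inv: "inv_into F \<theta> (\<theta> f) = f" if "f \<in> F" for f using that F(4) by simp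
  have mult: "\<theta> (f \<otimes> h) = \<theta> f \<otimes> \<theta> h" if "f \<in> F" "h \<in> F" for f h
    using F(3) that by (simp add: hom_def)
  have "inv_into F \<theta> \<in> mon (G\<lparr>carrier := \<theta> ` F\<rparr>) G"
    using subgroup.mem_carrier[OF F(1)] subgroup.m_closed[OF F(1)]
    by (auto simp: mon_def hom_def inv inj_on_def mult[symmetric])
  then show ?thesis
    using sub F close by (auto simp: approximate_matching_def inv abs_minus_commute)
qed

text \<open>
  One extension in each direction. The accuracy \<open>\<delta>\<close> is reached in the second one.
\<close>

lemma approximate_matching_step:
  fixes G (structure) and \<beta> :: "'g \<Rightarrow> 'u::metric_space \<Rightarrow> 'u"
  assumes lf: "locally_finite_group G" and Q: "closure Q = UNIV"
    and \<alpha>: "\<alpha> \<in> generic_actions G Q" and \<beta>: "\<beta> \<in> generic_actions G Q"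
    and M: "approximate_matching G \<alpha> \<beta> \<epsilon> F \<theta> R" and pos: "0 < \<epsilon>" "0 < \<delta>"
    and g: "g \<in> carrier G" and X: "finite X"
  shows "\<exists>F' \<theta>' R'. approximate_matching G \<alpha> \<beta> \<delta> F' \<theta>' R' \<and> F \<subseteq> F' \<and> (\<forall>f\<in>F. \<theta>' f = \<theta> f) \<and>
    g \<in> F' \<and> g \<in> \<theta>' ` F' \<and>
    (\<forall>p\<in>R. \<exists>q\<in>R'. dist (fst p) (fst q) < \<epsilon> \<and> dist (snd p) (snd q) < \<epsilon>) \<and>
    (\<forall>x\<in>X. \<exists>q\<in>R'. dist x (fst q) < \<epsilon>) \<and> (\<forall>x\<in>X. \<exists>q\<in>R'. dist x (snd q) < \<epsilon>)"
proof -
  interpret group G using lf by (simp add: locally_finite_group_def)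
  have h: "\<alpha> \<in> hom G isometry_group" "\<beta> \<in> hom G isometry_group"
    using \<alpha> \<beta> by (auto simp: generic_actions_def topspace_hom_topology)
  have gen: "subgroup (generate G (insert g K)) G \<and> finite (generate G (insert g K)) \<and>
      K \<subseteq> generate G (insert g K) \<and> g \<in> generate G (insert g K)" if "subgroup K G" "finite K" for K
    using lf g that subgroup.subset[OF that(1)] generate_is_subgroup[of "insert g K"]
      generate.incl[of _ "insert g K" G]
    by (auto simp: locally_finite_group_def)
  have F: "subgroup F G" "finite F" using M by (auto simp: approximate_matching_def)
  define F1 where "F1 = generate G (insert g F)"
  have F1: "subgroup F1 G" "finite F1" "F \<subseteq> F1" "g \<in> F1" using gen[OF F] by (auto simp: F1_def)
  obtain \<theta>1 R1 where 1: "approximate_matching G \<alpha> \<beta> \<epsilon> F1 \<theta>1 R1" "\<forall>f\<in>F. \<theta>1 f = \<theta> f" "X \<subseteq> fst ` R1"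
    "\<forall>p\<in>R. \<exists>q\<in>R1. fst q = fst p \<and> dist (snd p) (snd q) < \<epsilon>"
    using approximate_matching_extend[OF is_group Q h(1) \<beta> M pos(1) pos(1) F1(1-3) X] by (elim exE conjE)
  note M1 = approximate_matching_converse[OF is_group 1(1)]
  have T: "subgroup (\<theta>1 ` F1) G" "finite (\<theta>1 ` F1)" using M1 by (auto simp: approximate_matching_def)
  define F2 where "F2 = generate G (insert g (\<theta>1 ` F1))"
  have F2: "subgroup F2 G" "finite F2" "\<theta>1 ` F1 \<subseteq> F2" "g \<in> F2" using gen[OF T] by (auto simp: F2_def)
  obtain \<theta>2 R2 where 2: "approximate_matching G \<beta> \<alpha> \<delta> F2 \<theta>2 R2" "\<forall>f\<in>\<theta>1 ` F1. \<theta>2 f = inv_into F1 \<theta>1 f"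
    "X \<subseteq> fst ` R2" "\<forall>p\<in>prod.swap ` R1. \<exists>q\<in>R2. fst q = fst p \<and> dist (snd p) (snd q) < \<epsilon>"
    using approximate_matching_extend[OF is_group Q h(2) \<alpha> M1 pos F2(1-3) X] by (elim exE conjE)
  note M2 = approximate_matching_converse[OF is_group 2(1)]
  have inj1: "inj_on \<theta>1 F1" and inj2: "inj_on \<theta>2 F2"
    using 1(1) 2(1) by (auto simp: approximate_matching_def mon_def)
  have \<theta>2: "\<theta>2 (\<theta>1 f) = f" if "f \<in> F1" for f using 2(2) that inj1 by simp
  have F1im: "f \<in> \<theta>2 ` F2" "inv_into F2 \<theta>2 f = \<theta>1 f" if "f \<in> F1" for f
  proof -
    have 3: "\<theta>1 f \<in> F2" using F2(3) that by blast
    show "f \<in> \<theta>2 ` F2" using 3 \<theta>2[OF that] by (metis image_eqI)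
    show "inv_into F2 \<theta>2 f = \<theta>1 f" using inv_into_f_f[OF inj2 3] \<theta>2[OF that] by simp
  qed
  have move: "\<exists>q\<in>prod.swap ` R2. dist (fst p) (fst q) < \<epsilon> \<and> snd q = snd p" if p: "p \<in> R1" for p
  proof -
    have "prod.swap p \<in> prod.swap ` R1" using p by blast
    from bspec[OF 2(4) this] obtain q where q: "q \<in> R2" "fst q = snd p" "dist (fst p) (snd q) < \<epsilon>" by auto
    then show ?thesis by (intro bexI[of _ "prod.swap q"]) auto
  qed
  show ?thesis
  proof (intro exI conjI ballI)
    show "approximate_matching G \<alpha> \<beta> \<delta> (\<theta>2 ` F2) (inv_into F2 \<theta>2) (prod.swap ` R2)" by (rule M2)
    show "F \<subseteq> \<theta>2 ` F2" "g \<in> \<theta>2 ` F2" using F1im(1) F1(3,4) by auto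
    show "inv_into F2 \<theta>2 f = \<theta> f" if "f \<in> F" for f using F1im(2)[of f] that F1(3) 1(2) by auto
    show "g \<in> inv_into F2 \<theta>2 ` \<theta>2 ` F2" using F2(4) inj2 by (simp add: image_image)
    show "\<exists>q\<in>prod.swap ` R2. dist (fst p) (fst q) < \<epsilon> \<and> dist (snd p) (snd q) < \<epsilon>" if "p \<in> R" for p
    proof -
      obtain q where q: "q \<in> R1" "fst q = fst p" "dist (snd p) (snd q) < \<epsilon>" using 1(4) \<open>p \<in> R\<close> by blast
      obtain q' where q': "q' \<in> prod.swap ` R2" "dist (fst q) (fst q') < \<epsilon>" "snd q' = snd q"
        using move[OF q(1)] by blast
      show ?thesis by (rule bexI[OF _ q'(1)]) (use q q' in auto)
    qed
    show "\<exists>q\<in>prod.swap ` R2. dist x (fst q) < \<epsilon>" if "x \<in> X" for x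
    proof -
      obtain q where "q \<in> R1" "fst q = x" using 1(3) \<open>x \<in> X\<close> by blast
      then show ?thesis using move[of q] by auto
    qed
    show "\<exists>q\<in>prod.swap ` R2. dist x (snd q) < \<epsilon>" if "x \<in> X" for x
    proof -
      obtain q where "q \<in> R2" "fst q = x" using 2(3) \<open>x \<in> X\<close> by blast
      then show ?thesis using pos by (intro bexI[of _ "prod.swap q"]) auto
    qed
  qed
qed

lemma geometric_chain_limit:
  fixes u :: "nat \<Rightarrow> 'u::metric_space"
  assumes "complete (UNIV :: 'u set)" "\<And>k. dist (u k) (u (Suc k)) < c * (1 / 2) ^ k"
  shows "\<exists>x. u \<longlonglongrightarrow> x \<and> dist (u 0) x \<le> 2 * c"
proof -
  have tail: "dist (u k) (u (k + j)) \<le> 2 * c * (1 / 2) ^ k * (1 - (1 / 2) ^ j)" for k j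
  proof (induction j)
    case (Suc j)
    have "dist (u k) (u (k + Suc j)) \<le> dist (u k) (u (k + j)) + dist (u (k + j)) (u (Suc (k + j)))"
      by (simp add: dist_triangle)
    also have "\<dots> \<le> 2 * c * (1 / 2) ^ k * (1 - (1 / 2) ^ j) + c * (1 / 2) ^ (k + j)"
      using Suc assms(2)[of "k + j"] by linarith
    also have "\<dots> = 2 * c * (1 / 2) ^ k * (1 - (1 / 2) ^ Suc j)"
      by (simp add: power_add algebra_simps)
    finally show ?case .
  qed simp
  have "0 < c" using le_less_trans[OF zero_le_dist assms(2)[of 0]] by simp
  have le: "dist (u k) (u (k + j)) \<le> 2 * c * (1 / 2) ^ k" for k j
  proof -
    have "2 * c * (1 / 2) ^ k * (1 - (1 / 2) ^ j) \<le> 2 * c * (1 / 2) ^ k * 1"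
      using \<open>0 < c\<close> by (intro mult_left_mono) auto
    then show ?thesis using tail[of k j] by linarith
  qed
  have "Cauchy u"
  proof (rule metric_CauchyI)
    fix e :: real assume "0 < e"
    then obtain M where M: "(1 / 2) ^ M < e / (4 * c)"
      using real_arch_pow_inv[of "e / (4 * c)" "1 / 2"] \<open>0 < c\<close> by auto
    have "dist (u a) (u b) < e" if "a \<ge> M" "b \<ge> M" for a b
    proof -
      have "dist (u M) (u a) \<le> 2 * c * (1 / 2) ^ M" "dist (u M) (u b) \<le> 2 * c * (1 / 2) ^ M"
        using le[of M "a - M"] le[of M "b - M"] that by simp_all
      moreover have "4 * c * (1 / 2) ^ M < e" using M \<open>0 < c\<close> by (simp add: field_simps)
      ultimately show ?thesis using dist_triangle3[of "u a" "u b" "u M"] by linarith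
    qed
    then show "\<exists>M. \<forall>m\<ge>M. \<forall>n\<ge>M. dist (u m) (u n) < e" by blast
  qed
  then obtain x where x: "u \<longlonglongrightarrow> x" using assms(1) by (auto simp: complete_def)
  have "(\<lambda>n. dist (u 0) (u n)) \<longlonglongrightarrow> dist (u 0) x" using x by (intro tendsto_dist) auto
  moreover have "dist (u 0) (u n) \<le> 2 * c" for n using le[of 0 n] by simp
  ultimately have "dist (u 0) x \<le> 2 * c" by (intro LIMSEQ_le_const2) auto
  then show ?thesis using x by blast
qed

text \<open>
  At stage \<open>n\<close> the matched points move by less than \<open>2\<^sup>-\<^sup>n\<close>, so every matched pair has a limit. The
  limits form an isometric and equivariant relation with dense domain and range, whose closure is
  the graph of the required isometry.
\<close>

lemma generic_actions_conjugate:
  fixes G (structure) and \<alpha> \<beta> :: "'g \<Rightarrow> 'u::metric_space \<Rightarrow> 'u"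
  assumes lf: "locally_finite_group G" and cnt: "countable (carrier G)"
    and compl: "complete (UNIV :: 'u set)" and Q: "closure Q = UNIV" "countable Q"
    and \<alpha>: "\<alpha> \<in> generic_actions G Q" and \<beta>: "\<beta> \<in> generic_actions G Q"
  shows "\<exists>\<phi> \<in> carrier isometry_group. \<exists>\<theta>. \<theta> ` carrier G = carrier G \<and>
    (\<forall>g\<in>carrier G. \<forall>x. \<phi> (\<alpha> g x) = \<beta> (\<theta> g) (\<phi> x))"
proof -
  interpret group G using lf by (simp add: locally_finite_group_def)
  have h: "\<alpha> \<in> hom G isometry_group" "\<beta> \<in> hom G isometry_group"
    using \<alpha> \<beta> by (auto simp: generic_actions_def topspace_hom_topology)
  note A = hom_isometryD[OF is_group h(1)] and B = hom_isometryD[OF is_group h(2)]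
  have Qne: "Q \<noteq> {}" using Q(1) by auto
  define X where "X n = from_nat_into Q ` {..n}" for n
  define \<epsilon> where "\<epsilon> n = (1 / 2 :: real) ^ n" for n
  have \<epsilon>: "0 < \<epsilon> n" for n by (simp add: \<epsilon>_def)
  define ok where "ok n s = approximate_matching G \<alpha> \<beta> (\<epsilon> n) (fst s) (fst (snd s)) (snd (snd s))" for n s
  define next_ok where "next_ok n s s' \<longleftrightarrow> fst s \<subseteq> fst s' \<and> (\<forall>f\<in>fst s. fst (snd s') f = fst (snd s) f) \<and>
    from_nat_into (carrier G) n \<in> fst s' \<and> from_nat_into (carrier G) n \<in> fst (snd s') ` fst s' \<and>
    (\<forall>p\<in>snd (snd s). \<exists>q\<in>snd (snd s'). dist (fst p) (fst q) < \<epsilon> n \<and> dist (snd p) (snd q) < \<epsilon> n) \<and>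
    (\<forall>x\<in>X n. \<exists>q\<in>snd (snd s'). dist x (fst q) < \<epsilon> n) \<and>
    (\<forall>x\<in>X n. \<exists>q\<in>snd (snd s'). dist x (snd q) < \<epsilon> n)"
    for n and s s' :: "'g set \<times> ('g \<Rightarrow> 'g) \<times> ('u \<times> 'u) set"
  have gC: "from_nat_into (carrier G) n \<in> carrier G" for n
    using from_nat_into[of "carrier G" n] one_closed by blast
  have "\<exists>s. \<forall>n. ok n (s n) \<and> next_ok n (s n) (s (Suc n))"
  proof (rule dependent_nat_choice)
    have "approximate_matching G \<alpha> \<beta> (\<epsilon> 0) {\<one>} id {}"
      using triv_subgroup by (auto simp: approximate_matching_def mon_def hom_def)
    then show "\<exists>s. ok 0 s" by (intro exI[of _ "({\<one>}, id, {})"]) (simp add: ok_def)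
    fix s n assume "ok n s"
    then have M: "approximate_matching G \<alpha> \<beta> (\<epsilon> n) (fst s) (fst (snd s)) (snd (snd s))" by (simp add: ok_def)
    have "finite (X n)" by (simp add: X_def)
    from approximate_matching_step[OF lf Q(1) \<alpha> \<beta> M \<epsilon> \<epsilon>[of "Suc n"] gC[of n] this]
    obtain F' \<theta>' R' where "approximate_matching G \<alpha> \<beta> (\<epsilon> (Suc n)) F' \<theta>' R'" "next_ok n s (F', \<theta>', R')"
      unfolding next_ok_def fst_conv snd_conv by (elim exE) blast
    then show "\<exists>s'. ok (Suc n) s' \<and> next_ok n s s'"
      by (intro exI[of _ "(F', \<theta>', R')"]) (simp add: ok_def)
  qed
  then obtain s where s: "\<forall>n. ok n (s n) \<and> next_ok n (s n) (s (Suc n))" by (rule exE)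
  define F \<theta>n R where "F = (\<lambda>n. fst (s n))" and "\<theta>n = (\<lambda>n. fst (snd (s n)))" and "R = (\<lambda>n. snd (snd (s n)))"
  have M: "approximate_matching G \<alpha> \<beta> (\<epsilon> n) (F n) (\<theta>n n) (R n)" for n
    using s by (simp add: ok_def F_def \<theta>n_def R_def)
  have nx: "next_ok n (s n) (s (Suc n))" for n using s by simp
  have F_Suc: "F n \<subseteq> F (Suc n)" "\<And>f. f \<in> F n \<Longrightarrow> \<theta>n (Suc n) f = \<theta>n n f"
     "from_nat_into (carrier G) n \<in> F (Suc n)" "from_nat_into (carrier G) n \<in> \<theta>n (Suc n) ` F (Suc n)" for n
    using nx[of n] by (simp_all add: next_ok_def F_def \<theta>n_def)
  have R_Suc: "\<exists>q\<in>R (Suc n). dist (fst p) (fst q) < \<epsilon> n \<and> dist (snd p) (snd q) < \<epsilon> n" if "p \<in> R n" for n p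
    using nx[of n] that by (simp add: next_ok_def R_def)
  have R_dense: "\<exists>q\<in>R (Suc n). dist x (fst q) < \<epsilon> n" "\<exists>q\<in>R (Suc n). dist x (snd q) < \<epsilon> n" if "x \<in> X n" for n x
    using nx[of n] that by (simp_all add: next_ok_def R_def)
  have F_mono: "F m \<subseteq> F n" if "m \<le> n" for m n
    by (rule lift_Suc_mono_le[where f = F, OF F_Suc(1) that])
  have \<theta>_stable: "\<theta>n n f = \<theta>n m f" if "m \<le> n" "f \<in> F m" for m n f
    using that
  proof (induction n rule: dec_induct)
    case (step n)
    then show ?case using F_Suc(2)[of f n] F_mono[of m n] by auto
  qed simp
  have F_all: "\<exists>n. g \<in> F n" if "g \<in> carrier G" for g
    using from_nat_into_surj[OF cnt that] F_Suc(3) by metis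
  define \<theta> where "\<theta> g = \<theta>n (LEAST n. g \<in> F n) g" for g
  have \<theta>: "\<theta> g = \<theta>n n g" if "g \<in> F n" for g n
    unfolding \<theta>_def using that \<theta>_stable[of "LEAST n. g \<in> F n" n g] by (metis LeastI Least_le)
  have MF: "subgroup (F n) G" "\<theta>n n \<in> mon (G\<lparr>carrier := F n\<rparr>) G" for n
    using M[of n] by (auto simp: approximate_matching_def)
  have \<theta>C: "\<theta>n n g \<in> carrier G" if "g \<in> F n" for g n
    using MF(2)[of n] that by (auto simp: mon_def hom_def)
  have \<theta>im: "\<theta> ` carrier G = carrier G"
  proof
    show "\<theta> ` carrier G \<subseteq> carrier G"
      using F_all \<theta> \<theta>C by (metis image_subsetI)
    show "carrier G \<subseteq> \<theta> ` carrier G"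
    proof
      fix g assume "g \<in> carrier G"
      then obtain n where "from_nat_into (carrier G) n = g" using from_nat_into_surj[OF cnt] by blast
      then obtain f where f: "f \<in> F (Suc n)" "g = \<theta>n (Suc n) f" using F_Suc(4)[of n] by auto
      then have "\<theta> f = g" "f \<in> carrier G" using \<theta> subgroup.mem_carrier[OF MF(1)] by auto
      then show "g \<in> \<theta> ` carrier G" by blast
    qed
  qed
  have \<theta>one: "\<theta> \<one> = \<one>"
  proof -
    have 1: "\<one> \<in> F 0" using subgroup.one_closed[OF MF(1)] .
    have "\<theta>n 0 \<one> \<otimes> \<theta>n 0 \<one> = \<theta>n 0 \<one>"
      using MF(2)[of 0] 1 by (auto simp: mon_def hom_def) (metis l_one one_closed)
    then show ?thesis using \<theta>[OF 1] \<theta>C[OF 1] by simp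
  qed
  define L where "L = {(x, y). \<exists>N u. (\<forall>k. u k \<in> R (N + k)) \<and> (\<lambda>k. fst (u k)) \<longlonglongrightarrow> x \<and> (\<lambda>k. snd (u k)) \<longlonglongrightarrow> y}"
  have L_equi: "dist x (\<alpha> g x') = dist y (\<beta> (\<theta> g) y')"
    if xy: "(x, y) \<in> L" and xy': "(x', y') \<in> L" and g: "g \<in> carrier G" for x y x' y' g
  proof -
    obtain N u where u: "\<forall>k. u k \<in> R (N + k)" "(\<lambda>k. fst (u k)) \<longlonglongrightarrow> x" "(\<lambda>k. snd (u k)) \<longlonglongrightarrow> y"
      using xy unfolding L_def by blast
    obtain N' u' where u': "\<forall>k. u' k \<in> R (N' + k)" "(\<lambda>k. fst (u' k)) \<longlonglongrightarrow> x'" "(\<lambda>k. snd (u' k)) \<longlonglongrightarrow> y'"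
      using xy' unfolding L_def by blast
    obtain n0 where n0: "g \<in> F n0" using F_all[OF g] by blast
    define K where "K = N + N' + n0"
    define v where "v k = u (k + (N' + n0))" for k
    define v' where "v' k = u' (k + (N + n0))" for k
    have v: "v k \<in> R (K + k)" "v' k \<in> R (K + k)" for k
      using u(1)[rule_format, of "k + (N' + n0)"] u'(1)[rule_format, of "k + (N + n0)"]
      by (simp_all add: v_def v'_def K_def ac_simps)
    have lim: "(\<lambda>k. fst (v k)) \<longlonglongrightarrow> x" "(\<lambda>k. snd (v k)) \<longlonglongrightarrow> y" "(\<lambda>k. fst (v' k)) \<longlonglongrightarrow> x'" "(\<lambda>k. snd (v' k)) \<longlonglongrightarrow> y'"
      unfolding v_def v'_def using u(2,3) u'(2,3) by (auto intro: LIMSEQ_ignore_initial_segment)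
    have \<theta>g: "\<theta> g \<in> carrier G" using \<theta>im g by blast
    have "(\<lambda>k. \<alpha> g (fst (v' k))) \<longlonglongrightarrow> \<alpha> g x'"
      using lim(3) A(1)[OF g] by (simp add: tendsto_dist_iff[of _ "\<alpha> g x'"] tendsto_dist_iff[of _ x'])
    moreover have "(\<lambda>k. \<beta> (\<theta> g) (snd (v' k))) \<longlonglongrightarrow> \<beta> (\<theta> g) y'"
      using lim(4) B(1)[OF \<theta>g] by (simp add: tendsto_dist_iff[of _ "\<beta> (\<theta> g) y'"] tendsto_dist_iff[of _ y'])
    ultimately have "(\<lambda>k. dist (fst (v k)) (\<alpha> g (fst (v' k))) - dist (snd (v k)) (\<beta> (\<theta> g) (snd (v' k))))
        \<longlonglongrightarrow> dist x (\<alpha> g x') - dist y (\<beta> (\<theta> g) y')"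
      using lim by (intro tendsto_diff tendsto_dist)
    moreover have "(\<lambda>k. dist (fst (v k)) (\<alpha> g (fst (v' k))) - dist (snd (v k)) (\<beta> (\<theta> g) (snd (v' k)))) \<longlonglongrightarrow> 0"
    proof (rule Lim_null_comparison)
      have "\<bar>dist (fst (v k)) (\<alpha> g (fst (v' k))) - dist (snd (v k)) (\<beta> (\<theta> g) (snd (v' k)))\<bar> \<le> \<epsilon> (K + k)" for k
      proof -
        have "g \<in> F (K + k)" using n0 F_mono[of n0 "K + k"] by (auto simp: K_def)
        then show ?thesis
          using M[of "K + k"] v[of k] \<theta>[of g "K + k"] by (auto simp: approximate_matching_def intro: less_imp_le)
      qed
      then show "\<forall>\<^sub>F k in sequentially. norm (dist (fst (v k)) (\<alpha> g (fst (v' k))) - dist (snd (v k)) (\<beta> (\<theta> g) (snd (v' k)))) \<le> \<epsilon> (K + k)"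
        by simp
      show "(\<lambda>k. \<epsilon> (K + k)) \<longlonglongrightarrow> 0"
        unfolding \<epsilon>_def power_add by (intro tendsto_mult_right_zero LIMSEQ_power_zero) simp
    qed
    ultimately show ?thesis using LIMSEQ_unique by fastforce
  qed
  have chain: "\<exists>x y. (x, y) \<in> L \<and> dist (fst p) x \<le> 2 * \<epsilon> N \<and> dist (snd p) y \<le> 2 * \<epsilon> N" if p: "p \<in> R N" for p N
  proof -
    have "\<exists>u. \<forall>k. (u k \<in> R (N + k) \<and> (k = 0 \<longrightarrow> u k = p)) \<and>
        (dist (fst (u k)) (fst (u (Suc k))) < \<epsilon> (N + k) \<and> dist (snd (u k)) (snd (u (Suc k))) < \<epsilon> (N + k))"
    proof (rule dependent_nat_choice)
      show "\<exists>x. x \<in> R (N + 0) \<and> (0 = 0 \<longrightarrow> x = p)" using p by (intro exI[of _ p]) simp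
      fix x :: "'u \<times> 'u" and n :: nat assume "x \<in> R (N + n) \<and> (n = 0 \<longrightarrow> x = p)"
      then obtain y where "y \<in> R (Suc (N + n))" "dist (fst x) (fst y) < \<epsilon> (N + n)" "dist (snd x) (snd y) < \<epsilon> (N + n)"
        using R_Suc[of x "N + n"] by blast
      then show "\<exists>y. (y \<in> R (N + Suc n) \<and> (Suc n = 0 \<longrightarrow> y = p)) \<and>
          dist (fst x) (fst y) < \<epsilon> (N + n) \<and> dist (snd x) (snd y) < \<epsilon> (N + n)"
        by (intro exI[of _ y]) simp
    qed
    then obtain u where u: "\<forall>k. (u k \<in> R (N + k) \<and> (k = 0 \<longrightarrow> u k = p)) \<and>
        (dist (fst (u k)) (fst (u (Suc k))) < \<epsilon> (N + k) \<and> dist (snd (u k)) (snd (u (Suc k))) < \<epsilon> (N + k))"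
      by (rule exE)
    have e: "\<epsilon> (N + k) = \<epsilon> N * (1 / 2) ^ k" for k by (simp add: \<epsilon>_def power_add)
    have u0: "u 0 = p" and uR: "\<forall>k. u k \<in> R (N + k)"
      and d: "\<And>k. dist (fst (u k)) (fst (u (Suc k))) < \<epsilon> N * (1 / 2) ^ k"
        "\<And>k. dist (snd (u k)) (snd (u (Suc k))) < \<epsilon> N * (1 / 2) ^ k"
      using u by (simp_all add: e)
    obtain x where x: "(\<lambda>k. fst (u k)) \<longlonglongrightarrow> x" "dist (fst (u 0)) x \<le> 2 * \<epsilon> N"
      using geometric_chain_limit[OF compl, of "\<lambda>k. fst (u k)" "\<epsilon> N"] d(1) by blast
    obtain y where y: "(\<lambda>k. snd (u k)) \<longlonglongrightarrow> y" "dist (snd (u 0)) y \<le> 2 * \<epsilon> N"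
      using geometric_chain_limit[OF compl, of "\<lambda>k. snd (u k)" "\<epsilon> N"] d(2) by blast
    have "(x, y) \<in> L" unfolding L_def using uR x(1) y(1) by blast
    then show ?thesis using x y u0 by blast
  qed
  have dense: "z \<in> closure (Domain L)" "z \<in> closure (Range L)" for z
  proof -
    have "\<exists>x y. (x, y) \<in> L \<and> dist x z < e" "\<exists>x y. (x, y) \<in> L \<and> dist y z < e" if e: "0 < e" for e
    proof -
      have "\<forall>e>0. \<exists>u\<in>Q. dist u z < e" using Q(1) closure_approachable[of z Q] by blast
      moreover have "0 < e / 4" using e by simp
      ultimately obtain q where q: "q \<in> Q" "dist q z < e / 4" by blast
      obtain j where j: "from_nat_into Q j = q" using from_nat_into_surj[OF Q(2) q(1)] by blast
      obtain M where M: "(1 / 2) ^ M < e / 8" using real_arch_pow_inv[of "e / 8" "1 / 2"] e by auto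
      define n where "n = max j M"
      have qX: "q \<in> X n" using j by (auto simp: X_def n_def)
      have "\<epsilon> n \<le> (1 / 2) ^ M" unfolding \<epsilon>_def by (rule power_decreasing) (auto simp: n_def)
      then have \<epsilon>n: "\<epsilon> n < e / 8" using M by simp
      have \<epsilon>S: "\<epsilon> (Suc n) \<le> \<epsilon> n" by (simp add: \<epsilon>_def)
      obtain p where p: "p \<in> R (Suc n)" "dist q (fst p) < \<epsilon> n" using R_dense(1)[OF qX] by blast
      obtain x y where xy: "(x, y) \<in> L" "dist (fst p) x \<le> 2 * \<epsilon> (Suc n)" using chain[OF p(1)] by blast
      have "dist x z < e"
        using dist_triangle[of x z q] dist_triangle[of x q "fst p"] xy(2) p(2) q(2) \<epsilon>n \<epsilon>S e
        by (simp add: dist_commute)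
      then show "\<exists>x y. (x, y) \<in> L \<and> dist x z < e" using xy(1) by blast
      obtain p' where p': "p' \<in> R (Suc n)" "dist q (snd p') < \<epsilon> n" using R_dense(2)[OF qX] by blast
      obtain x' y' where xy': "(x', y') \<in> L" "dist (snd p') y' \<le> 2 * \<epsilon> (Suc n)" using chain[OF p'(1)] by blast
      have "dist y' z < e"
        using dist_triangle[of y' z q] dist_triangle[of y' q "snd p'"] xy'(2) p'(2) q(2) \<epsilon>n \<epsilon>S e
        by (simp add: dist_commute)
      then show "\<exists>x y. (x, y) \<in> L \<and> dist y z < e" using xy'(1) by blast
    qed
    then show "z \<in> closure (Domain L)" "z \<in> closure (Range L)"
      unfolding closure_approachable by (meson DomainI RangeI)+
  qed
  have "\<exists>\<phi> \<in> carrier isometry_group. \<forall>(x, y) \<in> L. \<phi> x = y"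
  proof (rule isometric_relation_extension[OF compl])
    show "dist x x' = dist y y'" if "(x, y) \<in> L" "(x', y') \<in> L" for x y x' y'
      using L_equi[OF that one_closed] by (simp add: \<theta>one A(3) B(3))
  qed (use dense in auto)
  then obtain \<phi> where \<phi>: "\<phi> \<in> carrier isometry_group" "\<forall>(x, y) \<in> L. \<phi> x = y" by blast
  have \<phi>L: "\<phi> x = y" if "(x, y) \<in> L" for x y using bspec[OF \<phi>(2) that] by simp
  have \<phi>iso: "isometric_on UNIV \<phi>" using \<phi>(1) by (simp add: isometry_group_def)
  have domL: "closure (Domain L) = UNIV" using dense by auto
  have "\<phi> (\<alpha> g x) = \<beta> (\<theta> g) (\<phi> x)" if g: "g \<in> carrier G" for g x
  proof -
    have \<theta>g: "\<theta> g \<in> carrier G" using \<theta>im g by blast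
    have "(\<lambda>x. \<phi> (\<alpha> g x)) = (\<lambda>x. \<beta> (\<theta> g) (\<phi> x))"
    proof (rule isometries_eq_on_dense[OF _ _ domL])
      show "isometric_on UNIV (\<lambda>x. \<phi> (\<alpha> g x))" "isometric_on UNIV (\<lambda>x. \<beta> (\<theta> g) (\<phi> x))"
        using \<phi>iso A(1)[OF g] B(1)[OF \<theta>g] by (simp_all add: isometric_on_def)
      fix x' assume "x' \<in> Domain L"
      then obtain y' where xy': "(x', y') \<in> L" by blast
      \<comment> \<open>the equation extends from \<open>x\<close> in the domain of \<open>L\<close> to \<open>x = \<alpha> g x'\<close>, where the left side is \<open>0\<close>\<close>
      have "closed {x. dist x (\<alpha> g x') = dist (\<phi> x) (\<beta> (\<theta> g) (\<phi> x'))}"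
        using isometry_continuous[OF \<phi>iso] by (intro closed_Collect_eq continuous_intros)
      moreover have "Domain L \<subseteq> {x. dist x (\<alpha> g x') = dist (\<phi> x) (\<beta> (\<theta> g) (\<phi> x'))}"
      proof
        fix x assume "x \<in> Domain L"
        then obtain y where xy: "(x, y) \<in> L" by blast
        then show "x \<in> {x. dist x (\<alpha> g x') = dist (\<phi> x) (\<beta> (\<theta> g) (\<phi> x'))}"
          using L_equi[OF xy xy' g] \<phi>L[OF xy] \<phi>L[OF xy'] by simp
      qed
      ultimately have "closure (Domain L) \<subseteq> {x. dist x (\<alpha> g x') = dist (\<phi> x) (\<beta> (\<theta> g) (\<phi> x'))}"
        by (rule closure_minimal[rotated])
      then have "dist (\<alpha> g x') (\<alpha> g x') = dist (\<phi> (\<alpha> g x')) (\<beta> (\<theta> g) (\<phi> x'))"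
        using domL by blast
      then show "\<phi> (\<alpha> g x') = \<beta> (\<theta> g) (\<phi> x')" by simp
    qed
    then show ?thesis by (rule fun_cong)
  qed
  then show ?thesis using \<phi>(1) \<theta>im by blast
qed

section \<open>The closure of the image as a Polish group\<close>

lemma isometry_groupD:
  assumes "f \<in> carrier (isometry_group :: ('u::metric_space \<Rightarrow> 'u) monoid)"
  shows "dist (f x) (f y) = dist x y" "f (inv_into UNIV f x) = x" "inv_into UNIV f (f x) = x"
    "inv_into UNIV f \<in> carrier isometry_group" "inv\<^bsub>isometry_group\<^esub> f = inv_into UNIV f"
proof -
  have s: "surj f" and d: "\<And>x y. dist (f x) (f y) = dist x y"
    using assms by (auto simp: isometry_group_def isometric_on_def)
  have i: "inj f" by (rule injI) (metis d dist_eq_0_iff)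
  show "dist (f x) (f y) = dist x y" by (rule d)
  show 1: "f (inv_into UNIV f x) = x" for x using s by (simp add: surj_f_inv_f)
  show 2: "inv_into UNIV f (f x) = x" for x using i by simp
  have "dist (inv_into UNIV f x) (inv_into UNIV f y) = dist x y" for x y
    using d[of "inv_into UNIV f x" "inv_into UNIV f y"] by (simp add: 1)
  moreover have "surj (inv_into UNIV f)" by (metis 2 surjI)
  ultimately show 3: "inv_into UNIV f \<in> carrier isometry_group"
    by (simp add: isometry_group_def isometric_on_def)
  show "inv\<^bsub>isometry_group\<^esub> f = inv_into UNIV f"
    by (rule group.inv_equality[OF isometry_group_is_group _ assms 3])
      (use 2 in \<open>auto simp: isometry_group_def fun_eq_iff\<close>)
qed

lemma topological_group_isometries:
  "topological_group (isometry_group :: ('u::metric_space \<Rightarrow> 'u) monoid) isometry_topology"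
proof -
  let ?G = "isometry_group :: ('u \<Rightarrow> 'u) monoid" and ?T = "isometry_topology :: ('u \<Rightarrow> 'u) topology"
  have "continuous_map (prod_topology ?T ?T) ?T (\<lambda>(f, g). f \<otimes>\<^bsub>?G\<^esub> g)"
    unfolding continuous_map_isometry_topology
  proof (intro conjI ballI allI)
    show "(case p of (f, g) \<Rightarrow> f \<otimes>\<^bsub>?G\<^esub> g) \<in> carrier ?G" if "p \<in> topspace (prod_topology ?T ?T)" for p
      using that monoid.m_closed[OF group.is_monoid[OF isometry_group_is_group]]
      by (auto simp: topspace_isometry_topology)
    fix z
    show "continuous_map (prod_topology ?T ?T) euclidean (\<lambda>p. (case p of (f, g) \<Rightarrow> f \<otimes>\<^bsub>?G\<^esub> g) z)"
    proof (rule continuous_map_by_dist_bound)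
      fix p0 e assume p0: "p0 \<in> topspace (prod_topology ?T ?T)" "0 < (e::real)"
      obtain f0 g0 where fg: "p0 = (f0, g0)" by fastforce
      let ?r = "\<lambda>p. dist (snd p z) (g0 z) + dist (fst p (g0 z)) (f0 (g0 z))"
      have "continuous_map (prod_topology ?T ?T) euclideanreal ?r"
        by (intro continuous_map_add continuous_map_dist_euclidean
            continuous_map_compose[OF continuous_map_snd continuous_map_eval, unfolded comp_def]
            continuous_map_compose[OF continuous_map_fst continuous_map_eval, unfolded comp_def]) auto
      moreover have "dist ((case p of (f, g) \<Rightarrow> f \<otimes>\<^bsub>?G\<^esub> g) z) ((case p0 of (f, g) \<Rightarrow> f \<otimes>\<^bsub>?G\<^esub> g) z) \<le> ?r p"
        if pT: "p \<in> topspace (prod_topology ?T ?T)" for p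
      proof -
        obtain f g where p: "p = (f, g)" "f \<in> carrier ?G" using pT by (auto simp: topspace_isometry_topology)
        have "dist (f (g z)) (f0 (g0 z)) \<le> dist (f (g z)) (f (g0 z)) + dist (f (g0 z)) (f0 (g0 z))"
          by (rule dist_triangle)
        then show ?thesis using isometry_groupD(1)[OF p(2)] by (simp add: p fg isometry_group_def)
      qed
      ultimately show "\<exists>r. continuous_map (prod_topology ?T ?T) euclideanreal r \<and> r p0 < e \<and>
          (\<forall>p\<in>topspace (prod_topology ?T ?T). dist ((case p of (f, g) \<Rightarrow> f \<otimes>\<^bsub>?G\<^esub> g) z) ((case p0 of (f, g) \<Rightarrow> f \<otimes>\<^bsub>?G\<^esub> g) z) \<le> r p)"
        using p0(2) by (intro exI[of _ ?r]) (simp add: fg)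
    qed
  qed
  moreover have "continuous_map ?T ?T (\<lambda>f. inv\<^bsub>?G\<^esub> f)"
    unfolding continuous_map_isometry_topology
  proof (intro conjI ballI allI)
    show "inv\<^bsub>?G\<^esub> f \<in> carrier ?G" if "f \<in> topspace ?T" for f
      using that group.inv_closed[OF isometry_group_is_group] by (auto simp: topspace_isometry_topology)
    fix z
    show "continuous_map ?T euclidean (\<lambda>f. (inv\<^bsub>?G\<^esub> f) z)"
    proof (rule continuous_map_by_dist_bound)
      fix f0 e assume f0: "f0 \<in> topspace ?T" "0 < (e::real)"
      then have f0C: "f0 \<in> carrier ?G" by (simp add: topspace_isometry_topology)
      let ?w = "inv_into UNIV f0 z"
      have "continuous_map ?T euclideanreal (\<lambda>f. dist z (f ?w))"
        by (intro continuous_map_dist_euclidean continuous_map_eval) auto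
      moreover have "dist ((inv\<^bsub>?G\<^esub> f) z) ((inv\<^bsub>?G\<^esub> f0) z) \<le> dist z (f ?w)" if "f \<in> topspace ?T" for f
      proof -
        have f: "f \<in> carrier ?G" using that by (simp add: topspace_isometry_topology)
        have "dist (inv_into UNIV f z) ?w = dist z (f ?w)"
          using isometry_groupD(1)[OF f, of "inv_into UNIV f z" ?w] isometry_groupD(2)[OF f] by simp
        then show ?thesis using isometry_groupD(5)[OF f] isometry_groupD(5)[OF f0C] by simp
      qed
      moreover have "dist z (f0 ?w) < e" using f0(2) isometry_groupD(2)[OF f0C] by simp
      ultimately show "\<exists>r. continuous_map ?T euclideanreal r \<and> r f0 < e \<and>
          (\<forall>f\<in>topspace ?T. dist ((inv\<^bsub>?G\<^esub> f) z) ((inv\<^bsub>?G\<^esub> f0) z) \<le> r f)" by blast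
    qed
  qed
  ultimately show ?thesis
    by (simp add: topological_group_def isometry_group_is_group topspace_isometry_topology)
qed

lemma topological_group_subgroup:
  assumes G: "topological_group G T" and H: "subgroup H G"
  shows "topological_group (G\<lparr>carrier := H\<rparr>) (subtopology T H)"
proof -
  have gr: "group G" and T: "topspace T = carrier G"
    and mult: "continuous_map (prod_topology T T) T (\<lambda>(x, y). x \<otimes>\<^bsub>G\<^esub> y)"
    and inv: "continuous_map T T (\<lambda>x. inv\<^bsub>G\<^esub> x)"
    using G by (auto simp: topological_group_def)
  have HG: "H \<subseteq> carrier G" using subgroup.subset[OF H] .
  let ?T = "subtopology T H"
  have "continuous_map (prod_topology ?T ?T) ?T (\<lambda>(x, y). x \<otimes>\<^bsub>G\<^esub> y)"
    unfolding continuous_map_in_subtopology prod_topology_subtopology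
    using subgroup.m_closed[OF H] mult
    by (auto intro!: continuous_map_from_subtopology)
  moreover have "continuous_map ?T ?T (\<lambda>x. inv\<^bsub>G\<lparr>carrier := H\<rparr>\<^esub> x)"
  proof (rule continuous_map_eq)
    show "continuous_map ?T ?T (\<lambda>x. inv\<^bsub>G\<^esub> x)"
      unfolding continuous_map_in_subtopology
      using subgroup.m_inv_closed[OF H] inv by (auto intro!: continuous_map_from_subtopology)
    show "inv\<^bsub>G\<^esub> x = inv\<^bsub>G\<lparr>carrier := H\<rparr>\<^esub> x" if "x \<in> topspace ?T" for x
      using group.m_inv_consistent[OF gr H] that by auto
  qed
  ultimately show ?thesis
    using subgroup.subgroup_is_group[OF H gr] HG T by (auto simp: topological_group_def)
qed

text \<open>
  An isometry is determined by its values and those of its inverse on a dense sequence \<open>q\<close>. Pairs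
  of sequences arise in this way exactly if the relation \<open>rel a\<close> between the members of \<open>q\<close> and the
  assigned points is isometric, by \<open>isometric_relation_extension\<close>. This is a closed condition.
\<close>

lemma completely_metrizable_isometry_topology:
  assumes compl: "complete (UNIV :: 'u::metric_space set)" and Q: "closure Q = (UNIV :: 'u set)" "countable Q"
  shows "completely_metrizable_space (isometry_topology :: ('u \<Rightarrow> 'u) topology)"
proof -
  let ?T = "isometry_topology :: ('u \<Rightarrow> 'u) topology"
  let ?P = "product_topology (\<lambda>_. euclidean :: 'u topology) (UNIV :: (nat + nat) set)"
  have Qne: "Q \<noteq> {}" using Q(1) by auto
  define q where "q = from_nat_into Q"
  have q: "range q = Q" unfolding q_def using range_from_nat_into[OF Qne Q(2)] .
  define \<Phi> :: "('u \<Rightarrow> 'u) \<Rightarrow> nat + nat \<Rightarrow> 'u" where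
    "\<Phi> f = (\<lambda>k. case k of Inl n \<Rightarrow> f (q n) | Inr n \<Rightarrow> (inv\<^bsub>isometry_group\<^esub> f) (q n))" for f
  define rel :: "(nat + nat \<Rightarrow> 'u) \<Rightarrow> nat + nat \<Rightarrow> 'u \<times> 'u" where
    "rel a k = (case k of Inl n \<Rightarrow> (q n, a (Inl n)) | Inr n \<Rightarrow> (a (Inr n), q n))" for a k
  define C where "C = {a. \<forall>k l. dist (fst (rel a k)) (fst (rel a l)) = dist (snd (rel a k)) (snd (rel a l))}"
  have ex: "\<exists>\<phi>. \<phi> \<in> carrier isometry_group \<and> (\<forall>k. \<phi> (fst (rel a k)) = snd (rel a k))" if "a \<in> C" for a
  proof -
    have "\<exists>\<phi> \<in> carrier isometry_group. \<forall>(x, y) \<in> range (rel a). \<phi> x = y"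
    proof (rule isometric_relation_extension[OF compl])
      show "dist x x' = dist y y'" if xy: "(x, y) \<in> range (rel a)" "(x', y') \<in> range (rel a)" for x y x' y'
      proof -
        obtain k l where kl: "(x, y) = rel a k" "(x', y') = rel a l" using xy by blast
        have "dist (fst (rel a k)) (fst (rel a l)) = dist (snd (rel a k)) (snd (rel a l))"
          using \<open>a \<in> C\<close> by (simp add: C_def)
        then show ?thesis unfolding kl[symmetric] by simp
      qed
      have "q n \<in> Domain (range (rel a))" "q n \<in> Range (range (rel a))" for n
      proof -
        have "rel a (Inl n) = (q n, a (Inl n))" "rel a (Inr n) = (a (Inr n), q n)" by (simp_all add: rel_def)
        then show "q n \<in> Domain (range (rel a))" "q n \<in> Range (range (rel a))"
          by (metis DomainI rangeI, metis RangeI rangeI)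
      qed
      then have "Q \<subseteq> Domain (range (rel a))" "Q \<subseteq> Range (range (rel a))" using q by auto
      then show "closure (Domain (range (rel a))) = UNIV" "closure (Range (range (rel a))) = UNIV"
        using closure_mono Q(1) by blast+
    qed
    then obtain \<phi> where "\<phi> \<in> carrier isometry_group" "\<forall>(x, y) \<in> range (rel a). \<phi> x = y" by blast
    then show ?thesis by (intro exI[of _ \<phi>]) (auto simp: case_prod_beta)
  qed
  define \<Psi> where "\<Psi> a = (SOME \<phi>. \<phi> \<in> carrier isometry_group \<and> (\<forall>k. \<phi> (fst (rel a k)) = snd (rel a k)))" for a
  have \<Psi>: "\<Psi> a \<in> carrier isometry_group" "\<Psi> a (fst (rel a k)) = snd (rel a k)" if "a \<in> C" for a k
    using someI_ex[OF ex[OF that]] by (auto simp: \<Psi>_def)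
  have inv: "(inv\<^bsub>isometry_group\<^esub> f) x = inv_into UNIV f x" if "f \<in> carrier isometry_group" for f and x :: 'u
    using isometry_groupD(5)[OF that] by simp
  have rel\<Phi>: "f (fst (rel (\<Phi> f) k)) = snd (rel (\<Phi> f) k)" if f: "f \<in> carrier isometry_group" for f k
    using isometry_groupD(2)[OF f] by (cases k) (auto simp: rel_def \<Phi>_def inv[OF f])
  have \<Phi>C: "\<Phi> f \<in> C" if f: "f \<in> carrier isometry_group" for f
    unfolding C_def using rel\<Phi>[OF f, symmetric] isometry_groupD(1)[OF f] by simp
  have \<Psi>\<Phi>: "\<Psi> (\<Phi> f) = f" if f: "f \<in> carrier isometry_group" for f
  proof (rule isometries_eq_on_dense[OF _ _ Q(1)])
    show "isometric_on UNIV (\<Psi> (\<Phi> f))" "isometric_on UNIV f"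
      using \<Psi>(1)[OF \<Phi>C[OF f]] f by (auto simp: isometry_group_def)
    fix x assume "x \<in> Q"
    then obtain n where n: "x = q n" using q by blast
    show "\<Psi> (\<Phi> f) x = f x"
      using \<Psi>(2)[OF \<Phi>C[OF f], of "Inl n"] by (simp add: n rel_def \<Phi>_def)
  qed
  have \<Phi>\<Psi>: "\<Phi> (\<Psi> a) = a" if a: "a \<in> C" for a
  proof
    fix k
    show "\<Phi> (\<Psi> a) k = a k"
      using \<Psi>(2)[OF a, of k] isometry_groupD(3)[OF \<Psi>(1)[OF a]]
      by (cases k) (auto simp: rel_def \<Phi>_def inv[OF \<Psi>(1)[OF a]], metis)
  qed
  have c\<Phi>: "continuous_map ?T ?P \<Phi>"
    unfolding continuous_map_componentwise_UNIV
  proof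
    fix k
    have 1: "continuous_map ?T euclidean (\<lambda>f. f z)" for z by (rule continuous_map_eval)
    have 2: "continuous_map ?T euclidean (\<lambda>f. (inv\<^bsub>isometry_group\<^esub> f) z)" for z
      using topological_group_isometries
      by (auto simp: topological_group_def continuous_map_isometry_topology)
    show "continuous_map ?T euclidean (\<lambda>f. \<Phi> f k)"
      using 1 2 by (cases k) (simp_all add: \<Phi>_def)
  qed
  have c\<Psi>: "continuous_map (subtopology ?P C) ?T \<Psi>"
    unfolding continuous_map_isometry_topology
  proof (intro conjI ballI allI)
    show "\<Psi> a \<in> carrier isometry_group" if "a \<in> topspace (subtopology ?P C)" for a using \<Psi>(1) that by auto
    fix z
    show "continuous_map (subtopology ?P C) euclidean (\<lambda>a. \<Psi> a z)"
    proof (rule continuous_map_by_dist_bound)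
      fix a0 e assume a0: "a0 \<in> topspace (subtopology ?P C)" "0 < (e::real)"
      have "\<forall>e>0. \<exists>u\<in>Q. dist u z < e" using Q(1) closure_approachable[of z Q] by blast
      then obtain u where "u \<in> Q" "dist u z < e / 2" using half_gt_zero[OF a0(2)] by blast
      then obtain n where n: "dist (q n) z < e / 2" using q by blast
      let ?r = "\<lambda>a. 2 * dist (q n) z + dist (a (Inl n)) (a0 (Inl n))"
      have "continuous_map (subtopology ?P C) euclideanreal ?r"
        by (intro continuous_map_add continuous_map_dist_euclidean continuous_map_from_subtopology
            continuous_map_product_projection) auto
      moreover have "dist (\<Psi> a z) (\<Psi> a0 z) \<le> ?r a" if "a \<in> topspace (subtopology ?P C)" for a
      proof -
        have aC: "a \<in> C" "a0 \<in> C" using that a0 by auto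
        have "dist (\<Psi> a (q n)) (\<Psi> a z) = dist (q n) z" "dist (\<Psi> a0 (q n)) (\<Psi> a0 z) = dist (q n) z"
          using isometry_groupD(1)[OF \<Psi>(1)] aC by blast+
        moreover have "\<Psi> a (q n) = a (Inl n)" "\<Psi> a0 (q n) = a0 (Inl n)"
          using \<Psi>(2)[OF aC(1), of "Inl n"] \<Psi>(2)[OF aC(2), of "Inl n"] by (simp_all add: rel_def)
        ultimately show ?thesis
          using dist_triangle[of "\<Psi> a z" "\<Psi> a0 z" "\<Psi> a (q n)"] dist_triangle[of "\<Psi> a (q n)" "\<Psi> a0 z" "\<Psi> a0 (q n)"]
          by (simp add: dist_commute)
      qed
      moreover have "?r a0 < e" using n by simp
      ultimately show "\<exists>r. continuous_map (subtopology ?P C) euclideanreal r \<and> r a0 < e \<and>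
         (\<forall>a\<in>topspace (subtopology ?P C). dist (\<Psi> a z) (\<Psi> a0 z) \<le> r a)" by (intro exI[of _ ?r]) blast
    qed
  qed
  have hom: "homeomorphic_maps ?T (subtopology ?P C) \<Phi> \<Psi>"
    unfolding homeomorphic_maps_def
    using c\<Phi> c\<Psi> \<Phi>C \<Psi>\<Phi> \<Phi>\<Psi> by (auto simp: continuous_map_in_subtopology topspace_isometry_topology)
  have "closedin ?P C"
  proof -
    have "C = (\<Inter>k. \<Inter>l. {a \<in> topspace ?P. dist (fst (rel a k)) (fst (rel a l)) - dist (snd (rel a k)) (snd (rel a l)) \<in> {0}})"
      by (auto simp: C_def)
    moreover have "closedin ?P {a \<in> topspace ?P. dist (fst (rel a k)) (fst (rel a l)) - dist (snd (rel a k)) (snd (rel a l)) \<in> {0}}" for k l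
    proof (rule closedin_continuous_map_preimage)
      have "continuous_map ?P euclidean (\<lambda>a. a k)" for k
        by (rule continuous_map_product_projection) simp
      then have "continuous_map ?P euclidean (\<lambda>a. fst (rel a k))" "continuous_map ?P euclidean (\<lambda>a. snd (rel a k))" for k
        by (cases k; simp add: rel_def)+
      then show "continuous_map ?P euclideanreal (\<lambda>a. dist (fst (rel a k)) (fst (rel a l)) - dist (snd (rel a k)) (snd (rel a l)))"
        by (intro continuous_map_diff continuous_map_dist_euclidean)
    qed simp
    ultimately show ?thesis by (auto intro!: closedin_INT)
  qed
  moreover have "completely_metrizable_space (euclidean :: 'u topology)"
    using Met_TC.completely_metrizable_space_mtopology[where 'a = 'u] compl by simp
  then have "completely_metrizable_space ?P"
    by (simp add: completely_metrizable_space_product_topology)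
  ultimately have "completely_metrizable_space (subtopology ?P C)"
    by (rule completely_metrizable_space_closedin[rotated])
  moreover have "?T homeomorphic_space (subtopology ?P C)"
    using hom unfolding homeomorphic_space_def by blast
  ultimately show ?thesis using homeomorphic_completely_metrizable_space by blast
qed

lemma image_closure_iff:
  fixes G (structure) and \<alpha> :: "'g \<Rightarrow> 'u::metric_space \<Rightarrow> 'u"
  assumes "\<alpha> \<in> hom G isometry_group"
  shows "f \<in> image_closure G \<alpha> \<longleftrightarrow> f \<in> carrier isometry_group \<and>
    (\<forall>Z \<eta>. finite Z \<and> 0 < \<eta> \<longrightarrow> (\<exists>g\<in>carrier G. \<forall>z\<in>Z. dist (\<alpha> g z) (f z) < \<eta>))"
proof (intro iffI conjI allI impI)
  assume f: "f \<in> image_closure G \<alpha>"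
  then have top: "f \<in> topspace isometry_topology"
    and cl: "\<And>T. f \<in> T \<Longrightarrow> openin isometry_topology T \<Longrightarrow> \<exists>y\<in>\<alpha> ` carrier G. y \<in> T"
    by (auto simp: image_closure_def in_closure_of)
  then show "f \<in> carrier isometry_group" by (simp add: topspace_isometry_topology)
  fix Z :: "'u set" and \<eta> :: real assume Z: "finite Z \<and> 0 < \<eta>"
  let ?T = "{h \<in> topspace isometry_topology. \<forall>z\<in>Z. dist (h z) (f z) < \<eta>}"
  have "openin isometry_topology ?T"
  proof (rule openin_finite_conditions)
    fix z
    have "continuous_map isometry_topology euclideanreal (\<lambda>h. dist (h z) (f z))"
      by (intro continuous_map_dist_euclidean continuous_map_eval) auto
    from openin_continuous_map_preimage[OF this, of "{..<\<eta>}"]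
    show "openin isometry_topology {h \<in> topspace isometry_topology. dist (h z) (f z) < \<eta>}" by simp
  qed (use Z in auto)
  moreover have "f \<in> ?T" using top Z by simp
  ultimately obtain h where "h \<in> \<alpha> ` carrier G" "h \<in> ?T" using cl[of ?T] by blast
  then show "\<exists>g\<in>carrier G. \<forall>z\<in>Z. dist (\<alpha> g z) (f z) < \<eta>" by blast
next
  assume f: "f \<in> carrier isometry_group \<and>
    (\<forall>Z \<eta>. finite Z \<and> 0 < \<eta> \<longrightarrow> (\<exists>g\<in>carrier G. \<forall>z\<in>Z. dist (\<alpha> g z) (f z) < \<eta>))"
  have "\<exists>y. y \<in> \<alpha> ` carrier G \<and> y \<in> T" if T: "f \<in> T" "openin isometry_topology T" for T
  proof -
    obtain Z \<eta> where Z: "finite Z" "0 < \<eta>"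
      "\<And>h. h \<in> carrier isometry_group \<Longrightarrow> (\<And>z. z \<in> Z \<Longrightarrow> dist (h z) (f z) < \<eta>) \<Longrightarrow> h \<in> T"
      using isometry_topology_neighbourhood[OF T(2,1)] by metis
    obtain g where g: "g \<in> carrier G" "\<forall>z\<in>Z. dist (\<alpha> g z) (f z) < \<eta>" using f Z(1,2) by blast
    have "\<alpha> g \<in> carrier isometry_group" using assms g by (auto simp: hom_def)
    then have "\<alpha> g \<in> T" using Z(3) g(2) by blast
    then show ?thesis using g by blast
  qed
  then show "f \<in> image_closure G \<alpha>"
    using f by (auto simp: image_closure_def in_closure_of topspace_isometry_topology)
qed

lemma subgroup_image_closure:
  fixes G (structure) and \<alpha> :: "'g \<Rightarrow> 'u::metric_space \<Rightarrow> 'u"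
  assumes "group G" and \<alpha>: "\<alpha> \<in> hom G isometry_group"
  shows "subgroup (image_closure G \<alpha>) isometry_group"
proof -
  interpret group G by fact
  interpret I: group "isometry_group :: ('u \<Rightarrow> 'u) monoid" by (rule isometry_group_is_group)
  note A = hom_isometryD[OF is_group \<alpha>] and cl = image_closure_iff[OF \<alpha>]
  show ?thesis
  proof (rule I.subgroupI)
    show "image_closure G \<alpha> \<subseteq> carrier isometry_group" using cl by blast
    have "id \<in> image_closure G \<alpha>"
      unfolding cl using I.one_closed A(3) by (auto simp: isometry_group_def intro!: bexI[of _ \<one>])
    then show "image_closure G \<alpha> \<noteq> {}" by blast
    fix f assume f: "f \<in> image_closure G \<alpha>"
    then have fC: "f \<in> carrier isometry_group" using cl by blast
    note fD = isometry_groupD[OF fC]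
    show "inv\<^bsub>isometry_group\<^esub> f \<in> image_closure G \<alpha>"
      unfolding cl fD(5)
    proof (intro conjI allI impI)
      show "inv_into UNIV f \<in> carrier isometry_group" by (rule fD(4))
      fix Z :: "'u set" and \<eta> :: real assume "finite Z \<and> 0 < \<eta>"
      then have "finite (inv_into UNIV f ` Z) \<and> 0 < \<eta>" by simp
      then obtain g where g: "g \<in> carrier G" "\<forall>z\<in>inv_into UNIV f ` Z. dist (\<alpha> g z) (f z) < \<eta>"
        using f unfolding cl by blast
      have "dist (\<alpha> (inv g) z) (inv_into UNIV f z) < \<eta>" if "z \<in> Z" for z
      proof -
        have "dist (\<alpha> g (inv_into UNIV f z)) z < \<eta>" using g(2) that fD(2) by auto
        moreover have "dist (\<alpha> (inv g) z) (inv_into UNIV f z) = dist z (\<alpha> g (inv_into UNIV f z))"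
          using A(1)[of g "\<alpha> (inv g) z" "inv_into UNIV f z"] A(4)[of "inv g" z] g(1) by simp
        ultimately show ?thesis by (simp add: dist_commute)
      qed
      then show "\<exists>g\<in>carrier G. \<forall>z\<in>Z. dist (\<alpha> g z) (inv_into UNIV f z) < \<eta>" using g(1) by blast
    qed
    fix h assume h: "h \<in> image_closure G \<alpha>"
    then have hC: "h \<in> carrier isometry_group" using cl by blast
    show "f \<otimes>\<^bsub>isometry_group\<^esub> h \<in> image_closure G \<alpha>"
      unfolding cl
    proof (intro conjI allI impI)
      show "f \<otimes>\<^bsub>isometry_group\<^esub> h \<in> carrier isometry_group" using fC hC by (rule I.m_closed)
      fix Z :: "'u set" and \<eta> :: real assume Z: "finite Z \<and> 0 < \<eta>"
      then have 1: "finite Z \<and> 0 < \<eta> / 2" "finite (h ` Z) \<and> 0 < \<eta> / 2" by auto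
      obtain g where g: "g \<in> carrier G" "\<forall>z\<in>Z. dist (\<alpha> g z) (h z) < \<eta> / 2" using h 1(1) unfolding cl by blast
      obtain k where k: "k \<in> carrier G" "\<forall>z\<in>h ` Z. dist (\<alpha> k z) (f z) < \<eta> / 2" using f 1(2) unfolding cl by blast
      have "dist (\<alpha> (k \<otimes> g) z) ((f \<otimes>\<^bsub>isometry_group\<^esub> h) z) < \<eta>" if "z \<in> Z" for z
      proof -
        have "dist (\<alpha> k (\<alpha> g z)) (\<alpha> k (h z)) < \<eta> / 2" using g(2) that A(1)[OF k(1)] by simp
        moreover have "dist (\<alpha> k (h z)) (f (h z)) < \<eta> / 2" using k(2) that by blast
        moreover have "dist (\<alpha> k (\<alpha> g z)) (f (h z)) \<le> dist (\<alpha> k (\<alpha> g z)) (\<alpha> k (h z)) + dist (\<alpha> k (h z)) (f (h z))"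
          by (rule dist_triangle)
        ultimately show ?thesis using A(2)[OF k(1) g(1)] by (simp add: isometry_group_def)
      qed
      then show "\<exists>g\<in>carrier G. \<forall>z\<in>Z. dist (\<alpha> g z) ((f \<otimes>\<^bsub>isometry_group\<^esub> h) z) < \<eta>"
        using g(1) k(1) by blast
    qed
  qed
qed

lemma polish_group_image_closure:
  fixes G (structure) and \<alpha> :: "'g \<Rightarrow> 'u::metric_space \<Rightarrow> 'u"
  assumes "group G" "countable (carrier G)" and \<alpha>: "\<alpha> \<in> hom G isometry_group"
    and compl: "complete (UNIV :: 'u set)" and Q: "closure Q = (UNIV :: 'u set)" "countable Q"
  shows "polish_group (isometry_group\<lparr>carrier := image_closure G \<alpha>\<rparr>) (subtopology isometry_topology (image_closure G \<alpha>))"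
proof -
  let ?C = "image_closure G \<alpha>" and ?T = "isometry_topology :: ('u \<Rightarrow> 'u) topology"
  have sub: "\<alpha> ` carrier G \<subseteq> topspace ?T" using \<alpha> by (auto simp: hom_def topspace_isometry_topology)
  have sC: "\<alpha> ` carrier G \<subseteq> ?C" unfolding image_closure_def by (rule closure_of_subset[OF sub])
  have "closedin ?T ?C" unfolding image_closure_def by (rule closedin_closure_of)
  then have "completely_metrizable_space (subtopology ?T ?C)"
    using completely_metrizable_isometry_topology[OF compl Q] completely_metrizable_space_closedin by blast
  moreover have "separable_space (subtopology ?T ?C)"
    unfolding separable_space_def
  proof (intro exI conjI)
    show "countable (\<alpha> ` carrier G)" using assms(2) by simp
    show "\<alpha> ` carrier G \<subseteq> topspace (subtopology ?T ?C)" using sub sC by auto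
    have "?C \<subseteq> topspace ?T" unfolding image_closure_def by (rule closure_of_subset_topspace)
    then show "subtopology ?T ?C closure_of \<alpha> ` carrier G = topspace (subtopology ?T ?C)"
      using sC unfolding closure_of_subtopology by (simp add: inf_absorb2) (auto simp: image_closure_def)
  qed
  ultimately show ?thesis
    using topological_group_subgroup[OF topological_group_isometries subgroup_image_closure[OF assms(1) \<alpha>]]
    by (simp add: polish_group_def)
qed

lemma conjugate_image_closure:
  fixes G (structure) and \<alpha> \<beta> :: "'g \<Rightarrow> 'u::metric_space \<Rightarrow> 'u"
  assumes \<alpha>: "\<alpha> \<in> hom G isometry_group" and \<beta>: "\<beta> \<in> hom G isometry_group"
    and \<phi>: "\<phi> \<in> carrier isometry_group" and \<theta>: "\<theta> ` carrier G \<subseteq> carrier G"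
    and conj: "\<And>g x. g \<in> carrier G \<Longrightarrow> \<phi> (\<alpha> g x) = \<beta> (\<theta> g) (\<phi> x)" and f: "f \<in> image_closure G \<alpha>"
  shows "\<phi> \<circ> f \<circ> inv_into UNIV \<phi> \<in> image_closure G \<beta>"
proof -
  interpret I: group "isometry_group :: ('u \<Rightarrow> 'u) monoid" by (rule isometry_group_is_group)
  note \<phi>D = isometry_groupD[OF \<phi>]
  have fC: "f \<in> carrier isometry_group" using f image_closure_iff[OF \<alpha>] by blast
  show ?thesis
    unfolding image_closure_iff[OF \<beta>]
  proof (intro conjI allI impI)
    show "\<phi> \<circ> f \<circ> inv_into UNIV \<phi> \<in> carrier isometry_group"
      using I.m_closed[OF I.m_closed[OF \<phi> fC] \<phi>D(4)] by (simp add: isometry_group_def)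
    fix Z :: "'u set" and \<eta> :: real assume "finite Z \<and> 0 < \<eta>"
    then have "finite (inv_into UNIV \<phi> ` Z) \<and> 0 < \<eta>" by simp
    then obtain g where g: "g \<in> carrier G" "\<forall>z\<in>inv_into UNIV \<phi> ` Z. dist (\<alpha> g z) (f z) < \<eta>"
      using f unfolding image_closure_iff[OF \<alpha>] by blast
    have "dist (\<beta> (\<theta> g) z) ((\<phi> \<circ> f \<circ> inv_into UNIV \<phi>) z) < \<eta>" if "z \<in> Z" for z
      using g(2) that conj[OF g(1), of "inv_into UNIV \<phi> z"] \<phi>D(2)[of z]
        \<phi>D(1)[of "\<alpha> g (inv_into UNIV \<phi> z)" "f (inv_into UNIV \<phi> z)"] by auto
    then show "\<exists>g\<in>carrier G. \<forall>z\<in>Z. dist (\<beta> g z) ((\<phi> \<circ> f \<circ> inv_into UNIV \<phi>) z) < \<eta>"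
      using g(1) \<theta> by blast
  qed
qed

lemma topologically_isomorphic_image_closures:
  fixes G (structure) and \<alpha> \<beta> :: "'g \<Rightarrow> 'u::metric_space \<Rightarrow> 'u"
  assumes \<alpha>: "\<alpha> \<in> hom G isometry_group" and \<beta>: "\<beta> \<in> hom G isometry_group"
    and \<phi>: "\<phi> \<in> carrier isometry_group" and \<theta>: "\<theta> ` carrier G = carrier G"
    and conj: "\<And>g x. g \<in> carrier G \<Longrightarrow> \<phi> (\<alpha> g x) = \<beta> (\<theta> g) (\<phi> x)"
  shows "topologically_isomorphic
     (isometry_group\<lparr>carrier := image_closure G \<alpha>\<rparr>) (subtopology isometry_topology (image_closure G \<alpha>))
     (isometry_group\<lparr>carrier := image_closure G \<beta>\<rparr>) (subtopology isometry_topology (image_closure G \<beta>))"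
proof -
  let ?A = "image_closure G \<alpha>" and ?B = "image_closure G \<beta>" and ?T = "isometry_topology :: ('u \<Rightarrow> 'u) topology"
  define \<psi> where "\<psi> = inv_into UNIV \<phi>"
  note \<phi>D = isometry_groupD[OF \<phi>]
  have \<psi>: "\<psi> \<in> carrier isometry_group" using \<phi>D(4) by (simp add: \<psi>_def)
  have \<phi>\<psi>: "\<phi> (\<psi> x) = x" "\<psi> (\<phi> x) = x" for x using \<phi>D(2,3) by (simp_all add: \<psi>_def)
  have inv\<psi>: "inv_into UNIV \<psi> = \<phi>"
    by (rule inv_unique_comp) (simp_all add: fun_eq_iff \<phi>\<psi>)
  define c where "c f = \<phi> \<circ> f \<circ> \<psi>" for f :: "'u \<Rightarrow> 'u"
  define d where "d f = \<psi> \<circ> f \<circ> \<phi>" for f :: "'u \<Rightarrow> 'u"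
  have cd: "c (d f) = f" "d (c f) = f" for f by (simp_all add: c_def d_def fun_eq_iff \<phi>\<psi>)
  have c: "c f \<in> ?B" if "f \<in> ?A" for f
    unfolding c_def \<psi>_def by (rule conjugate_image_closure[OF \<alpha> \<beta> \<phi> _ conj that]) (use \<theta> in auto)
  define \<theta>' where "\<theta>' = inv_into (carrier G) \<theta>"
  have \<theta>': "\<theta>' g \<in> carrier G" "\<theta> (\<theta>' g) = g" if "g \<in> carrier G" for g
    using that \<theta> by (auto simp: \<theta>'_def inv_into_into f_inv_into_f)
  have d: "d f \<in> ?A" if f: "f \<in> ?B" for f
  proof -
    have "\<psi> (\<beta> g x) = \<alpha> (\<theta>' g) (\<psi> x)" if g: "g \<in> carrier G" for g x
      using conj[OF \<theta>'(1)[OF g], of "\<psi> x"] \<theta>'(2)[OF g] \<phi>\<psi> by metis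
    then show ?thesis
      using conjugate_image_closure[OF \<beta> \<alpha> \<psi>, of \<theta>' f] \<theta>'(1) f by (auto simp: d_def inv\<psi>)
  qed
  have AC: "?A \<subseteq> carrier isometry_group" "?B \<subseteq> carrier isometry_group"
    using image_closure_iff[OF \<alpha>] image_closure_iff[OF \<beta>] by blast+
  have "c \<in> iso (isometry_group\<lparr>carrier := ?A\<rparr>) (isometry_group\<lparr>carrier := ?B\<rparr>)"
  proof -
    have "bij_betw c ?A ?B" by (rule bij_betwI[of _ _ _ d]) (use c d cd in auto)
    moreover have "c (f \<circ> g) = c f \<circ> c g" for f g by (simp add: c_def fun_eq_iff \<phi>\<psi>)
    ultimately show ?thesis using c by (auto simp: iso_def hom_def isometry_group_def)
  qed
  moreover have "continuous_map (subtopology ?T ?A) ?T c"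
    unfolding continuous_map_isometry_topology
  proof (intro conjI ballI allI)
    show "c f \<in> carrier isometry_group" if "f \<in> topspace (subtopology ?T ?A)" for f using c AC that by auto
    fix z
    show "continuous_map (subtopology ?T ?A) euclidean (\<lambda>f. c f z)"
    proof (rule continuous_map_from_subtopology, rule continuous_map_by_dist_bound)
      fix f0 e assume "f0 \<in> topspace ?T" "0 < (e::real)"
      then show "\<exists>r. continuous_map ?T euclideanreal r \<and> r f0 < e \<and> (\<forall>f\<in>topspace ?T. dist (c f z) (c f0 z) \<le> r f)"
        by (intro exI[of _ "\<lambda>f. dist (f (\<psi> z)) (f0 (\<psi> z))"] conjI continuous_map_dist_euclidean continuous_map_eval)
          (auto simp: c_def \<phi>D(1))
    qed
  qed
  moreover have "continuous_map (subtopology ?T ?B) ?T d"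
    unfolding continuous_map_isometry_topology
  proof (intro conjI ballI allI)
    show "d f \<in> carrier isometry_group" if "f \<in> topspace (subtopology ?T ?B)" for f using d AC that by auto
    fix z
    show "continuous_map (subtopology ?T ?B) euclidean (\<lambda>f. d f z)"
    proof (rule continuous_map_from_subtopology, rule continuous_map_by_dist_bound)
      fix f0 e assume "f0 \<in> topspace ?T" "0 < (e::real)"
      then show "\<exists>r. continuous_map ?T euclideanreal r \<and> r f0 < e \<and> (\<forall>f\<in>topspace ?T. dist (d f z) (d f0 z) \<le> r f)"
        by (intro exI[of _ "\<lambda>f. dist (f (\<phi> z)) (f0 (\<phi> z))"] conjI continuous_map_dist_euclidean continuous_map_eval)
          (auto simp: d_def isometry_groupD(1)[OF \<psi>])
    qed
  qed
  ultimately have "c \<in> iso (isometry_group\<lparr>carrier := ?A\<rparr>) (isometry_group\<lparr>carrier := ?B\<rparr>)"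
    "homeomorphic_maps (subtopology ?T ?A) (subtopology ?T ?B) c d"
    unfolding homeomorphic_maps_def using c d cd by (auto simp: continuous_map_in_subtopology)
  then show ?thesis
    unfolding topologically_isomorphic_def using homeomorphic_maps_map by blast
qed

theorem theorem0p4:
  fixes G :: "('g, 'm) monoid_scheme"
  assumes "hall_universal_group G"
    and "urysohn_space TYPE('u::metric_space)"
  shows "\<exists>(H :: ('u \<Rightarrow> 'u) monoid) T.
           polish_group H T \<and>
           comeager_in (hom_topology G)
             {\<alpha> :: 'g \<Rightarrow> 'u \<Rightarrow> 'u. \<alpha> \<in> topspace (hom_topology G) \<and>
                topologically_isomorphic
                  (isometry_group\<lparr>carrier := image_closure G \<alpha>\<rparr>)
                  (subtopology isometry_topology (image_closure G \<alpha>))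
                  H T}"
proof -
  have lf: "locally_finite_group G" and cnt: "countable (carrier G)"
    using assms(1) by (auto simp: hall_universal_group_def)
  then have gr: "group G" by (simp add: locally_finite_group_def)
  obtain Q :: "'u set" where Q: "closure Q = UNIV" "countable Q" and compl: "complete (UNIV :: 'u set)"
    using assms(2) by (auto simp: urysohn_space_def rational_urysohn_def)
  let ?X = "hom_topology G :: ('g \<Rightarrow> 'u \<Rightarrow> 'u) topology"
  let ?K = "\<lambda>\<alpha> :: 'g \<Rightarrow> 'u \<Rightarrow> 'u. isometry_group\<lparr>carrier := image_closure G \<alpha>\<rparr>"
  let ?S = "\<lambda>\<alpha> :: 'g \<Rightarrow> 'u \<Rightarrow> 'u. subtopology isometry_topology (image_closure G \<alpha>)"
  have triv: "(\<lambda>g. id) \<in> hom G (isometry_group :: ('u \<Rightarrow> 'u) monoid)"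
    by (auto simp: hom_def isometry_group_def isometric_on_def)
  \<comment> \<open>if there were no generic homomorphism, every set of homomorphisms would be comeager, and the
    trivial homomorphism would do\<close>
  obtain \<alpha>0 :: "'g \<Rightarrow> 'u \<Rightarrow> 'u" where \<alpha>0: "\<alpha>0 \<in> hom G isometry_group"
      "generic_actions G Q \<noteq> {} \<Longrightarrow> \<alpha>0 \<in> generic_actions G Q"
  proof (cases "generic_actions G Q = {}")
    case True
    then show ?thesis using that[OF triv] by blast
  next
    case False
    then obtain \<alpha> where "\<alpha> \<in> generic_actions G Q" by blast
    then show ?thesis using that[of \<alpha>] by (auto simp: generic_actions_def topspace_hom_topology)
  qed
  have iso: "topologically_isomorphic (?K \<alpha>) (?S \<alpha>) (?K \<alpha>0) (?S \<alpha>0)" if \<alpha>: "\<alpha> \<in> generic_actions G Q" for \<alpha>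
  proof -
    have "\<alpha>0 \<in> generic_actions G Q" using \<alpha> \<alpha>0(2) by blast
    from generic_actions_conjugate[OF lf cnt compl Q \<alpha> this]
    obtain \<phi> \<theta> where "\<phi> \<in> carrier isometry_group" "\<theta> ` carrier G = carrier G"
      "\<forall>g\<in>carrier G. \<forall>x. \<phi> (\<alpha> g x) = \<alpha>0 (\<theta> g) (\<phi> x)" by blast
    moreover have "\<alpha> \<in> hom G isometry_group"
      using \<alpha> by (simp add: generic_actions_def topspace_hom_topology)
    ultimately show ?thesis
      using topologically_isomorphic_image_closures[of \<alpha> G \<alpha>0 \<phi> \<theta>] \<alpha>0(1) by blast
  qed
  have "comeager_in ?X {\<alpha>. \<alpha> \<in> topspace ?X \<and> topologically_isomorphic (?K \<alpha>) (?S \<alpha>) (?K \<alpha>0) (?S \<alpha>0)}"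
  proof (rule comeager_generic_actions[OF assms Q(2)])
    show "generic_actions G Q \<subseteq> {\<alpha>. \<alpha> \<in> topspace ?X \<and> topologically_isomorphic (?K \<alpha>) (?S \<alpha>) (?K \<alpha>0) (?S \<alpha>0)}"
      using iso by (auto simp: generic_actions_def)
  qed auto
  then show ?thesis
    using polish_group_image_closure[OF gr cnt \<alpha>0(1) compl Q] by blast
qed

end
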